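(* Let $\psi(\cdot;\hbar)$, $\hbar>0$ small, be an arbitrary family of nonzero real solutions on $(x_1,x_2)$ of the equation $-\hbar^2\psi''+v\psi=\lambda\psi$, where $v$ and $\lambda$ satisfy the potential barrier assumption stated in the context. Then there exist amplitudes $A_1(\hbar),A_2(\hbar)>0$ and phases $\theta_1(\hbar),\theta_2(\hbar)\in\mathbb R/(2\pi\mathbb Z)$ such that, as $\hbar\to0$, $$\psi(x;\hbar)=A_1(\hbar)(\lambda-v(x))^{-1/4}\Big(\sin\big(\hbar^{-1}\Theta_1(x)+\theta_1(\hbar)\big)+O(\hbar)\Big),\qquad x\in(x_1,b_1),$$ $$\psi(x;\hbar)=A_2(\hbar)(\lambda-v(x))^{-1/4}\Big(\sin\big(\hbar^{-1}\Theta_2(x)+\theta_2(\hbar)\big)+O(\hbar)\Big),\qquad x\in(b_2,x_2),$$ and such that, for each sufficiently small $\hbar$, $\theta_j(\hbar)=\pi/4\ (\mathrm{mod}\ \pi)$ for at least one $j=j(\hbar)\in\{1,2\}$. These formulas are uniform in $x$ on compact subintervals of $(x_1,b_1)$ and $(b_2,x_2)$, respectively, and can be differentiated in $x$ (the remainder $O(\hbar)$ being then replaced by $O(1)$).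
   Context: Potential barrier assumption: $v$ is a real function, $v\in C^2(x_1,x_2)$ on some interval $(x_1,x_2)\subset\mathbb R$; the equation $v(x)=\lambda$ has exactly two solutions $b_1<b_2$ in $(x_1,x_2)$; $v(x)>\lambda$ for $x\in(b_1,b_2)$ and $v(x)<\lambda$ for $x\in(x_1,x_2)\setminus[b_1,b_2]$; $v$ is of class $C^3$ in some neighborhoods of $b_1$ and $b_2$; $v'(b_1)>0$ and $v'(b_2)<0$. The energy $\lambda$ is fixed. Phase functions: $\Theta_j(x)=(-1)^j\int_{b_j}^x(\lambda-v(y))^{1/2}\,dy$, $j=1,2$ ($x<b_1$ for $j=1$, $x>b_2$ for $j=2$). Convention: phases are only defined up to terms of order $O(\hbar)$, since such terms can be absorbed in the remainders. *)

theory Defs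
  imports "HOL-Analysis.Analysis"
begin

text \<open>Class C^k on an open set of reals. On an open set the iterated \<^const>\<open>deriv\<close>
  depends only on the values of the function there.\<close>

definition C_k_on :: "nat \<Rightarrow> (real \<Rightarrow> real) \<Rightarrow> real set \<Rightarrow> bool" where
  "C_k_on k f S \<longleftrightarrow>
     (\<forall>i<k. \<forall>x\<in>S. (deriv ^^ i) f differentiable (at x)) \<and> continuous_on S ((deriv ^^ k) f)"

text \<open>The endpoints of the base interval are extended reals, so that unbounded intervals are
  included; \<open>lam\<close> is the energy and \<open>b1\<close>, \<open>b2\<close> are the turning points.\<close>

definition potential_barrier ::
  "(real \<Rightarrow> real) \<Rightarrow> real \<Rightarrow> ereal \<Rightarrow> ereal \<Rightarrow> real \<Rightarrow> real \<Rightarrow> bool" where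
  "potential_barrier v lam x1 x2 b1 b2 \<longleftrightarrow>
     C_k_on 2 v (einterval x1 x2) \<and>
     b1 < b2 \<and>
     {x \<in> einterval x1 x2. v x = lam} = {b1, b2} \<and>
     (\<forall>x\<in>{b1<..<b2}. lam < v x) \<and>
     (\<forall>x\<in>einterval x1 x2 - {b1..b2}. v x < lam) \<and>
     (\<exists>U. open U \<and> b1 \<in> U \<and> U \<subseteq> einterval x1 x2 \<and> C_k_on 3 v U) \<and>
     (\<exists>U. open U \<and> b2 \<in> U \<and> U \<subseteq> einterval x1 x2 \<and> C_k_on 3 v U) \<and>
     0 < deriv v b1 \<and> deriv v b2 < 0"

definition schroedinger_solution ::
  "real \<Rightarrow> (real \<Rightarrow> real) \<Rightarrow> real \<Rightarrow> real set \<Rightarrow> (real \<Rightarrow> real) \<Rightarrow> bool" where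
  "schroedinger_solution h v lam I psi \<longleftrightarrow>
     (\<forall>x\<in>I. psi differentiable (at x) \<and> deriv psi differentiable (at x) \<and>
        - h\<^sup>2 * deriv (deriv psi) x + v x * psi x = lam * psi x)"

text \<open>The integral is oriented: for \<open>x < b\<close> it equals minus the integral over \<open>(x, b)\<close>.
  Only points where \<open>v \<le> lam\<close> between \<open>b\<close> and \<open>x\<close> are relevant.\<close>

definition phase_function :: "nat \<Rightarrow> (real \<Rightarrow> real) \<Rightarrow> real \<Rightarrow> real \<Rightarrow> real \<Rightarrow> real" where
  "phase_function j v lam b x = (- 1) ^ j * (LBINT y=ereal b..ereal x. sqrt (lam - v y))"

text \<open>The asymptotic formula with amplitude \<open>A\<close> and phase \<open>th\<close> on the interval \<open>I\<close>, as \<open>h \<rightarrow> 0+\<close>.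
  The function \<open>r\<close> is the remainder. It is O(h) and its derivative in \<open>x\<close> is O(1), both uniformly
  on compact subintervals of \<open>I\<close>; the latter says that the formula can be differentiated in \<open>x\<close>.
  The constant \<open>C\<close> and the range of \<open>h\<close> may depend on the family \<open>psi\<close> and on the subinterval.\<close>

definition wkb_asymptotics ::
  "(real \<Rightarrow> real) \<Rightarrow> real \<Rightarrow> (real \<Rightarrow> real) \<Rightarrow> real set \<Rightarrow> (real \<Rightarrow> real \<Rightarrow> real)
     \<Rightarrow> (real \<Rightarrow> real) \<Rightarrow> (real \<Rightarrow> real) \<Rightarrow> bool" where
  "wkb_asymptotics v lam Th I psi A th \<longleftrightarrow>
     (\<exists>r :: real \<Rightarrow> real \<Rightarrow> real.
        (\<forall>\<^sub>F h in at_right 0. \<forall>x\<in>I.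
           psi h x = A h * (lam - v x) powr (- 1 / 4) * (sin (Th x / h + th h) + r h x)) \<and>
        (\<forall>a c. {a..c} \<subseteq> I \<longrightarrow>
           (\<exists>C. \<forall>\<^sub>F h in at_right 0. \<forall>x\<in>{a..c}.
              \<bar>r h x\<bar> \<le> C * h \<and> r h differentiable (at x) \<and> \<bar>deriv (r h) x\<bar> \<le> C)))"

end

theory Submission
  imports Defs "HOL-Computational_Algebra.Polynomial"
begin

text \<open>Put \<open>V = v - lam\<close>, so that the equation reads \<open>h\<^sup>2 y'' = V y\<close>.

  Where \<open>V < 0\<close>, dividing \<open>y\<close> by the amplitude \<open>(-V) powr (-1/4)\<close> and using the phase as
  independent variable turns the equation into that of a harmonic oscillator with a perturbation of
  relative size \<open>h\<^sup>2\<close> whose frequency is \<open>1 / h\<close>. Variation of constants gives two coefficients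
  that drift by \<open>O(h)\<close> on compact sets (lemma \<open>coefficient_drift\<close>). Hence both asymptotic formulas hold
  with amplitude and phase read off at one base point on each side; only the value \<open>pi / 4\<close> of one
  of the two phases has to be explained.

  Inside the barrier \<open>y y'\<close> is nondecreasing. Its sign at the midpoint therefore persists on one half
  of the barrier: the solution decays when it enters the barrier from \<open>b1\<close>, or it decays when it
  enters from \<open>b2\<close>. The reflection \<open>x \<mapsto> - x\<close> exchanges the two cases. So it suffices to show that a
  solution that decays beyond a simple turning point (a recessive solution) has phase \<open>pi / 4\<close>
  modulo \<open>pi\<close>, up to \<open>O(h)\<close>.

  Two recessive solutions, which may belong to different potentials, are compared in Langer's variable \<open>s\<close>, in which both equations have the form
  \<open>w'' = (s / h\<^sup>2 + g s) w\<close> with bounded \<open>g\<close>. The derivative of their Wronskian is the product of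
  the two solutions with a bounded function, and this product is under control because
  the energy \<open>h\<^sup>2 y'\<^sup>2 - V y\<^sup>2\<close> has derivative \<open>- V' y\<^sup>2\<close>: the square mean of a recessive solution near the
  turning point is bounded by its squared amplitude. On the other hand the Wronskian, taken in the
  oscillatory region, is the product of the amplitudes times the sine of the phase difference,
  divided by \<open>h\<close>. So all recessive solutions have the same phase up to \<open>O(h)\<close>; this is theorem
  \<open>connection_universality\<close>.

  The common phase is then found from one example. The harmonic oscillator
  \<open>V x = x\<^sup>2 - 1\<close> with \<open>h = 1 / (4 k + 1)\<close> has an even recessive solution, and an even function has zero
  derivative at \<open>0\<close>, where the phase function is \<open>pi / 4\<close>; this forces the phase \<open>pi / 4\<close>
  (lemma \<open>oscillator_phase\<close>). The values \<open>1 / (4 k + 1)\<close> suffice for all small \<open>h\<close>, because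
  \<open>s / h\<^sup>2\<close> is homogeneous and the comparison works between \<open>h\<close> and \<open>h * mu ^ 6\<close> with \<open>mu\<close> in a compact
  subset of the open half line.\<close>

section \<open>Solutions and elementary estimates\<close>

text \<open>The equation as a first-order system. The derivative is a separate function, so that reflected
  solutions can be written down without mentioning \<^const>\<open>deriv\<close>.\<close>
definition sol_on :: "real \<Rightarrow> (real \<Rightarrow> real) \<Rightarrow> real set \<Rightarrow> (real \<Rightarrow> real) \<Rightarrow> (real \<Rightarrow> real) \<Rightarrow> bool" where
  "sol_on h V S y y1 \<longleftrightarrow>
     (\<forall>x\<in>S. (y has_real_derivative y1 x) (at x) \<and> (y1 has_real_derivative V x * y x / h\<^sup>2) (at x))"

lemma sol_onD:
  assumes "sol_on h V S y y1" "x \<in> S"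
  shows "(y has_real_derivative y1 x) (at x)" "(y1 has_real_derivative V x * y x / h\<^sup>2) (at x)"
  using assms by (auto simp: sol_on_def)

lemma sol_on_subset: "sol_on h V S y y1 \<Longrightarrow> T \<subseteq> S \<Longrightarrow> sol_on h V T y y1"
  by (auto simp: sol_on_def)

lemma gronwall:
  fixes F dF :: "real \<Rightarrow> real"
  assumes der: "\<And>t. t \<in> {a..c} \<Longrightarrow> (F has_real_derivative dF t) (at t)"
    and bound: "\<And>t. t \<in> {a..c} \<Longrightarrow> \<bar>dF t\<bar> \<le> K * F t"
    and x: "x \<in> {a..c}" "x0 \<in> {a..c}"
  shows "F x \<le> F x0 * exp (K * \<bar>x - x0\<bar>)"
proof (cases "x0 \<le> x")
  case True
  have "F x * exp (- K * x) \<le> F x0 * exp (- K * x0)"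
  proof (rule DERIV_nonpos_imp_nonincreasing[OF True])
    fix t assume t: "x0 \<le> t" "t \<le> x"
    then have t': "t \<in> {a..c}" using x by auto
    have "((\<lambda>t. F t * exp (- K * t)) has_real_derivative (dF t - K * F t) * exp (- K * t)) (at t)"
      by (rule derivative_eq_intros der[OF t'] refl | simp)+ (simp add: algebra_simps)
    moreover have "(dF t - K * F t) * exp (- K * t) \<le> 0"
      using bound[OF t'] by (intro mult_nonpos_nonneg) auto
    ultimately show "\<exists>y. ((\<lambda>t. F t * exp (- K * t)) has_real_derivative y) (at t) \<and> y \<le> 0" by blast
  qed
  then have "F x * exp (- K * x) * exp (K * x) \<le> F x0 * exp (- K * x0) * exp (K * x)"
    by (intro mult_right_mono) auto
  then show ?thesis using True by (simp add: mult.assoc flip: exp_add) (simp add: algebra_simps)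
next
  case False
  then have le: "x \<le> x0" by simp
  have "F x * exp (K * x) \<le> F x0 * exp (K * x0)"
  proof (rule DERIV_nonneg_imp_nondecreasing[OF le])
    fix t assume t: "x \<le> t" "t \<le> x0"
    then have t': "t \<in> {a..c}" using x by auto
    have "((\<lambda>t. F t * exp (K * t)) has_real_derivative (dF t + K * F t) * exp (K * t)) (at t)"
      by (rule derivative_eq_intros der[OF t'] refl | simp)+ (simp add: algebra_simps)
    moreover have "(dF t + K * F t) * exp (K * t) \<ge> 0"
      using bound[OF t'] by (intro mult_nonneg_nonneg) auto
    ultimately show "\<exists>y. ((\<lambda>t. F t * exp (K * t)) has_real_derivative y) (at t) \<and> 0 \<le> y" by blast
  qed
  then have "F x * exp (K * x) * exp (- K * x) \<le> F x0 * exp (K * x0) * exp (- K * x)"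
    by (intro mult_right_mono) auto
  then show ?thesis using False by (simp add: mult.assoc flip: exp_add) (simp add: algebra_simps)
qed

lemma increment_bound:
  fixes F dF :: "real \<Rightarrow> real"
  assumes der: "\<And>t. t \<in> {a..c} \<Longrightarrow> (F has_real_derivative dF t) (at t)"
    and bound: "\<And>t. t \<in> {a..c} \<Longrightarrow> \<bar>dF t\<bar> \<le> B"
    and x: "x \<in> {a..c}" "x0 \<in> {a..c}"
  shows "\<bar>F x - F x0\<bar> \<le> B * \<bar>x - x0\<bar>"
proof -
  have "norm (F x - F x0) \<le> B * norm (x - x0)"
    by (rule field_differentiable_bound[where S="{a..c}" and f'=dF])
       (use der bound x in \<open>auto intro: has_field_derivative_at_within\<close>)
  then show ?thesis by simp
qed

lemma bounded_on_interval:
  fixes g :: "real \<Rightarrow> real"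
  assumes "continuous_on {a..c} g"
  obtains K where "K \<ge> 0" "\<And>t. t \<in> {a..c} \<Longrightarrow> \<bar>g t\<bar> \<le> K"
proof -
  have "bounded (g ` {a..c})"
    using compact_continuous_image[OF assms] by (simp add: compact_imp_bounded)
  then obtain K where "0 < K" "\<forall>y\<in>g ` {a..c}. norm y \<le> K"
    unfolding bounded_pos by blast
  then show ?thesis using that[of K] by auto
qed

text \<open>Uniqueness for the Cauchy problem, by Gronwall's inequality for \<open>y\<^sup>2 + y1\<^sup>2\<close>. It guarantees that
  a nonzero solution has positive amplitude at every base point.\<close>
lemma sol_on_zero:
  assumes sol: "sol_on h V S y y1" and S: "is_interval S" and V: "continuous_on S V"
    and x0: "x0 \<in> S" "y x0 = 0" "y1 x0 = 0" and x: "x \<in> S"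
  shows "y x = 0"
proof -
  let ?a = "min x x0" and ?c = "max x x0"
  have sub: "{?a..?c} \<subseteq> S"
  proof
    fix t assume t: "t \<in> {?a..?c}"
    have "?a \<in> S" "?c \<in> S" using x x0 by (auto simp: min_def max_def)
    then show "t \<in> S" using t S unfolding is_interval_1 by (meson atLeastAtMost_iff)
  qed
  have "continuous_on {?a..?c} (\<lambda>t. V t * inverse (h\<^sup>2))"
    by (intro continuous_on_mult continuous_on_const continuous_on_subset[OF V sub])
  then obtain M where M: "\<And>t. t \<in> {?a..?c} \<Longrightarrow> \<bar>V t / h\<^sup>2\<bar> \<le> M"
    unfolding divide_inverse by (rule bounded_on_interval) blast
  define F where "F t = (y t)\<^sup>2 + (y1 t)\<^sup>2" for t
  have "F x \<le> F x0 * exp ((1 + M) * \<bar>x - x0\<bar>)"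
  proof (rule gronwall[where dF="\<lambda>t. 2 * (1 + V t / h\<^sup>2) * (y t * y1 t)"])
    fix t assume t: "t \<in> {?a..?c}"
    then have tS: "t \<in> S" using sub by auto
    show "(F has_real_derivative 2 * (1 + V t / h\<^sup>2) * (y t * y1 t)) (at t)"
      unfolding F_def
      by (rule derivative_eq_intros sol_onD[OF sol tS] refl | simp)+ (simp add: algebra_simps add_divide_distrib)
    have "\<bar>2 * (1 + V t / h\<^sup>2) * (y t * y1 t)\<bar> = \<bar>1 + V t / h\<^sup>2\<bar> * (2 * \<bar>y t * y1 t\<bar>)"
      unfolding abs_mult by simp
    also have "\<dots> \<le> (1 + M) * F t"
    proof (rule mult_mono)
      show "\<bar>1 + V t / h\<^sup>2\<bar> \<le> 1 + M" and "0 \<le> 1 + M" using M[OF t] by linarith+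
      show "2 * \<bar>y t * y1 t\<bar> \<le> F t"
        unfolding F_def abs_mult using sum_squares_bound[of "\<bar>y t\<bar>" "\<bar>y1 t\<bar>"] by simp
    qed simp
    finally show "\<bar>2 * (1 + V t / h\<^sup>2) * (y t * y1 t)\<bar> \<le> (1 + M) * F t" .
  qed auto
  then have "F x \<le> 0" by (simp add: F_def x0)
  then show ?thesis by (simp add: F_def sum_power2_le_zero_iff)
qed

section \<open>Variation of constants in the oscillatory region\<close>

text \<open>Here \<open>Th\<close> decreases: it is the phase counted from a turning point at the right end of \<open>S\<close>.\<close>
locale allowed_region =
  fixes S :: "real set" and V V1 V2 Th :: "real \<Rightarrow> real"
  assumes open_S: "open S" and interval_S: "is_interval S"
    and V_der: "\<And>x. x \<in> S \<Longrightarrow> (V has_real_derivative V1 x) (at x)"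
    and V1_der: "\<And>x. x \<in> S \<Longrightarrow> (V1 has_real_derivative V2 x) (at x)"
    and V2_cont: "continuous_on S V2"
    and V_neg: "\<And>x. x \<in> S \<Longrightarrow> V x < 0"
    and Th_der: "\<And>x. x \<in> S \<Longrightarrow> (Th has_real_derivative - sqrt (- V x)) (at x)"
begin

text \<open>The amplitude of the Liouville-Green approximation and, in the form that follows from
  \<open>amp ^ 4 * V = - 1\<close>, its two derivatives.\<close>
definition amp :: "real \<Rightarrow> real" where "amp x = (- V x) powr (- 1 / 4)"
definition amp1 :: "real \<Rightarrow> real" where "amp1 x = amp x ^ 5 * V1 x / 4"
definition amp2 :: "real \<Rightarrow> real" where "amp2 x = (5 * amp x ^ 4 * amp1 x * V1 x + amp x ^ 5 * V2 x) / 4"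

lemma amp_pos: "x \<in> S \<Longrightarrow> amp x > 0"
  using V_neg[of x] by (simp add: amp_def)

lemma amp_pow4: "x \<in> S \<Longrightarrow> amp x ^ 4 * V x = - 1"
  using V_neg[of x] by (simp add: amp_def powr_power powr_minus powr_realpow field_simps)

lemma sqrt_V: "x \<in> S \<Longrightarrow> sqrt (- V x) = 1 / (amp x)\<^sup>2"
proof -
  assume x: "x \<in> S"
  have "(1 / (amp x)\<^sup>2)\<^sup>2 = - V x"
    using amp_pow4[OF x] amp_pos[OF x] by (simp add: power_divide field_simps flip: power_mult)
  then show ?thesis
    using amp_pos[OF x] by (metis less_eq_real_def real_sqrt_abs abs_of_nonneg zero_le_divide_1_iff zero_le_power2)
qed

lemma amp_der: assumes x: "x \<in> S" shows "(amp has_real_derivative amp1 x) (at x)"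
proof -
  have "(amp has_real_derivative (- 1 / 4) * (- V x) powr (- 1 / 4 - of_nat 1) * (- V1 x)) (at x)"
    unfolding amp_def
    by (rule DERIV_fun_powr) (auto intro!: derivative_eq_intros V_der[OF x] simp: V_neg[OF x])
  moreover have "(- V x) powr (- 1 / 4 - of_nat 1) = amp x ^ 5"
    using V_neg[OF x] by (simp add: amp_def powr_power)
  ultimately show ?thesis by (simp add: amp1_def mult_ac)
qed

lemma amp1_der: assumes x: "x \<in> S" shows "(amp1 has_real_derivative amp2 x) (at x)"
  unfolding amp1_def amp2_def
  by (rule derivative_eq_intros amp_der[OF x] V1_der[OF x] refl | simp)+ (simp add: amp1_def field_simps)

lemma cont_amp: "continuous_on S amp" and cont_amp1: "continuous_on S amp1" and cont_V1: "continuous_on S V1"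
proof -
  show "continuous_on S amp"
    by (rule DERIV_continuous_on[OF has_field_derivative_at_within[OF amp_der]])
  show "continuous_on S amp1"
    by (rule DERIV_continuous_on[OF has_field_derivative_at_within[OF amp1_der]])
  show "continuous_on S V1"
    by (rule DERIV_continuous_on[OF has_field_derivative_at_within[OF V1_der]])
qed

lemma cont_amp2: "continuous_on S amp2"
  unfolding amp2_def using cont_amp cont_amp1 cont_V1 V2_cont by (intro continuous_intros) auto

text \<open>A solution measured in units of its amplitude, and \<open>h\<close> times the derivative of this quotient with
  respect to the phase \<open>Th\<close>. Without perturbation this pair would rotate with angle \<open>Th / h\<close>; the
  next two definitions undo the rotation. The last one is the squared amplitude.\<close>
definition wval :: "(real \<Rightarrow> real) \<Rightarrow> real \<Rightarrow> real" where "wval y x = y x / amp x"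
definition wslope :: "real \<Rightarrow> (real \<Rightarrow> real) \<Rightarrow> (real \<Rightarrow> real) \<Rightarrow> real \<Rightarrow> real" where
  "wslope h y y1 x = - h * (amp x * y1 x - amp1 x * y x)"
definition sin_coeff :: "real \<Rightarrow> (real \<Rightarrow> real) \<Rightarrow> (real \<Rightarrow> real) \<Rightarrow> real \<Rightarrow> real" where
  "sin_coeff h y y1 x = wval y x * sin (Th x / h) + wslope h y y1 x * cos (Th x / h)"
definition cos_coeff :: "real \<Rightarrow> (real \<Rightarrow> real) \<Rightarrow> (real \<Rightarrow> real) \<Rightarrow> real \<Rightarrow> real" where
  "cos_coeff h y y1 x = wval y x * cos (Th x / h) - wslope h y y1 x * sin (Th x / h)"
definition intensity :: "real \<Rightarrow> (real \<Rightarrow> real) \<Rightarrow> (real \<Rightarrow> real) \<Rightarrow> real \<Rightarrow> real" where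
  "intensity h y y1 x = (wval y x)\<^sup>2 + (wslope h y y1 x)\<^sup>2"

lemma intensity_nonneg: "intensity h y y1 x \<ge> 0" by (simp add: intensity_def)

lemma wval_eq: "wval y x = sin_coeff h y y1 x * sin (Th x / h) + cos_coeff h y y1 x * cos (Th x / h)"
proof -
  have "sin_coeff h y y1 x * sin (Th x / h) + cos_coeff h y y1 x * cos (Th x / h)
      = wval y x * ((sin (Th x / h))\<^sup>2 + (cos (Th x / h))\<^sup>2)"
    unfolding sin_coeff_def cos_coeff_def by algebra
  then show ?thesis by simp
qed

lemma wslope_eq: "wslope h y y1 x = sin_coeff h y y1 x * cos (Th x / h) - cos_coeff h y y1 x * sin (Th x / h)"
proof -
  have "sin_coeff h y y1 x * cos (Th x / h) - cos_coeff h y y1 x * sin (Th x / h)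
      = wslope h y y1 x * ((sin (Th x / h))\<^sup>2 + (cos (Th x / h))\<^sup>2)"
    unfolding sin_coeff_def cos_coeff_def by algebra
  then show ?thesis by simp
qed

lemma intensity_eq: "intensity h y y1 x = (sin_coeff h y y1 x)\<^sup>2 + (cos_coeff h y y1 x)\<^sup>2"
proof -
  have "(sin_coeff h y y1 x)\<^sup>2 + (cos_coeff h y y1 x)\<^sup>2
      = intensity h y y1 x * ((sin (Th x / h))\<^sup>2 + (cos (Th x / h))\<^sup>2)"
    unfolding sin_coeff_def cos_coeff_def intensity_def by algebra
  then show ?thesis by simp
qed

lemma sin_coeff_le: "\<bar>sin_coeff h y y1 x\<bar> \<le> sqrt (intensity h y y1 x)" and cos_coeff_le: "\<bar>cos_coeff h y y1 x\<bar> \<le> sqrt (intensity h y y1 x)"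
  unfolding intensity_eq[of h] by (rule real_le_rsqrt, simp)+

lemma wval_le: "\<bar>wval y x\<bar> \<le> sqrt (intensity h y y1 x)"
  unfolding intensity_def by (rule real_le_rsqrt) simp

lemma intensity_zero_imp:
  assumes x: "x \<in> S" and h: "h \<noteq> 0" and N: "intensity h y y1 x = 0"
  shows "y x = 0" "y1 x = 0"
proof -
  have "wval y x = 0" "wslope h y y1 x = 0" using N by (auto simp: intensity_def sum_power2_eq_zero_iff)
  then show "y x = 0" "y1 x = 0" using amp_pos[OF x] h by (auto simp: wval_def wslope_def)
qed

context
  fixes h y y1 x
  assumes h: "h \<noteq> 0" and sol: "sol_on h V S y y1" and x: "x \<in> S"
begin

lemma wval_der: "(wval y has_real_derivative - wslope h y y1 x / (h * (amp x)\<^sup>2)) (at x)"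
  unfolding wval_def wslope_def
  by (rule derivative_eq_intros sol_onD[OF sol x] amp_der[OF x] refl | simp)+
     (use amp_pos[OF x] h in \<open>auto simp: field_simps power2_eq_square\<close>)

text \<open>The term with \<open>amp2\<close> is the only deviation from a rotation. It is smaller than the main
  term by the factor \<open>h\<^sup>2\<close>.\<close>
lemma wslope_der: "(wslope h y y1 has_real_derivative wval y x / (h * (amp x)\<^sup>2) + h * amp x * amp2 x * wval y x) (at x)"
proof -
  have *: "V x = - 1 / amp x ^ 4" using amp_pow4[OF x] amp_pos[OF x] by (simp add: field_simps)
  show ?thesis unfolding wval_def wslope_def
    by (rule derivative_eq_intros sol_onD[OF sol x] amp_der[OF x] amp1_der[OF x] refl | simp)+
      (use amp_pos[OF x] h in \<open>simp add: * field_simps power2_eq_square power4_eq_xxxx\<close>)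
qed

lemma phase_der: "((\<lambda>x. Th x / h) has_real_derivative - 1 / (h * (amp x)\<^sup>2)) (at x)"
  by (rule derivative_eq_intros Th_der[OF x] refl | simp add: h)+ (simp add: sqrt_V[OF x])

lemma sin_coeff_der: "(sin_coeff h y y1 has_real_derivative h * (amp x * amp2 x) * wval y x * cos (Th x / h)) (at x)"
  unfolding sin_coeff_def
  by (rule derivative_eq_intros wval_der wslope_der phase_der refl | simp)+ (simp add: algebra_simps)

lemma cos_coeff_der: "(cos_coeff h y y1 has_real_derivative - h * (amp x * amp2 x) * wval y x * sin (Th x / h)) (at x)"
  unfolding cos_coeff_def
  by (rule derivative_eq_intros wval_der wslope_der phase_der refl | simp)+ (simp add: algebra_simps)

lemma intensity_der: "(intensity h y y1 has_real_derivative 2 * h * (amp x * amp2 x) * wval y x * wslope h y y1 x) (at x)"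
  unfolding intensity_def
  by (rule derivative_eq_intros wval_der wslope_der refl | simp)+ (simp add: algebra_simps)

end

text \<open>The derivatives of both coefficients are \<open>O(h)\<close> times the square root of the intensity, and the
  intensity itself varies by a bounded factor by Gronwall's inequality. The constant does not depend
  on \<open>h\<close> or on the solution.\<close>
lemma coefficient_drift:
  assumes ac: "{a..c} \<subseteq> S" and x0: "x0 \<in> S"
  obtains C where "C \<ge> 0"
    "\<And>h y y1 x. 0 < h \<Longrightarrow> h \<le> 1 \<Longrightarrow> sol_on h V S y y1 \<Longrightarrow> x \<in> {a..c} \<Longrightarrow>
       \<bar>sin_coeff h y y1 x - sin_coeff h y y1 x0\<bar> \<le> C * h * sqrt (intensity h y y1 x0) \<and>
       \<bar>cos_coeff h y y1 x - cos_coeff h y y1 x0\<bar> \<le> C * h * sqrt (intensity h y y1 x0) \<and>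
       intensity h y y1 x \<le> C * intensity h y y1 x0"
proof (cases "a \<le> c")
  case False
  then show ?thesis using that[of 0] by auto
next
  case True
  \<comment> \<open>The base point need not lie in \<open>{a..c}\<close>, so the estimates are made on the hull of both.\<close>
  define l where "l = min a x0"
  define r where "r = max c x0"
  have sub: "{l..r} \<subseteq> S"
  proof
    fix t assume t: "t \<in> {l..r}"
    have "a \<in> S" "c \<in> S" using ac True by auto
    then have "l \<in> S" "r \<in> S" using x0 by (auto simp: l_def r_def min_def max_def)
    then show "t \<in> S" using t interval_S unfolding is_interval_1 by (meson atLeastAtMost_iff)
  qed
  have ltr: "x0 \<in> {l..r}" "{a..c} \<subseteq> {l..r}" by (auto simp: l_def r_def)
  have "continuous_on {l..r} (\<lambda>x. amp x * amp2 x)"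
    by (intro continuous_on_mult continuous_on_subset[OF cont_amp sub] continuous_on_subset[OF cont_amp2 sub])
  then obtain K where K0: "K \<ge> 0" and K: "\<And>t. t \<in> {l..r} \<Longrightarrow> \<bar>amp t * amp2 t\<bar> \<le> K"
    by (rule bounded_on_interval) blast
  define D where "D = r - l"
  have D0: "D \<ge> 0" using ltr by (auto simp: D_def)
  define C where "C = exp (K * D) * (1 + K * D)"
  have growth: "intensity h y y1 t \<le> intensity h y y1 x0 * exp (K * D)"
    if h: "0 < h" "h \<le> 1" and sol: "sol_on h V S y y1" and t: "t \<in> {l..r}" for h y y1 t
  proof -
    have "intensity h y y1 t \<le> intensity h y y1 x0 * exp (K * \<bar>t - x0\<bar>)"
    proof (rule gronwall[where a=l and c=r and dF="\<lambda>x. 2 * h * (amp x * amp2 x) * wval y x * wslope h y y1 x"])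
      fix s assume s: "s \<in> {l..r}"
      show "(intensity h y y1 has_real_derivative 2 * h * (amp s * amp2 s) * wval y s * wslope h y y1 s) (at s)"
        by (rule intensity_der[OF _ sol subsetD[OF sub s]]) (use h in simp)
      have "\<bar>2 * h * (amp s * amp2 s) * wval y s * wslope h y y1 s\<bar> = h * \<bar>amp s * amp2 s\<bar> * (2 * \<bar>wval y s\<bar> * \<bar>wslope h y y1 s\<bar>)"
        using h by (simp add: abs_mult)
      also have "\<dots> \<le> K * intensity h y y1 s"
      proof (intro mult_mono)
        have "h * \<bar>amp s * amp2 s\<bar> \<le> 1 * K" using K[OF s] h by (intro mult_mono) auto
        then show "h * \<bar>amp s * amp2 s\<bar> \<le> K" by simp
        show "2 * \<bar>wval y s\<bar> * \<bar>wslope h y y1 s\<bar> \<le> intensity h y y1 s"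
          using sum_squares_bound[of "\<bar>wval y s\<bar>" "\<bar>wslope h y y1 s\<bar>"] by (simp add: intensity_def)
      qed (use K0 in auto)
      finally show "\<bar>2 * h * (amp s * amp2 s) * wval y s * wslope h y y1 s\<bar> \<le> K * intensity h y y1 s" .
    qed (use t ltr in auto)
    also have "\<dots> \<le> intensity h y y1 x0 * exp (K * D)"
      using t ltr K0 by (intro mult_left_mono intensity_nonneg) (auto simp: D_def intro!: mult_left_mono)
    finally show ?thesis .
  qed
  show ?thesis
  proof (rule that[of C])
    show "C \<ge> 0" using K0 D0 by (simp add: C_def)
    fix h y y1 x
    assume h: "0 < h" "h \<le> 1" and sol: "sol_on h V S y y1" and xin: "x \<in> {a..c}"
    then have xlr: "x \<in> {l..r}" using ltr by auto
    define B where "B = h * K * (exp (K * D) * sqrt (intensity h y y1 x0))"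
    have uB: "\<bar>wval y t\<bar> \<le> exp (K * D) * sqrt (intensity h y y1 x0)" if t: "t \<in> {l..r}" for t
    proof -
      have "\<bar>wval y t\<bar> \<le> sqrt (intensity h y y1 t)" by (rule wval_le)
      also have "\<dots> \<le> sqrt (intensity h y y1 x0 * (exp (K * D))\<^sup>2)"
      proof (intro real_sqrt_le_mono order.trans[OF growth[OF h sol t]] mult_left_mono intensity_nonneg)
        show "exp (K * D) \<le> (exp (K * D))\<^sup>2" using K0 D0 by (intro self_le_power) auto
      qed
      also have "\<dots> = exp (K * D) * sqrt (intensity h y y1 x0)" by (simp add: real_sqrt_mult)
      finally show ?thesis .
    qed
    have bd: "\<bar>h * (amp t * amp2 t) * wval y t * w\<bar> \<le> B" if t: "t \<in> {l..r}" and w: "\<bar>w\<bar> \<le> 1" for t w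
    proof -
      have "\<bar>h * (amp t * amp2 t) * wval y t * w\<bar> = h * \<bar>amp t * amp2 t\<bar> * \<bar>wval y t\<bar> * \<bar>w\<bar>"
        using h by (simp add: abs_mult)
      also have "\<dots> \<le> h * K * (exp (K * D) * sqrt (intensity h y y1 x0)) * 1"
        using h K0 intensity_nonneg by (intro mult_mono K uB t w) auto
      finally show ?thesis by (simp add: B_def)
    qed
    have BD: "B * \<bar>x - x0\<bar> \<le> C * h * sqrt (intensity h y y1 x0)"
    proof -
      have "B * \<bar>x - x0\<bar> \<le> B * D"
        using xlr ltr h K0 intensity_nonneg by (intro mult_left_mono) (auto simp: D_def B_def)
      also have "\<dots> = (exp (K * D) * (K * D)) * (h * sqrt (intensity h y y1 x0))" by (simp add: B_def)
      also have "\<dots> \<le> C * (h * sqrt (intensity h y y1 x0))"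
        using h intensity_nonneg by (intro mult_right_mono) (auto simp: C_def algebra_simps)
      finally show ?thesis by (simp add: mult_ac)
    qed
    have tS: "t \<in> S" if "t \<in> {l..r}" for t using sub that by blast
    have h0: "h \<noteq> 0" using h by simp
    have "\<bar>sin_coeff h y y1 x - sin_coeff h y y1 x0\<bar> \<le> B * \<bar>x - x0\<bar>"
      by (rule increment_bound[OF sin_coeff_der[OF h0 sol tS] bd xlr ltr(1)]) simp_all
    moreover have "\<bar>cos_coeff h y y1 x - cos_coeff h y y1 x0\<bar> \<le> B * \<bar>x - x0\<bar>"
    proof (rule increment_bound[OF cos_coeff_der[OF h0 sol tS] _ xlr ltr(1)])
      fix t assume "t \<in> {l..r}"
      then show "\<bar>- h * (amp t * amp2 t) * wval y t * sin (Th t / h)\<bar> \<le> B"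
        using bd[of t "- sin (Th t / h)"] by simp
    qed simp
    moreover have "intensity h y y1 x \<le> C * intensity h y y1 x0"
    proof -
      have "exp (K * D) \<le> C" using K0 D0 by (simp add: C_def)
      from mult_left_mono[OF this intensity_nonneg[of h y y1 x0]] growth[OF h sol xlr]
      show ?thesis by (simp add: mult.commute)
    qed
    ultimately show "\<bar>sin_coeff h y y1 x - sin_coeff h y y1 x0\<bar> \<le> C * h * sqrt (intensity h y y1 x0) \<and>
       \<bar>cos_coeff h y y1 x - cos_coeff h y y1 x0\<bar> \<le> C * h * sqrt (intensity h y y1 x0) \<and>
       intensity h y y1 x \<le> C * intensity h y y1 x0" using BD by linarith
  qed
qed

end

section \<open>Energy estimates at a turning point\<close>

text \<open>Its derivative \<open>- V' y\<^sup>2\<close> has a sign near a simple turning point and measures the square mean of \<open>y\<close>.\<close>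
definition energy :: "real \<Rightarrow> (real \<Rightarrow> real) \<Rightarrow> (real \<Rightarrow> real) \<Rightarrow> (real \<Rightarrow> real) \<Rightarrow> real \<Rightarrow> real" where
  "energy h V y y1 x = h\<^sup>2 * (y1 x)\<^sup>2 - V x * (y x)\<^sup>2"

lemma energy_der:
  assumes "h \<noteq> 0" "sol_on h V S y y1" "x \<in> S" "(V has_real_derivative V1) (at x)"
  shows "(energy h V y y1 has_real_derivative - V1 * (y x)\<^sup>2) (at x)"
  unfolding energy_def
  by (rule derivative_eq_intros sol_onD[OF assms(2,3)] assms(4) refl | simp)+
     (use assms(1) in \<open>simp add: field_simps power2_eq_square\<close>)

text \<open>The derivative of \<open>y y1\<close> is \<open>y1\<^sup>2 + V y\<^sup>2 / h\<^sup>2\<close>, which is nonnegative in a barrier. So a solution that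
  decays at one point of the barrier decays everywhere to the left of it.\<close>
lemma recessive_propagates:
  assumes sol: "sol_on h V {p..m} y y1" and V: "\<And>x. x \<in> {p..m} \<Longrightarrow> V x \<ge> 0"
    and m: "y m * y1 m \<le> 0" and x: "x \<in> {p..m}"
  shows "y x * y1 x \<le> 0"
proof -
  have "y x * y1 x \<le> y m * y1 m"
  proof (rule DERIV_nonneg_imp_nondecreasing[where f="\<lambda>x. y x * y1 x"])
    show "x \<le> m" using x by simp
    fix t assume "x \<le> t" "t \<le> m"
    then have t: "t \<in> {p..m}" using x by simp
    have "((\<lambda>x. y x * y1 x) has_real_derivative (y1 t)\<^sup>2 + V t * (y t)\<^sup>2 / h\<^sup>2) (at t)"
      by (rule derivative_eq_intros sol_onD[OF sol t] refl | simp)+ (simp add: power2_eq_square)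
    moreover have "(y1 t)\<^sup>2 + V t * (y t)\<^sup>2 / h\<^sup>2 \<ge> 0" using V[OF t] by simp
    ultimately show "\<exists>d. ((\<lambda>x. y x * y1 x) has_real_derivative d) (at t) \<and> 0 \<le> d" by blast
  qed
  then show ?thesis using m by linarith
qed

text \<open>For a solution that decays on \<open>{b..r}\<close>, everything at the far end \<open>r\<close> is controlled by the energy
  at \<open>l\<close>, that is, by the amplitude in the oscillatory region. On \<open>{l..b}\<close> the energy decreases,
  which bounds \<open>h y1\<close> and hence \<open>h y\<close> at \<open>b\<close>. Beyond \<open>b\<close> the total increase of \<open>y y1\<close> is at most
  \<open>- y b * y1 b\<close>; since the rate of increase is at least \<open>V y\<^sup>2 / h\<^sup>2\<close>, the solution itself has to be
  small at the middle of \<open>{b..r}\<close>, and then so is its slope at \<open>r\<close>, because \<open>y1\<^sup>2\<close> decreases.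
  The constant does not depend on \<open>h\<close>, on the solution, or on the position of \<open>l\<close> and \<open>r\<close>.\<close>
lemma recessive_bounds:
  fixes V V1 :: "real \<Rightarrow> real"
  assumes pos: "0 < d" "0 < v1"
    and V_der: "\<And>x. x \<in> {p..q} \<Longrightarrow> (V has_real_derivative V1 x) (at x)"
    and V1: "\<And>x. x \<in> {p..q} \<Longrightarrow> v1 \<le> V1 x"
    and V0: "V b = 0"
  obtains C where "C \<ge> 0"
    "\<And>h l r y y1. 0 < h \<Longrightarrow> h \<le> 1 \<Longrightarrow> l \<in> {p..b - d} \<Longrightarrow> r \<in> {b + d..q} \<Longrightarrow>
      sol_on h V {l..r} y y1 \<Longrightarrow> \<forall>x\<in>{b..r}. y x * y1 x \<le> 0 \<Longrightarrow>
      energy h V y y1 l - energy h V y y1 r \<le> C * energy h V y y1 l \<and>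
      (y r)\<^sup>2 \<le> C * energy h V y y1 l \<and> (y1 r)\<^sup>2 \<le> C * energy h V y y1 l"
proof -
  have V_lower: "v1 * (x' - x) \<le> V x' - V x" if "x \<le> x'" "p \<le> x" "x' \<le> q" for x x'
  proof -
    have "V x - v1 * x \<le> V x' - v1 * x'"
    proof (rule DERIV_nonneg_imp_nondecreasing[OF that(1)])
      fix t assume t: "x \<le> t" "t \<le> x'"
      then have t': "t \<in> {p..q}" using that by auto
      have "((\<lambda>t. V t - v1 * t) has_real_derivative V1 t - v1) (at t)"
        by (rule derivative_eq_intros V_der[OF t'] refl | simp)+
      then show "\<exists>y. ((\<lambda>t. V t - v1 * t) has_real_derivative y) (at t) \<and> 0 \<le> y"
        using V1[OF t'] by force
    qed
    then show ?thesis by (simp add: algebra_simps)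
  qed
  define D where "D = b - p"
  \<comment> \<open>\<open>\<eta>\<close> is a lower bound for \<open>- V l\<close>, and \<open>\<eta> / 4\<close> one for \<open>V\<close> on \<open>{c0..r}\<close> below.\<close>
  define \<eta> where "\<eta> = v1 * d"
  have eta: "\<eta> > 0" using pos by (simp add: \<eta>_def)
  define K1 where "K1 = 2 * (1 / \<eta> + D\<^sup>2)"
  define K2 where "K2 = (K1 + 1) / 2"
  define K3 where "K3 = 16 * K2 / (\<eta> * d)"
  define C where "C = 1 + \<bar>V q\<bar> * K3 + K3 + 16 * K3 / d\<^sup>2"
  have K0: "K1 \<ge> 0" "K2 \<ge> 0" "K3 \<ge> 0" using pos eta by (auto simp: K1_def K2_def K3_def)
  have C0: "C \<ge> 0" "C \<ge> K3" "C \<ge> 16 * K3 / d\<^sup>2" "C \<ge> 1 + \<bar>V q\<bar> * K3"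
    using K0 pos by (simp_all add: C_def add_nonneg_nonneg add_increasing)
  show ?thesis
  proof (rule that[OF C0(1)])
    fix h l r :: real and y y1 :: "real \<Rightarrow> real"
    assume h: "0 < h" "h \<le> 1" and l: "l \<in> {p..b - d}" and r: "r \<in> {b + d..q}"
      and sol: "sol_on h V {l..r} y y1" and "\<forall>x\<in>{b..r}. y x * y1 x \<le> 0"
    then have rec: "\<And>x. x \<in> {b..r} \<Longrightarrow> y x * y1 x \<le> 0" by blast
    have lbr: "l < b" "b < r" using l r pos by auto
    have inD: "x \<in> {p..q}" if "x \<in> {l..r}" for x using that l r by auto
    define E where "E = energy h V y y1"
    define A where "A = E l"
    have E_mono: "E t \<le> E s" if "l \<le> s" "s \<le> t" "t \<le> r" for s t
    proof (rule DERIV_nonpos_imp_nonincreasing[OF that(2)])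
      fix x assume x: "s \<le> x" "x \<le> t"
      then have x': "x \<in> {l..r}" using that by auto
      have "(E has_real_derivative - V1 x * (y x)\<^sup>2) (at x)"
        unfolding E_def using h x' by (intro energy_der[OF _ sol] V_der inD) auto
      moreover have "- V1 x * (y x)\<^sup>2 \<le> 0" using V1[OF inD[OF x']] pos by simp
      ultimately show "\<exists>y. (E has_real_derivative y) (at x) \<and> y \<le> 0" by blast
    qed
    have slope: "(h * y1 x)\<^sup>2 \<le> A" if "x \<in> {l..b}" for x
    proof -
      have "0 \<le> v1 * (b - x)" using that pos by simp
      moreover have "v1 * (b - x) \<le> - V x" using V_lower[of x b] that l r pos V0 by auto
      ultimately have "V x \<le> 0" by linarith
      then have "(h * y1 x)\<^sup>2 \<le> E x"
        by (simp add: E_def energy_def power_mult_distrib mult_nonpos_nonneg)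
      also have "\<dots> \<le> A" unfolding A_def using that lbr by (intro E_mono) auto
      finally show ?thesis .
    qed
    have A0: "A \<ge> 0" using slope[of b] lbr zero_le_power2[of "h * y1 b"] by (meson atLeastAtMost_iff less_imp_le order_refl order_trans)
    have yl: "(y l)\<^sup>2 \<le> A / \<eta>"
    proof -
      have "\<eta> \<le> v1 * (b - l)" unfolding \<eta>_def using l pos by (intro mult_left_mono) auto
      also have "\<dots> \<le> - V l" using V_lower[of l b] l r pos V0 by auto
      finally have "\<eta> * (y l)\<^sup>2 \<le> - V l * (y l)\<^sup>2" by (rule mult_right_mono) simp
      also have "\<dots> \<le> A" by (simp add: A_def E_def energy_def)
      finally show ?thesis using eta by (simp add: field_simps)
    qed
    have hyb: "(h * y b)\<^sup>2 \<le> K1 * A"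
    proof -
      have "\<bar>y b - y l\<bar> \<le> (sqrt A / h) * \<bar>b - l\<bar>"
      proof (rule increment_bound[where a=l and c=b and dF=y1])
        fix t assume t: "t \<in> {l..b}"
        then show "(y has_real_derivative y1 t) (at t)" using sol_onD(1)[OF sol] lbr by auto
        have "\<bar>h * y1 t\<bar> \<le> sqrt A" by (rule real_le_rsqrt) (use slope[OF t] in simp)
        then show "\<bar>y1 t\<bar> \<le> sqrt A / h" using h by (simp add: abs_mult field_simps)
      qed (use lbr in auto)
      also have "\<dots> \<le> (sqrt A / h) * D" using l lbr h A0 by (intro mult_left_mono) (auto simp: D_def)
      finally have "h * \<bar>y b - y l\<bar> \<le> D * sqrt A" using h by (simp add: field_simps)
      then have "(h * \<bar>y b - y l\<bar>)\<^sup>2 \<le> (D * sqrt A)\<^sup>2" using h by (intro power_mono) auto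
      then have 1: "(h * (y b - y l))\<^sup>2 \<le> D\<^sup>2 * A" using A0 by (simp add: power_mult_distrib)
      have 2: "(h * y l)\<^sup>2 \<le> A / \<eta>"
      proof -
        have "(h * y l)\<^sup>2 \<le> 1 * (y l)\<^sup>2"
          unfolding power_mult_distrib using h by (intro mult_right_mono) (auto simp: power_le_one)
        then show ?thesis using yl by simp
      qed
      have "(h * y b)\<^sup>2 \<le> 2 * ((h * y l)\<^sup>2 + (h * (y b - y l))\<^sup>2)"
        using zero_le_power2[of "h * y l - h * (y b - y l)"] by (simp add: power2_eq_square algebra_simps)
      also have "\<dots> \<le> 2 * (A / \<eta> + D\<^sup>2 * A)" using 1 2 by simp
      also have "\<dots> = K1 * A" by (simp add: K1_def algebra_simps)
      finally show ?thesis .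
    qed
    \<comment> \<open>The product is only \<open>O(1 / h\<^sup>2)\<close>; this is enough, since the growth rate of \<open>y y1\<close> has the same factor.\<close>
    have prod: "h\<^sup>2 * \<bar>y b * y1 b\<bar> \<le> K2 * A"
    proof -
      have "h\<^sup>2 * \<bar>y b * y1 b\<bar> = \<bar>h * y b\<bar> * \<bar>h * y1 b\<bar>" using h by (simp add: abs_mult power2_eq_square)
      also have "\<dots> \<le> ((h * y b)\<^sup>2 + (h * y1 b)\<^sup>2) / 2"
        using sum_squares_bound[of "\<bar>h * y b\<bar>" "\<bar>h * y1 b\<bar>"] by simp
      also have "\<dots> \<le> K2 * A" using hyb slope[of b] lbr by (simp add: K2_def algebra_simps)
      finally show ?thesis .
    qed
    have V_pos: "V x \<ge> v1 * (x - b)" if "x \<in> {b..r}" for x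
      using V_lower[of b x] that V0 lbr l r pos by auto
    have V_nn: "V x \<ge> 0" if "x \<in> {b..r}" for x
    proof -
      have "0 \<le> v1 * (x - b)" using that pos by simp
      then show ?thesis using V_pos[OF that] by linarith
    qed
    have y_dec: "(y t)\<^sup>2 \<le> (y s)\<^sup>2" if "b \<le> s" "s \<le> t" "t \<le> r" for s t
    proof (rule DERIV_nonpos_imp_nonincreasing[OF that(2)])
      fix x assume x: "s \<le> x" "x \<le> t"
      then have x': "x \<in> {l..r}" "x \<in> {b..r}" using that lbr by auto
      have "((\<lambda>x. (y x)\<^sup>2) has_real_derivative 2 * (y x * y1 x)) (at x)"
        by (rule derivative_eq_intros sol_onD[OF sol x'(1)] refl | simp)+
      then show "\<exists>d. ((\<lambda>x. (y x)\<^sup>2) has_real_derivative d) (at x) \<and> d \<le> 0"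
        using rec[OF x'(2)] by (metis mult_nonneg_nonpos zero_le_numeral)
    qed
    have y1_dec: "(y1 t)\<^sup>2 \<le> (y1 s)\<^sup>2" if "b \<le> s" "s \<le> t" "t \<le> r" for s t
    proof (rule DERIV_nonpos_imp_nonincreasing[OF that(2)])
      fix x assume x: "s \<le> x" "x \<le> t"
      then have x': "x \<in> {l..r}" "x \<in> {b..r}" using that lbr by auto
      have "((\<lambda>x. (y1 x)\<^sup>2) has_real_derivative (2 * V x / h\<^sup>2) * (y x * y1 x)) (at x)"
        by (rule derivative_eq_intros sol_onD[OF sol x'(1)] refl | simp)+
      moreover have "(2 * V x / h\<^sup>2) * (y x * y1 x) \<le> 0"
        using V_nn[OF x'(2)] by (intro mult_nonneg_nonpos rec[OF x'(2)]) auto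
      ultimately show "\<exists>d. ((\<lambda>x. (y1 x)\<^sup>2) has_real_derivative d) (at x) \<and> d \<le> 0" by blast
    qed
    define F where "F x = y x * y1 x" for x
    have F_der: "(F has_real_derivative (y1 x)\<^sup>2 + V x * (y x)\<^sup>2 / h\<^sup>2) (at x)" if "x \<in> {l..r}" for x
      unfolding F_def
      by (rule derivative_eq_intros sol_onD[OF sol that] refl | simp)+ (simp add: power2_eq_square)
    define c0 where "c0 = b + (r - b) / 4"
    define c1 where "c1 = b + (r - b) / 2"
    have c: "b < c0" "c0 < c1" "c1 < r" unfolding c0_def c1_def using lbr by (auto simp: field_simps)
    \<comment> \<open>Mean value theorem for \<open>y y1\<close> on the second quarter of \<open>{b..r}\<close>, where \<open>V\<close> is bounded below.\<close>
    have yc1: "(y c1)\<^sup>2 \<le> K3 * A"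
    proof -
      obtain \<xi> where xi: "c0 < \<xi>" "\<xi> < c1"
        and mvt: "F c1 - F c0 = (c1 - c0) * ((y1 \<xi>)\<^sup>2 + V \<xi> * (y \<xi>)\<^sup>2 / h\<^sup>2)"
        using MVT2[OF c(2), of F "\<lambda>x. (y1 x)\<^sup>2 + V x * (y x)\<^sup>2 / h\<^sup>2"] F_der c lbr by auto
      have "F b \<le> F c0"
      proof (rule DERIV_nonneg_imp_nondecreasing[of b c0 F])
        fix x assume "b \<le> x" "x \<le> c0"
        then have "x \<in> {l..r}" "x \<in> {b..r}" using c lbr by auto
        then show "\<exists>y. (F has_real_derivative y) (at x) \<and> 0 \<le> y"
          using F_der V_nn by (intro exI[of _ "(y1 x)\<^sup>2 + V x * (y x)\<^sup>2 / h\<^sup>2"]) simp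
      qed (use c in simp)
      moreover have "F c1 \<le> 0" using rec[of c1] c by (simp add: F_def)
      ultimately have 1: "h\<^sup>2 * (F c1 - F c0) \<le> K2 * A"
      proof -
        assume a: "F b \<le> F c0" "F c1 \<le> 0"
        have "F c1 - F c0 \<le> \<bar>y b * y1 b\<bar>" using a by (simp add: F_def)
        then have "h\<^sup>2 * (F c1 - F c0) \<le> h\<^sup>2 * \<bar>y b * y1 b\<bar>" by (rule mult_left_mono) simp
        then show ?thesis using prod by linarith
      qed
      have 2: "\<eta> / 4 \<le> V \<xi>"
      proof -
        have "\<eta> / 4 = v1 * (d / 4)" by (simp add: \<eta>_def)
        also have "\<dots> \<le> v1 * (\<xi> - b)" using xi r pos by (intro mult_left_mono) (auto simp: c0_def field_simps)
        also have "\<dots> \<le> V \<xi>" using V_pos[of \<xi>] xi c by auto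
        finally show ?thesis .
      qed
      have "(d / 4) * ((\<eta> / 4) * (y c1)\<^sup>2) \<le> (c1 - c0) * (V \<xi> * (y \<xi>)\<^sup>2)"
        using r pos 2 y_dec[of \<xi> c1] xi c eta by (intro mult_mono) (auto simp: c0_def c1_def)
      also have "\<dots> \<le> (c1 - c0) * (h\<^sup>2 * (y1 \<xi>)\<^sup>2 + V \<xi> * (y \<xi>)\<^sup>2)"
        using c by (intro mult_left_mono) auto
      also have "\<dots> = h\<^sup>2 * (F c1 - F c0)" unfolding mvt using h by (simp add: field_simps)
      also note 1
      finally show ?thesis using pos eta by (simp add: K3_def field_simps)
    qed
    have yr: "(y r)\<^sup>2 \<le> K3 * A" using y_dec[of c1 r] c lbr yc1 by linarith
    have y1r: "(y1 r)\<^sup>2 \<le> 16 * K3 / d\<^sup>2 * A"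
    proof -
      obtain \<xi> where xi: "c1 < \<xi>" "\<xi> < r" and mvt: "y r - y c1 = (r - c1) * y1 \<xi>"
        using MVT2[OF c(3), of y y1] sol_onD(1)[OF sol] c lbr by auto
      have "(d / 2)\<^sup>2 * (y1 r)\<^sup>2 \<le> (r - c1)\<^sup>2 * (y1 \<xi>)\<^sup>2"
        using r pos xi c lbr y1_dec[of \<xi> r]
        by (intro mult_mono power_mono[of "d / 2"]) (auto simp: c1_def field_simps)
      also have "\<dots> = (y r - y c1)\<^sup>2" unfolding mvt by (simp add: power_mult_distrib)
      also have "\<dots> \<le> 2 * ((y r)\<^sup>2 + (y c1)\<^sup>2)"
        using zero_le_power2[of "y r + y c1"] by (simp add: power2_eq_square algebra_simps)
      also have "\<dots> \<le> 4 * (K3 * A)"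
      proof -
        have "2 * (p + q) \<le> 4 * k" if "p \<le> k" "q \<le> k" for p q k :: real using that by simp
        from this[OF yr yc1] show ?thesis .
      qed
      finally show ?thesis using pos by (simp add: field_simps power2_eq_square)
    qed
    have Er: "E l - E r \<le> (1 + \<bar>V q\<bar> * K3) * A"
    proof -
      have "V r \<le> \<bar>V q\<bar>"
      proof -
        have "0 \<le> v1 * (q - r)" using r pos by simp
        moreover have "v1 * (q - r) \<le> V q - V r" using V_lower[of r q] lbr l r pos by auto
        ultimately show ?thesis by linarith
      qed
      then have "V r * (y r)\<^sup>2 \<le> \<bar>V q\<bar> * (K3 * A)" using yr by (intro mult_mono) auto
      moreover have "- E r \<le> V r * (y r)\<^sup>2" by (simp add: E_def energy_def)
      ultimately show ?thesis by (simp add: A_def algebra_simps)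
    qed
    show "energy h V y y1 l - energy h V y y1 r \<le> C * energy h V y y1 l \<and>
      (y r)\<^sup>2 \<le> C * energy h V y y1 l \<and> (y1 r)\<^sup>2 \<le> C * energy h V y y1 l"
      using Er yr y1r mult_right_mono[OF C0(2) A0] mult_right_mono[OF C0(3) A0] mult_right_mono[OF C0(4) A0]
      unfolding A_def E_def by linarith
  qed
qed

section \<open>Langer's change of variable\<close>

text \<open>Dividing a function by \<open>x\<close>, and \<open>\<integral> sqrt (t * q t) dt\<close> by a power of \<open>x\<close>, both lead to averages over the
  segment from \<open>0\<close> to \<open>x\<close>. The weight is taken in the form \<open>s ^ n\<close> with argument \<open>s\<^sup>2 * x\<close> so that the
  square root that comes from a simple turning point becomes a polynomial in \<open>s\<close>.\<close>
definition radial_mean :: "nat \<Rightarrow> (real \<Rightarrow> real) \<Rightarrow> real \<Rightarrow> real" where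
  "radial_mean n g x = integral {0..1} (\<lambda>s. s ^ n * g (s\<^sup>2 * x))"

lemma radial_in:
  fixes e x s :: real
  assumes "x \<in> {- e<..<e}" "s \<in> {0..1}"
  shows "s\<^sup>2 * x \<in> {- e<..<e}"
proof -
  have "\<bar>s\<^sup>2 * x\<bar> \<le> 1 * \<bar>x\<bar>"
    using assms(2) unfolding abs_mult by (intro mult_right_mono) (auto simp: power_le_one)
  then show ?thesis using assms(1) by auto
qed

lemma radial_mean_continuous_pair:
  fixes g :: "real \<Rightarrow> real"
  assumes "continuous_on {- e<..<e} g"
  shows "continuous_on ({- e<..<e} \<times> cbox 0 1) (\<lambda>(x, s). s ^ n * g (s\<^sup>2 * x))"
proof -
  have "continuous_on ({- e<..<e} \<times> cbox 0 1) (\<lambda>w. g ((snd w)\<^sup>2 * fst w))"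
    by (rule continuous_on_compose2[OF assms])
       (auto intro!: continuous_intros radial_in simp del: greaterThanLessThan_iff)
  then show ?thesis
    unfolding case_prod_beta by - (rule continuous_on_mult, auto intro!: continuous_intros)
qed

lemma radial_mean_continuous:
  assumes "continuous_on {- e<..<e} g"
  shows "continuous_on {- e<..<e} (radial_mean n g)"
  using integral_continuous_on_param[OF radial_mean_continuous_pair[OF assms, of n]]
  by (simp add: radial_mean_def[abs_def] cbox_interval)

lemma radial_mean_integrable:
  fixes g :: "real \<Rightarrow> real"
  assumes "continuous_on {- e<..<e} g" "x \<in> {- e<..<e}"
  shows "(\<lambda>s. s ^ n * g (s\<^sup>2 * x)) integrable_on {0..1}"
proof (rule integrable_continuous_interval)
  have "continuous_on {0..1} (\<lambda>s. g (s\<^sup>2 * x))"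
    by (rule continuous_on_compose2[OF assms(1)])
       (use radial_in[OF assms(2)] in \<open>auto intro!: continuous_intros simp del: greaterThanLessThan_iff\<close>)
  then show "continuous_on {0..1} (\<lambda>s. s ^ n * g (s\<^sup>2 * x))"
    by - (rule continuous_on_mult, auto intro!: continuous_intros)
qed

lemma radial_mean_der:
  assumes g: "\<And>x. x \<in> {- e<..<e} \<Longrightarrow> (g has_real_derivative g1 x) (at x)"
    and g1: "continuous_on {- e<..<e} g1" and x0: "x0 \<in> {- e<..<e}"
  shows "(radial_mean n g has_real_derivative radial_mean (n + 2) g1 x0) (at x0)"
proof -
  let ?U = "{- e<..<e}"
  have cont: "continuous_on ?U g"
    by (rule DERIV_continuous_on[OF has_field_derivative_at_within[OF g]])
  have "((\<lambda>x. integral (cbox 0 1) (\<lambda>s. s ^ n * g (s\<^sup>2 * x))) has_field_derivative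
      integral (cbox 0 1) (\<lambda>s. s ^ (n + 2) * g1 (s\<^sup>2 * x0))) (at x0 within ?U)"
  proof (rule leibniz_rule_field_derivative[OF _ _ _ x0])
    fix x s :: real assume x: "x \<in> ?U" and s: "s \<in> cbox 0 1"
    then have "s \<in> {0..1}" by (simp add: cbox_interval)
    moreover have "((\<lambda>x. s\<^sup>2 * x) has_real_derivative s\<^sup>2) (at x)"
      by (auto intro!: derivative_eq_intros)
    ultimately have "((\<lambda>x. g (s\<^sup>2 * x)) has_real_derivative g1 (s\<^sup>2 * x) * s\<^sup>2) (at x)"
      using DERIV_chain2[where f=g and g="\<lambda>x. s\<^sup>2 * x", OF g[OF radial_in[OF x]]] by blast
    then have "((\<lambda>x. s ^ n * g (s\<^sup>2 * x)) has_real_derivative s ^ n * (g1 (s\<^sup>2 * x) * s\<^sup>2)) (at x)"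
      by (rule DERIV_cmult)
    moreover have "s ^ n * (g1 (s\<^sup>2 * x) * s\<^sup>2) = s ^ (n + 2) * g1 (s\<^sup>2 * x)"
      unfolding power_add by simp
    ultimately show "((\<lambda>x. s ^ n * g (s\<^sup>2 * x)) has_real_derivative s ^ (n + 2) * g1 (s\<^sup>2 * x)) (at x within ?U)"
      by (auto intro: has_field_derivative_at_within)
  next
    fix x assume "x \<in> ?U"
    then show "(\<lambda>s. s ^ n * g (s\<^sup>2 * x)) integrable_on cbox 0 1"
      using radial_mean_integrable[OF cont] by (simp add: cbox_interval)
  qed (rule radial_mean_continuous_pair[OF g1], simp)
  moreover have "at x0 within ?U = at x0" using x0 by (intro at_within_open) auto
  ultimately show ?thesis by (simp add: radial_mean_def[abs_def] cbox_interval)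
qed

text \<open>Integration by parts. It expresses \<open>x\<close> times the derivative of a mean by the mean and the function.\<close>
lemma radial_mean_parts:
  assumes g: "\<And>x. x \<in> {- e<..<e} \<Longrightarrow> (g has_real_derivative g1 x) (at x)"
    and g1: "continuous_on {- e<..<e} g1" and x: "x \<in> {- e<..<e}"
  shows "2 * x * radial_mean (n + 2) g1 x = g x - (real n + 1) * radial_mean n g x"
proof -
  have cont: "continuous_on {- e<..<e} g"
    by (rule DERIV_continuous_on[OF has_field_derivative_at_within[OF g]])
  have "((\<lambda>s. (real n + 1) * (s ^ n * g (s\<^sup>2 * x)) + 2 * x * (s ^ (n + 2) * g1 (s\<^sup>2 * x)))
      has_integral (1 ^ (n + 1) * g (1\<^sup>2 * x) - 0 ^ (n + 1) * g (0\<^sup>2 * x))) {0..1}"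
  proof (rule fundamental_theorem_of_calculus)
    fix s :: real assume s: "s \<in> {0..1}"
    have "((\<lambda>s. s\<^sup>2 * x) has_real_derivative 2 * s * x) (at s)"
      by (auto intro!: derivative_eq_intros)
    from DERIV_chain2[where f=g and g="\<lambda>s. s\<^sup>2 * x", OF g[OF radial_in[OF x s]] this]
    have g_der: "((\<lambda>s. g (s\<^sup>2 * x)) has_real_derivative g1 (s\<^sup>2 * x) * (2 * s * x)) (at s)" .
    have "((\<lambda>s. s ^ (n + 1)) has_real_derivative real (n + 1) * s ^ n) (at s)"
      using DERIV_pow[of "n + 1" s] by simp
    from DERIV_mult[OF this g_der]
    have "((\<lambda>s. s ^ (n + 1) * g (s\<^sup>2 * x)) has_real_derivative
        (real (n + 1) * s ^ n) * g (s\<^sup>2 * x) + (g1 (s\<^sup>2 * x) * (2 * s * x)) * s ^ (n + 1)) (at s)" .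
    then have "((\<lambda>s. s ^ (n + 1) * g (s\<^sup>2 * x)) has_real_derivative
        (real n + 1) * (s ^ n * g (s\<^sup>2 * x)) + 2 * x * (s ^ (n + 2) * g1 (s\<^sup>2 * x))) (at s)"
      by (rule DERIV_cong) (simp add: power_add algebra_simps power2_eq_square)
    then show "((\<lambda>s. s ^ (n + 1) * g (s\<^sup>2 * x)) has_vector_derivative
        (real n + 1) * (s ^ n * g (s\<^sup>2 * x)) + 2 * x * (s ^ (n + 2) * g1 (s\<^sup>2 * x))) (at s within {0..1})"
      by (simp add: has_real_derivative_iff_has_vector_derivative has_vector_derivative_at_within)
  qed simp
  moreover have "((\<lambda>s. (real n + 1) * (s ^ n * g (s\<^sup>2 * x)) + 2 * x * (s ^ (n + 2) * g1 (s\<^sup>2 * x)))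
      has_integral ((real n + 1) * radial_mean n g x + 2 * x * radial_mean (n + 2) g1 x)) {0..1}"
    unfolding radial_mean_def
    by (intro has_integral_add has_integral_mult_right integrable_integral
        radial_mean_integrable[OF cont x] radial_mean_integrable[OF g1 x])
  ultimately show ?thesis by (auto dest: has_integral_unique)
qed

text \<open>Hadamard's lemma: a function with a zero at \<open>0\<close> is \<open>x\<close> times a function with one derivative less.\<close>
lemma radial_mean_difference_quotient:
  assumes g: "\<And>x. x \<in> {- e<..<e} \<Longrightarrow> (g has_real_derivative g1 x) (at x)"
    and g1: "continuous_on {- e<..<e} g1" and x: "x \<in> {- e<..<e}"
  shows "x * (2 * radial_mean 1 g1 x) = g x - g 0"
proof -
  have "((\<lambda>s. 2 * x * (s ^ 1 * g1 (s\<^sup>2 * x))) has_integral (g (1\<^sup>2 * x) - g (0\<^sup>2 * x))) {0..1}"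
  proof (rule fundamental_theorem_of_calculus)
    fix s :: real assume s: "s \<in> {0..1}"
    have "((\<lambda>s. s\<^sup>2 * x) has_real_derivative 2 * s * x) (at s)"
      by (auto intro!: derivative_eq_intros)
    from DERIV_chain2[where f=g and g="\<lambda>s. s\<^sup>2 * x", OF g[OF radial_in[OF x s]] this]
    have g_der: "((\<lambda>s. g (s\<^sup>2 * x)) has_real_derivative g1 (s\<^sup>2 * x) * (2 * s * x)) (at s)" .
    from g_der have "((\<lambda>s. g (s\<^sup>2 * x)) has_real_derivative 2 * x * (s ^ 1 * g1 (s\<^sup>2 * x))) (at s)"
      by (rule DERIV_cong) simp
    then show "((\<lambda>s. g (s\<^sup>2 * x)) has_vector_derivative 2 * x * (s ^ 1 * g1 (s\<^sup>2 * x))) (at s within {0..1})"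
      by (simp add: has_real_derivative_iff_has_vector_derivative has_vector_derivative_at_within)
  qed simp
  moreover have "((\<lambda>s. 2 * x * (s ^ 1 * g1 (s\<^sup>2 * x))) has_integral 2 * x * radial_mean 1 g1 x) {0..1}"
    unfolding radial_mean_def
    by (intro has_integral_mult_right integrable_integral radial_mean_integrable[OF g1 x])
  ultimately show ?thesis by (auto dest: has_integral_unique)
qed

lemma radial_mean_pos:
  assumes g: "continuous_on {- e<..<e} g" and pos: "\<And>x. x \<in> {- e<..<e} \<Longrightarrow> g x > 0"
    and x: "x \<in> {- e<..<e}"
  shows "radial_mean n g x > 0"
proof -
  have seg: "closed_segment 0 x \<subseteq> {- e<..<e}"
    using x by (intro closed_segment_subset) auto
  obtain w where w: "w \<in> closed_segment 0 x" "\<And>t. t \<in> closed_segment 0 x \<Longrightarrow> g w \<le> g t"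
    using continuous_attains_inf[of "closed_segment 0 x" g] continuous_on_subset[OF g seg] by auto
  have gw: "g w > 0" using pos w seg by auto
  have "((\<lambda>s::real. s ^ n) has_integral (1 ^ (n + 1) / (real n + 1) - 0 ^ (n + 1) / (real n + 1))) {0..1}"
  proof (rule fundamental_theorem_of_calculus)
    fix s :: real
    have "((\<lambda>s. s ^ (n + 1) / (real n + 1)) has_real_derivative real (n + 1) * s ^ n / (real n + 1)) (at s)"
      using DERIV_cdivide[OF DERIV_pow[of "n + 1" s], of "real n + 1"] by simp
    then have "((\<lambda>s. s ^ (n + 1) / (real n + 1)) has_real_derivative s ^ n) (at s)"
      by (rule DERIV_cong) (simp add: field_simps)
    then show "((\<lambda>s. s ^ (n + 1) / (real n + 1)) has_vector_derivative s ^ n) (at s within {0..1})"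
      by (simp add: has_real_derivative_iff_has_vector_derivative has_vector_derivative_at_within)
  qed simp
  then have pw: "((\<lambda>s. g w * s ^ n) has_integral g w * (1 / (real n + 1))) {0..1}"
    by (intro has_integral_mult_right) simp
  have "g w * (1 / (real n + 1)) \<le> radial_mean n g x"
    unfolding radial_mean_def
  proof (rule has_integral_le[OF pw integrable_integral[OF radial_mean_integrable[OF g x]]])
    fix s :: real assume s: "s \<in> {0..1}"
    have "s\<^sup>2 * x \<in> closed_segment 0 x"
      unfolding in_segment using s by (intro exI[of _ "s\<^sup>2"]) (auto simp: power_le_one)
    then have "s ^ n * g w \<le> s ^ n * g (s\<^sup>2 * x)"
      using s by (intro mult_left_mono w(2)) auto
    then show "g w * s ^ n \<le> s ^ n * g (s\<^sup>2 * x)" by (simp add: mult.commute)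
  qed
  moreover have "g w * (1 / (real n + 1)) > 0" using gw by simp
  ultimately show ?thesis by linarith
qed


text \<open>The change of variable \<open>x = X s\<close> is determined by \<open>V (X s) * (X' s)\<^sup>2 = s\<close>. It is recorded through
  \<open>tau\<close>, the square root of \<open>X'\<close>, because the transformed solution is \<open>y (X s) / tau s\<close>.\<close>
definition langer_map ::
  "(real \<Rightarrow> real) \<Rightarrow> (real \<Rightarrow> real) \<Rightarrow> real set \<Rightarrow> real \<Rightarrow> real \<Rightarrow> (real \<Rightarrow> real) \<Rightarrow>
    (real \<Rightarrow> real) \<Rightarrow> (real \<Rightarrow> real) \<Rightarrow> (real \<Rightarrow> real) \<Rightarrow> bool" where
  "langer_map V V1 U b Z X tau tau1 tau2 \<longleftrightarrow> Z > 0 \<and> X 0 = b \<and> continuous_on {- Z..Z} tau2 \<and>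
     (\<forall>s\<in>{- Z..Z}. X s \<in> U \<and> V1 (X s) > 0 \<and> tau s > 0 \<and> V (X s) * tau s ^ 4 = s \<and>
       (X has_real_derivative (tau s)\<^sup>2) (at s) \<and> (tau has_real_derivative tau1 s) (at s) \<and>
       (tau1 has_real_derivative tau2 s) (at s))"

text \<open>With \<open>V (b + x) = x * q x\<close>, the inverse map is \<open>x * k x powr (2/3)\<close>, where \<open>2/3 * k x\<close> is the integral of
  \<open>sqrt (t * q t)\<close> over \<open>{0..x}\<close> divided by \<open>x powr (3/2)\<close> for \<open>x > 0\<close>. Three derivatives of \<open>V\<close> give two derivatives of
  \<open>q\<close>, hence of \<open>k\<close>. The derivative of the inverse map would seem to need \<open>k'\<close>, but by integration by
  parts it equals \<open>sqrt q * k powr (- 1/3)\<close>, so it also has two derivatives.\<close>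
lemma langer_coordinate:
  fixes V V1 V2 V3 :: "real \<Rightarrow> real"
  assumes U: "open U" "b \<in> U"
    and V: "\<And>x. x \<in> U \<Longrightarrow> (V has_real_derivative V1 x) (at x)"
    and V1: "\<And>x. x \<in> U \<Longrightarrow> (V1 has_real_derivative V2 x) (at x)"
    and V2: "\<And>x. x \<in> U \<Longrightarrow> (V2 has_real_derivative V3 x) (at x)"
    and V3: "continuous_on U V3" and b: "V b = 0" "V1 b > 0"
  obtains Z X tau tau1 tau2 where "langer_map V V1 U b Z X tau tau1 tau2"
proof -
  have V1_cont: "continuous_on U V1" by (rule DERIV_continuous_on[OF has_field_derivative_at_within[OF V1]])
  obtain e0 where e0: "e0 > 0" "ball b e0 \<subseteq> U" using U by (meson open_contains_ball)
  have "isCont V1 b" using V1[OF U(2)] by (rule DERIV_isCont)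
  then have "eventually (\<lambda>x. 0 < V1 x) (at b)"
    using b(2) unfolding isCont_def by (rule order_tendstoD(1))
  then obtain e1 where e1: "e1 > 0" "\<And>x. x \<noteq> b \<Longrightarrow> dist x b < e1 \<Longrightarrow> 0 < V1 x"
    unfolding eventually_at by blast
  define e where "e = min e0 e1"
  have e: "e > 0" using e0 e1 by (simp add: e_def)
  define I where "I = {- e<..<e}"
  have inU: "b + x \<in> U" and V1_pos: "V1 (b + x) > 0" if "x \<in> I" for x
  proof -
    have "b + x \<in> ball b e0" "dist (b + x) b < e1" using that by (auto simp: I_def e_def dist_real_def)
    then show "b + x \<in> U" "V1 (b + x) > 0" using e0 e1 b(2) by (auto, metis)
  qed
  have shift: "((\<lambda>x. G (b + x)) has_real_derivative G1 (b + x)) (at x)"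
    if "\<And>x. x \<in> U \<Longrightarrow> (G has_real_derivative G1 x) (at x)" "x \<in> I" for G G1 x
  proof -
    have "((\<lambda>x. b + x) has_real_derivative 1) (at x)" by (auto intro!: derivative_eq_intros)
    from DERIV_chain2[where f=G and g="\<lambda>x. b + x", OF that(1)[OF inU[OF that(2)]] this]
    show ?thesis by simp
  qed
  have shift_cont: "continuous_on I (\<lambda>x. G (b + x))" if "continuous_on U G" for G
    by (rule continuous_on_compose2[OF that]) (auto intro!: continuous_intros inU)
  have cV1: "continuous_on I (\<lambda>x. V1 (b + x))" by (rule shift_cont[OF V1_cont])
  have cV2: "continuous_on I (\<lambda>x. V2 (b + x))"
    by (rule shift_cont[OF DERIV_continuous_on[OF has_field_derivative_at_within[OF V2]]])
  have cV3: "continuous_on I (\<lambda>x. V3 (b + x))" by (rule shift_cont[OF V3])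
  \<comment> \<open>\<open>q = V (b + x) / x\<close>, with two continuous derivatives.\<close>
  define q where "q x = 2 * radial_mean 1 (\<lambda>x. V1 (b + x)) x" for x
  define q1 where "q1 x = 2 * radial_mean 3 (\<lambda>x. V2 (b + x)) x" for x
  define q2 where "q2 x = 2 * radial_mean 5 (\<lambda>x. V3 (b + x)) x" for x
  have q_eq: "x * q x = V (b + x)" if "x \<in> I" for x
    using radial_mean_difference_quotient[where g="\<lambda>x. V (b + x)" and e=e, folded I_def, OF shift[OF V] cV1 that] b
    by (simp add: q_def)
  have q_pos: "q x > 0" if "x \<in> I" for x
    using radial_mean_pos[where e=e, folded I_def, OF cV1 V1_pos that] by (simp add: q_def)
  have q_der: "(q has_real_derivative q1 x) (at x)" if "x \<in> I" for x
    unfolding q_def q1_def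
    using DERIV_cmult[OF radial_mean_der[where e=e, folded I_def, OF shift[OF V1] cV2 that, of 1], of 2]
    by (simp add: numeral_3_eq_3)
  have q1_der: "(q1 has_real_derivative q2 x) (at x)" if "x \<in> I" for x
    unfolding q1_def q2_def
    using DERIV_cmult[OF radial_mean_der[where e=e, folded I_def, OF shift[OF V2] cV3 that, of 3], of 2]
    by simp
  have cq: "continuous_on I q" by (rule DERIV_continuous_on[OF has_field_derivative_at_within[OF q_der]])
  have cq1: "continuous_on I q1" by (rule DERIV_continuous_on[OF has_field_derivative_at_within[OF q1_der]])
  have cq2: "continuous_on I q2"
    unfolding q2_def using radial_mean_continuous[where e=e, folded I_def, OF cV3] by (intro continuous_intros)
  define r where "r x = sqrt (q x)" for x
  define r1 where "r1 x = q1 x / (2 * r x)" for x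
  define r2 where "r2 x = (q2 x * r x - q1 x * r1 x) / (2 * q x)" for x
  have r_pos: "r x > 0" and r_sq: "(r x)\<^sup>2 = q x" if "x \<in> I" for x
    using q_pos[OF that] by (auto simp: r_def)
  have r_der: "(r has_real_derivative r1 x) (at x)" if "x \<in> I" for x
    unfolding r_def r1_def
    using DERIV_chain2[OF DERIV_real_sqrt[OF q_pos[OF that]] q_der[OF that]]
    by (simp add: field_simps)
  have r1_der: "(r1 has_real_derivative r2 x) (at x)" if "x \<in> I" for x
    unfolding r1_def r2_def
    by (rule derivative_eq_intros q1_der[OF that] r_der[OF that] refl)+
       (use r_pos[OF that] r_sq[OF that] in \<open>simp_all add: field_simps power2_eq_square r1_def\<close>)
  have cr: "continuous_on I r" by (rule DERIV_continuous_on[OF has_field_derivative_at_within[OF r_der]])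
  have cr1: "continuous_on I r1" by (rule DERIV_continuous_on[OF has_field_derivative_at_within[OF r1_der]])
  have cr2: "continuous_on I r2" unfolding r2_def
    by (intro continuous_intros cq cq1 cq2 cr cr1) (use q_pos in force)
  \<comment> \<open>The integral of \<open>sqrt (t * q t)\<close>, after \<open>t = s\<^sup>2 * x\<close> and without its factor \<open>2/3 * x powr (3/2)\<close>.\<close>
  define k where "k x = 3 * radial_mean 2 r x" for x
  define k1 where "k1 x = 3 * radial_mean 4 r1 x" for x
  define k2 where "k2 x = 3 * radial_mean 6 r2 x" for x
  have k_pos: "k x > 0" if "x \<in> I" for x
    using radial_mean_pos[where e=e, folded I_def, OF cr r_pos that] by (simp add: k_def)
  have k_der: "(k has_real_derivative k1 x) (at x)" if "x \<in> I" for x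
    unfolding k_def k1_def
    using DERIV_cmult[OF radial_mean_der[where e=e, folded I_def, OF r_der cr1 that, of 2], of 3] by simp
  have k1_der: "(k1 has_real_derivative k2 x) (at x)" if "x \<in> I" for x
    unfolding k1_def k2_def
    using DERIV_cmult[OF radial_mean_der[where e=e, folded I_def, OF r1_der cr2 that, of 4], of 3] by simp
  have ck: "continuous_on I k" by (rule DERIV_continuous_on[OF has_field_derivative_at_within[OF k_der]])
  have ck1: "continuous_on I k1" by (rule DERIV_continuous_on[OF has_field_derivative_at_within[OF k1_der]])
  have ck2: "continuous_on I k2"
    unfolding k2_def using radial_mean_continuous[where e=e, folded I_def, OF cr2] by (intro continuous_intros)
  have k_eq: "k x + 2 / 3 * x * k1 x = r x" if "x \<in> I" for x
    using radial_mean_parts[where e=e, folded I_def, OF r_der cr1 that, of 2] by (simp add: k_def k1_def)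
  \<comment> \<open>\<open>exp L\<close> is \<open>tau\<close> as a function of \<open>x\<close>; the logarithm turns all fractional powers into sums.\<close>
  define L where "L x = ln (k x) / 6 - ln (q x) / 4" for x
  define L1 where "L1 x = k1 x / (6 * k x) - q1 x / (4 * q x)" for x
  define L2 where "L2 x = (k2 x * k x - (k1 x)\<^sup>2) / (6 * (k x)\<^sup>2) - (q2 x * q x - (q1 x)\<^sup>2) / (4 * (q x)\<^sup>2)" for x
  have L_der: "(L has_real_derivative L1 x) (at x)" if "x \<in> I" for x
    unfolding L_def L1_def
    by (rule derivative_eq_intros q_der[OF that] k_der[OF that] refl | simp add: q_pos[OF that] k_pos[OF that])+
  have L1_der: "(L1 has_real_derivative L2 x) (at x)" if "x \<in> I" for x
  proof -
    have "q x \<noteq> 0" "k x \<noteq> 0" using q_pos[OF that] k_pos[OF that] by auto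
    then have "((\<lambda>x. k1 x / (6 * k x) - q1 x / (4 * q x)) has_real_derivative
        (k2 x * (6 * k x) - k1 x * (6 * k1 x)) / (6 * k x * (6 * k x))
        - (q2 x * (4 * q x) - q1 x * (4 * q1 x)) / (4 * q x * (4 * q x))) (at x)"
      by (intro DERIV_diff DERIV_divide DERIV_cmult q_der k_der q1_der k1_der that) auto
    then show ?thesis
      unfolding L1_def L2_def
      by (rule DERIV_cong) (use \<open>q x \<noteq> 0\<close> \<open>k x \<noteq> 0\<close> in \<open>simp add: divide_simps power2_eq_square, algebra?\<close>)
  qed
  have cL1: "continuous_on I L1" by (rule DERIV_continuous_on[OF has_field_derivative_at_within[OF L1_der]])
  have cL: "continuous_on I L" by (rule DERIV_continuous_on[OF has_field_derivative_at_within[OF L_der]])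
  have cL2: "continuous_on I L2" unfolding L2_def
    by (intro continuous_intros cq cq1 cq2 ck ck1 ck2) (use q_pos k_pos in force)+
  define Ze where "Ze x = x * exp (2 / 3 * ln (k x))" for x
  have Ze_der: "(Ze has_real_derivative exp (- 2 * L x)) (at x)" if x: "x \<in> I" for x
  proof -
    have "(Ze has_real_derivative exp (2 / 3 * ln (k x)) * (1 + 2 / 3 * x * k1 x / k x)) (at x)"
      unfolding Ze_def
      by (rule derivative_eq_intros k_der[OF x] refl | simp add: k_pos[OF x])+ (simp add: field_simps k_pos[OF x])
    moreover have "1 + 2 / 3 * x * k1 x / k x = exp (ln (q x) / 2 - ln (k x))"
    proof -
      have "1 + 2 / 3 * x * k1 x / k x = (k x + 2 / 3 * x * k1 x) / k x"
        using k_pos[OF x] by (simp add: field_simps)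
      also have "\<dots> = r x / k x" using k_eq[OF x] by simp
      also have "r x = exp (ln (q x) / 2)" using q_pos[OF x] by (simp add: r_def ln_sqrt[symmetric])
      also have "\<dots> / k x = exp (ln (q x) / 2 - ln (k x))" using k_pos[OF x] by (simp add: exp_diff)
      finally show ?thesis .
    qed
    moreover have "exp (2 / 3 * ln (k x)) * exp (ln (q x) / 2 - ln (k x)) = exp (- 2 * L x)"
      by (simp add: L_def field_simps flip: exp_add)
    ultimately show ?thesis by simp
  qed
  have Ze_V: "V (b + x) * exp (L x) ^ 4 = Ze x" if x: "x \<in> I" for x
  proof -
    have "exp (L x) ^ 4 = exp (2 / 3 * ln (k x)) / exp (ln (q x))"
      by (simp add: L_def field_simps flip: exp_of_nat_mult exp_diff)
    then show ?thesis using q_pos[OF x] by (simp add: Ze_def q_eq[OF x, symmetric])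
  qed
  define p where "p = e / 2"
  have p: "p > 0" "{- p..p} \<subseteq> I" using e by (auto simp: p_def I_def)
  have Ze_mono: "Ze x < Ze y" if "- p \<le> x" "x < y" "y \<le> p" for x y
  proof (rule DERIV_pos_imp_increasing[OF that(2)])
    fix t assume "x \<le> t" "t \<le> y"
    then have "t \<in> I" using that p by auto
    then show "\<exists>y. (Ze has_real_derivative y) (at t) \<and> 0 < y" using Ze_der by fastforce
  qed
  have Ze_cont: "isCont Ze x" if "x \<in> {- p..p}" for x
    using Ze_der[THEN DERIV_isCont] that p by blast
  have Ze0: "Ze 0 = 0" by (simp add: Ze_def)
  define Z1 where "Z1 = min (Ze p) (- Ze (- p))"
  have Z1: "Z1 > 0" using Ze_mono[of 0 p] Ze_mono[of "- p" 0] p Ze0 by (simp add: Z1_def)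
  define g where "g = inv_into {- p..p} Ze"
  have inj: "inj_on Ze {- p..p}"
    by (rule inj_onI) (metis Ze_mono atLeastAtMost_iff less_irrefl linorder_neqE)
  have g: "g s \<in> {- p<..<p}" "Ze (g s) = s" if s: "\<bar>s\<bar> < Z1" for s
  proof -
    have "\<exists>t\<ge>- p. t \<le> p \<and> Ze t = s"
      by (rule IVT) (use s p Ze_cont in \<open>auto simp: Z1_def\<close>)
    then obtain t where t: "- p \<le> t" "t \<le> p" "Ze t = s" by blast
    then have "g s = t" using inj by (auto simp: g_def)
    moreover have "t \<noteq> p" "t \<noteq> - p" using t s by (auto simp: Z1_def)
    ultimately show "g s \<in> {- p<..<p}" "Ze (g s) = s" using t by auto
  qed
  have g_in: "g s \<in> I" if "\<bar>s\<bar> < Z1" for s using g(1)[OF that] p by auto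
  have g_cont: "isCont g s" if s: "\<bar>s\<bar> < Z1" for s
  proof -
    have "isCont g (Ze (g s))"
    proof (rule isCont_inverse_function2[of "- p" "g s" p g Ze])
      fix t assume "- p \<le> t" "t \<le> p"
      then show "g (Ze t) = t" "isCont Ze t" using inj Ze_cont by (auto simp: g_def)
    qed (use g(1)[OF s] in auto)
    then show ?thesis by (simp add: g(2)[OF s])
  qed
  have g_der: "(g has_real_derivative (exp (L (g s)))\<^sup>2) (at s)" if s: "\<bar>s\<bar> < Z1" for s
  proof -
    have "(g has_real_derivative inverse (exp (- 2 * L (g s)))) (at s)"
      by (rule DERIV_inverse_function[where f=Ze and g=g and a="- Z1" and b=Z1, OF Ze_der[OF g_in[OF s]]])
         (use s g(2) g_cont in auto)
    moreover have "inverse (exp (- 2 * L (g s))) = (exp (L (g s)))\<^sup>2"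
      by (simp flip: exp_minus exp_of_nat_mult)
    ultimately show ?thesis by simp
  qed
  define tau where "tau s = exp (L (g s))" for s
  define tau1 where "tau1 s = L1 (g s) * tau s ^ 3" for s
  define tau2 where "tau2 s = (L2 (g s) + 3 * (L1 (g s))\<^sup>2) * tau s ^ 5" for s
  have tau_der: "(tau has_real_derivative tau1 s) (at s)" if s: "\<bar>s\<bar> < Z1" for s
    unfolding tau_def tau1_def
    by (rule derivative_eq_intros DERIV_chain2[where f=L, OF L_der[OF g_in[OF s]] g_der[OF s]] refl)+
       (simp add: power2_eq_square power3_eq_cube)
  have tau1_der: "(tau1 has_real_derivative tau2 s) (at s)" if s: "\<bar>s\<bar> < Z1" for s
    unfolding tau1_def
    by (rule derivative_eq_intros DERIV_chain2[where f=L1, OF L1_der[OF g_in[OF s]] g_der[OF s]] tau_der[OF s] refl)+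
       (simp add: tau1_def tau2_def flip: tau_def, simp add: algebra_simps power_numeral_reduce)
  define Z where "Z = Z1 / 2"
  have ZZ: "\<bar>s\<bar> < Z1" if "s \<in> {- Z..Z}" for s using that Z1 by (auto simp: Z_def)
  have "langer_map V V1 U b Z (\<lambda>s. b + g s) tau tau1 tau2"
    unfolding langer_map_def
  proof (intro conjI)
    show "Z > 0" using Z1 by (simp add: Z_def)
    show "b + g 0 = b" using inj p Ze0 by (metis add.right_neutral g_def inv_into_f_f atLeastAtMost_iff less_imp_le neg_le_0_iff_le)
    have gc: "continuous_on {- Z..Z} g" using ZZ g_cont by (intro continuous_at_imp_continuous_on) auto
    show "continuous_on {- Z..Z} tau2"
      unfolding tau2_def tau_def
      by (intro continuous_intros continuous_on_compose2[OF cL2 gc] continuous_on_compose2[OF cL1 gc] continuous_on_compose2[OF cL gc])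
         (use ZZ g_in in auto)
    show "\<forall>s\<in>{- Z..Z}. b + g s \<in> U \<and> V1 (b + g s) > 0 \<and> tau s > 0 \<and> V (b + g s) * tau s ^ 4 = s \<and>
       ((\<lambda>s. b + g s) has_real_derivative (tau s)\<^sup>2) (at s) \<and> (tau has_real_derivative tau1 s) (at s) \<and>
       (tau1 has_real_derivative tau2 s) (at s)"
    proof
      fix s assume "s \<in> {- Z..Z}"
      then have s: "\<bar>s\<bar> < Z1" by (rule ZZ)
      show "b + g s \<in> U \<and> V1 (b + g s) > 0 \<and> tau s > 0 \<and> V (b + g s) * tau s ^ 4 = s \<and>
         ((\<lambda>s. b + g s) has_real_derivative (tau s)\<^sup>2) (at s) \<and> (tau has_real_derivative tau1 s) (at s) \<and>
         (tau1 has_real_derivative tau2 s) (at s)"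
        using inU[OF g_in[OF s]] V1_pos[OF g_in[OF s]] Ze_V[OF g_in[OF s]] g(2)[OF s] tau_der[OF s] tau1_der[OF s]
          DERIV_add[OF DERIV_const g_der[OF s], of b] by (simp add: tau_def)
    qed
  qed
  then show ?thesis by (rule that)
qed

section \<open>The normal form at a simple turning point\<close>

lemma positive_on_interval:
  fixes g :: "real \<Rightarrow> real"
  assumes "continuous_on {a..c} g" "\<And>t. t \<in> {a..c} \<Longrightarrow> g t > 0"
  obtains m where "m > 0" "\<And>t. t \<in> {a..c} \<Longrightarrow> m \<le> g t"
proof (cases "a \<le> c")
  case True
  then obtain w where "w \<in> {a..c}" "\<And>t. t \<in> {a..c} \<Longrightarrow> g w \<le> g t"
    using continuous_attains_inf[of "{a..c}" g] assms(1) by auto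
  then show ?thesis using that[of "g w"] assms(2) by auto
next
  case False
  then show ?thesis using that[of 1] by auto
qed

text \<open>The algebra behind the transformed equation, with \<open>T\<close>, \<open>T1\<close>, \<open>T2\<close> in place of \<open>tau\<close> and its derivatives
  and with \<open>V = s / T ^ 4\<close>: the terms in \<open>Y1\<close> cancel.\<close>
lemma liouville_identity:
  fixes T :: real
  assumes "T \<noteq> 0" "h \<noteq> 0"
  shows "T1 * Y1 + s / T ^ 4 * Y / h\<^sup>2 * T\<^sup>2 * T
      - ((T2 * Y + Y1 * T\<^sup>2 * T1) * T\<^sup>2 - T1 * Y * (2 * T * T1)) / (T\<^sup>2 * T\<^sup>2)
    = (s / h\<^sup>2 + (2 * T1\<^sup>2 / T\<^sup>2 - T2 / T)) * (Y / T)"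
proof -
  have "((T2 * Y + Y1 * T\<^sup>2 * T1) * T\<^sup>2 - T1 * Y * (2 * T * T1)) / (T\<^sup>2 * T\<^sup>2)
      = T2 * Y / T\<^sup>2 + Y1 * T1 - 2 * T1\<^sup>2 * Y / T ^ 3"
    using assms by (simp add: field_simps eval_nat_numeral)
  moreover have "(s / T ^ 4) * Y / h\<^sup>2 * T\<^sup>2 * T = s * Y / (h\<^sup>2 * T)"
    using assms by (simp add: field_simps eval_nat_numeral)
  moreover have "(s / h\<^sup>2 + (2 * T1\<^sup>2 / T\<^sup>2 - T2 / T)) * (Y / T)
      = s * Y / (h\<^sup>2 * T) + 2 * T1\<^sup>2 * Y / T ^ 3 - T2 * Y / T\<^sup>2"
    using assms by (simp add: field_simps eval_nat_numeral)
  ultimately show ?thesis by simp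
qed

text \<open>The algebra behind \<open>amp1\<close> in Langer's variable, where \<open>amp = T / t\<close> and \<open>s = - (t ^ 4)\<close>. The fourth
  hypothesis is the derivative of \<open>V * T ^ 4 = s\<close>.\<close>
lemma amplitude_slope_identity:
  fixes T t T1 v v1 :: real
  assumes "T \<noteq> 0" "t \<noteq> 0" "v * T ^ 4 = - (t ^ 4)" "v1 * T ^ 6 = 1 - 4 * T ^ 3 * T1 * v"
  shows "(T / t) ^ 5 * v1 / 4 * Y = T1 * Y / (T\<^sup>2 * t) + Y / T / (4 * t ^ 5)"
proof -
  have v: "v = - (t ^ 4) / T ^ 4" using assms by (simp add: field_simps)
  have "1 - 4 * T ^ 3 * T1 * v = 1 + 4 * T1 * t ^ 4 / T"
    using assms(1) unfolding v by (simp add: field_simps eval_nat_numeral)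
  then have "v1 * T ^ 6 = 1 + 4 * T1 * t ^ 4 / T" using assms(4) by linarith
  then have v1: "v1 = (1 + 4 * T1 * t ^ 4 / T) / T ^ 6" using assms(1) by (subst eq_divide_eq) simp
  show ?thesis unfolding v1 using assms(1,2) by (simp add: field_simps eval_nat_numeral)
qed

text \<open>The transformed solution, its derivative, and the bounded remainder of the potential in
  \<open>w'' = (s / h\<^sup>2 + normal_pot s) w\<close>.\<close>
definition normal_sol :: "(real \<Rightarrow> real) \<Rightarrow> (real \<Rightarrow> real) \<Rightarrow> (real \<Rightarrow> real) \<Rightarrow> real \<Rightarrow> real" where
  "normal_sol X tau y s = y (X s) / tau s"

definition normal_slope :: "(real \<Rightarrow> real) \<Rightarrow> (real \<Rightarrow> real) \<Rightarrow> (real \<Rightarrow> real) \<Rightarrow> (real \<Rightarrow> real) \<Rightarrow> (real \<Rightarrow> real) \<Rightarrow> real \<Rightarrow> real" where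
  "normal_slope X tau tau1 y y1 s = tau s * y1 (X s) - tau1 s * y (X s) / (tau s)\<^sup>2"

definition normal_pot :: "(real \<Rightarrow> real) \<Rightarrow> (real \<Rightarrow> real) \<Rightarrow> (real \<Rightarrow> real) \<Rightarrow> real \<Rightarrow> real" where
  "normal_pot tau tau1 tau2 s = 2 * (tau1 s)\<^sup>2 / (tau s)\<^sup>2 - tau2 s / tau s"

text \<open>A simple turning point \<open>b\<close> at the right end of an oscillatory region \<open>S\<close>; the neighbourhood \<open>U\<close>
  reaches into the barrier to the right of \<open>b\<close>.\<close>
locale turning_point = allowed_region S V V1 V2 Th for S V V1 V2 Th +
  fixes V3 :: "real \<Rightarrow> real" and U :: "real set" and b :: real
  assumes open_U: "open U" and b_in: "b \<in> U"
    and U_V: "\<And>x. x \<in> U \<Longrightarrow> (V has_real_derivative V1 x) (at x)"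
    and U_V1: "\<And>x. x \<in> U \<Longrightarrow> (V1 has_real_derivative V2 x) (at x)"
    and U_V2: "\<And>x. x \<in> U \<Longrightarrow> (V2 has_real_derivative V3 x) (at x)"
    and U_V3: "continuous_on U V3"
    and V_b: "V b = 0" and V1_b: "V1 b > 0"
    and U_below: "\<And>x. x \<in> U \<Longrightarrow> x < b \<Longrightarrow> x \<in> S" and S_below: "\<And>x. x \<in> S \<Longrightarrow> x < b"
    and Th_cont: "continuous_on (insert b S) Th" and Th_b: "Th b = 0"
begin

definition recessive :: "real \<Rightarrow> (real \<Rightarrow> real) \<Rightarrow> (real \<Rightarrow> real) \<Rightarrow> bool" where
  "recessive h y y1 \<longleftrightarrow> sol_on h V (S \<union> U) y y1 \<and> (\<forall>x\<in>U. b \<le> x \<longrightarrow> y x * y1 x \<le> 0)"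

lemma langer_map_exists: obtains Z X tau tau1 tau2 where "langer_map V V1 U b Z X tau tau1 tau2"
  by (rule langer_coordinate[OF open_U b_in U_V U_V1 U_V2 U_V3 V_b V1_b])

context
  fixes Z X tau tau1 tau2
  assumes lm: "langer_map V V1 U b Z X tau tau1 tau2"
begin

lemma
  shows Z_pos: "Z > 0" and X_0: "X 0 = b" and cont_tau2: "continuous_on {- Z..Z} tau2"
    and X_in: "s \<in> {- Z..Z} \<Longrightarrow> X s \<in> U" and V1_X: "s \<in> {- Z..Z} \<Longrightarrow> V1 (X s) > 0"
    and tau_pos: "s \<in> {- Z..Z} \<Longrightarrow> tau s > 0" and V_X: "s \<in> {- Z..Z} \<Longrightarrow> V (X s) * tau s ^ 4 = s"
    and X_der: "s \<in> {- Z..Z} \<Longrightarrow> (X has_real_derivative (tau s)\<^sup>2) (at s)"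
    and tau_der: "s \<in> {- Z..Z} \<Longrightarrow> (tau has_real_derivative tau1 s) (at s)"
    and tau1_der: "s \<in> {- Z..Z} \<Longrightarrow> (tau1 has_real_derivative tau2 s) (at s)"
  using lm unfolding langer_map_def by auto

lemma cont_X: "continuous_on {- Z..Z} X"
  by (rule DERIV_continuous_on[OF has_field_derivative_at_within[OF X_der]])
lemma cont_tau: "continuous_on {- Z..Z} tau"
  by (rule DERIV_continuous_on[OF has_field_derivative_at_within[OF tau_der]])
lemma cont_tau1: "continuous_on {- Z..Z} tau1"
  by (rule DERIV_continuous_on[OF has_field_derivative_at_within[OF tau1_der]])
lemma cont_V1_X: "continuous_on {- Z..Z} (\<lambda>s. V1 (X s))"
  by (rule continuous_on_compose2[OF DERIV_continuous_on[OF has_field_derivative_at_within[OF U_V1]] cont_X])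
     (use X_in in auto)

lemma X_less: "- Z \<le> s \<Longrightarrow> s < t \<Longrightarrow> t \<le> Z \<Longrightarrow> X s < X t"
proof (rule DERIV_pos_imp_increasing[of s t X])
  fix x assume "- Z \<le> s" "t \<le> Z" "s \<le> x" "x \<le> t"
  then have "x \<in> {- Z..Z}" by auto
  then show "\<exists>y. (X has_real_derivative y) (at x) \<and> 0 < y"
    using X_der tau_pos by (intro exI[of _ "(tau x)\<^sup>2"]) fastforce
qed

lemma X_le: "- Z \<le> s \<Longrightarrow> s \<le> t \<Longrightarrow> t \<le> Z \<Longrightarrow> X s \<le> X t"
  using X_less[of s t] by (cases "s = t") auto

lemma X_neg: "s \<in> {- Z..Z} \<Longrightarrow> s < 0 \<Longrightarrow> X s \<in> S"
  using X_less[of s 0] X_0 X_in[of s] U_below by auto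

lemma X_onto: assumes "x \<in> {X (- Z)..X Z}" obtains s where "s \<in> {- Z..Z}" "X s = x"
  using IVT'[of X "- Z" x Z] cont_X assms Z_pos by auto

lemma normal_der:
  assumes h: "h \<noteq> 0" and sol: "sol_on h V U y y1" and s: "s \<in> {- Z..Z}"
  shows "(normal_sol X tau y has_real_derivative normal_slope X tau tau1 y y1 s) (at s)"
    and "(normal_slope X tau tau1 y y1 has_real_derivative (s / h\<^sup>2 + normal_pot tau tau1 tau2 s) * normal_sol X tau y s) (at s)"
proof -
  note y_X = DERIV_chain2[where f=y, OF sol_onD(1)[OF sol X_in[OF s]] X_der[OF s]]
  note y1_X = DERIV_chain2[where f=y1, OF sol_onD(2)[OF sol X_in[OF s]] X_der[OF s]]
  have t0: "tau s \<noteq> 0" using tau_pos[OF s] by simp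
  have "((\<lambda>s. y (X s) / tau s) has_real_derivative
      (y1 (X s) * (tau s)\<^sup>2 * tau s - y (X s) * tau1 s) / (tau s * tau s)) (at s)"
    by (rule DERIV_divide[OF y_X tau_der[OF s] t0])
  then show "(normal_sol X tau y has_real_derivative normal_slope X tau tau1 y y1 s) (at s)"
    unfolding normal_sol_def[abs_def]
    by (rule DERIV_cong) (use t0 in \<open>simp add: normal_slope_def field_simps power2_eq_square\<close>)
  have "((\<lambda>s. (tau s)\<^sup>2) has_real_derivative 2 * tau s * tau1 s) (at s)"
    by (rule derivative_eq_intros tau_der[OF s] refl | simp)+
  from DERIV_diff[OF DERIV_mult[OF tau_der[OF s] y1_X] DERIV_divide[OF DERIV_mult[OF tau1_der[OF s] y_X] this]] t0
  have D: "((\<lambda>s. tau s * y1 (X s) - tau1 s * y (X s) / (tau s)\<^sup>2) has_real_derivative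
     (tau1 s * y1 (X s) + V (X s) * y (X s) / h\<^sup>2 * (tau s)\<^sup>2 * tau s
      - ((tau2 s * y (X s) + y1 (X s) * (tau s)\<^sup>2 * tau1 s) * (tau s)\<^sup>2
         - tau1 s * y (X s) * (2 * tau s * tau1 s)) / ((tau s)\<^sup>2 * (tau s)\<^sup>2))) (at s)"
    by simp
  have V: "V (X s) = s / tau s ^ 4" using V_X[OF s] t0 by (simp add: field_simps)
  from D show "(normal_slope X tau tau1 y y1 has_real_derivative (s / h\<^sup>2 + normal_pot tau tau1 tau2 s) * normal_sol X tau y s) (at s)"
    unfolding normal_slope_def[abs_def] 
    by (rule DERIV_cong) (unfold V normal_sol_def normal_pot_def, rule liouville_identity[OF t0 h])
qed

lemma normal_energy_der:
  assumes h: "h \<noteq> 0" and sol: "sol_on h V U y y1" and s: "s \<in> {- Z..Z}"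
  shows "((\<lambda>s. energy h V y y1 (X s)) has_real_derivative - (V1 (X s) * tau s ^ 4) * (normal_sol X tau y s)\<^sup>2) (at s)"
proof -
  have "tau s \<noteq> 0" using tau_pos[OF s] by simp
  then show ?thesis
    using DERIV_chain2[where f="energy h V y y1", OF energy_der[OF h sol X_in[OF s] U_V[OF X_in[OF s]]] X_der[OF s]]
    by (elim DERIV_cong) (simp add: normal_sol_def field_simps power2_eq_square power4_eq_xxxx)
qed

text \<open>In Langer's variable the amplitude is \<open>tau s / t\<close>, so the pair of normalised values depends only on
  the transformed solution, on \<open>s\<close> and on \<open>h\<close>. This is what makes solutions for different potentials
  comparable. The strict inequality makes \<open>s\<close> an interior point, where \<open>V (X s) * tau s ^ 4 = s\<close> can
  be differentiated.\<close>
lemma normal_wval_wslope: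
  assumes t: "t > 0" and s: "s = - (t ^ 4)" "s \<in> {- Z..Z}" "- Z < s"
  shows "wval y (X s) = t * normal_sol X tau y s"
    and "wslope h y y1 (X s) = - h * (normal_slope X tau tau1 y y1 s / t - normal_sol X tau y s / (4 * t ^ 5))"
proof -
  have sn: "s < 0" using t s by simp
  have XS: "X s \<in> S" by (rule X_neg[OF s(2) sn])
  have t0: "tau s > 0" by (rule tau_pos[OF s(2)])
  have fpos: "amp (X s) > 0" by (rule amp_pos[OF XS])
  have amp: "amp (X s) = tau s / t"
  proof -
    have "(amp (X s) * t) ^ 4 = amp (X s) ^ 4 * - (V (X s) * tau s ^ 4)"
      unfolding V_X[OF s(2)] by (simp add: s power_mult_distrib)
    also have "\<dots> = tau s ^ 4 * - (amp (X s) ^ 4 * V (X s))" by simp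
    also have "\<dots> = tau s ^ 4" by (simp only: amp_pow4[OF XS])
    finally have "(amp (X s) * t) ^ 4 = tau s ^ 4" .
    then have "amp (X s) * t = tau s" by (rule power_eq_imp_eq_base) (use fpos t t0 in auto)
    then show ?thesis using t by (simp add: field_simps)
  qed
  show "wval y (X s) = t * normal_sol X tau y s" using t t0 by (simp add: wval_def normal_sol_def amp)
  have "((\<lambda>s. V (X s) * tau s ^ 4) has_real_derivative
      V1 (X s) * (tau s)\<^sup>2 * tau s ^ 4 + (4 * tau s ^ 3 * tau1 s) * V (X s)) (at s)"
    using DERIV_mult[OF DERIV_chain2[where f=V, OF U_V[OF X_in[OF s(2)]] X_der[OF s(2)]] DERIV_power[OF tau_der[OF s(2)], of 4]]
    by (simp add: mult_ac)
  moreover have "((\<lambda>s. V (X s) * tau s ^ 4) has_real_derivative 1) (at s)"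
    by (rule has_field_derivative_transform_within_open[OF DERIV_ident, of "{- Z<..<0}"])
       (use V_X Z_pos s sn in auto)
  ultimately have "V1 (X s) * (tau s)\<^sup>2 * tau s ^ 4 + (4 * tau s ^ 3 * tau1 s) * V (X s) = 1"
    by (rule DERIV_unique)
  moreover have "(tau s)\<^sup>2 * tau s ^ 4 = tau s ^ 6" by (simp flip: power_add)
  ultimately have V1_eq: "V1 (X s) * tau s ^ 6 = 1 - 4 * tau s ^ 3 * tau1 s * V (X s)"
    by (simp add: mult.assoc)
  have V_eq: "V (X s) * tau s ^ 4 = - (t ^ 4)" using V_X[OF s(2)] s(1) by simp
  have amp1: "amp1 (X s) * y (X s) = tau1 s * y (X s) / ((tau s)\<^sup>2 * t) + y (X s) / tau s / (4 * t ^ 5)"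
    unfolding amp1_def amp by (rule amplitude_slope_identity[OF _ _ V_eq V1_eq]) (use t t0 in auto)
  show "wslope h y y1 (X s) = - h * (normal_slope X tau tau1 y y1 s / t - normal_sol X tau y s / (4 * t ^ 5))"
    unfolding wslope_def amp amp1 normal_sol_def normal_slope_def by (simp add: diff_divide_distrib)
qed

text \<open>Both sides have the same derivative with respect to \<open>s\<close> and vanish at the turning point.\<close>
lemma Th_langer:
  assumes t: "t > 0" and s: "s = - (t ^ 4)" "s \<in> {- Z..Z}"
  shows "Th (X s) = 2 / 3 * t ^ 6"
proof -
  have sn: "s < 0" using t s by simp
  define D where "D r = Th (X r) - 2 / 3 * (- r * sqrt (- r))" for r
  have sub: "{s..0} \<subseteq> {- Z..Z}" using s(2) Z_pos by auto
  have "D 0 = D s"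
  proof (rule DERIV_isconst_end[OF sn])
    have "X ` {s..0} \<subseteq> insert b S"
    proof
      fix x assume "x \<in> X ` {s..0}"
      then obtain r where r: "r \<in> {s..0}" "x = X r" by auto
      have rZ: "r \<in> {- Z..Z}" by (rule subsetD[OF sub r(1)])
      show "x \<in> insert b S"
      proof (cases "r = 0")
        case True
        show ?thesis unfolding r(2) True X_0 by (rule insertI1)
      next
        case False
        have "r \<le> 0" using r(1) by simp
        with False have "r < 0" by linarith
        from X_neg[OF rZ this] show ?thesis unfolding r(2) by (rule insertI2)
      qed
    qed
    then have "continuous_on {s..0} (\<lambda>r. Th (X r))"
      by (rule continuous_on_compose2[OF Th_cont continuous_on_subset[OF cont_X sub]])
    then show "continuous_on {s..0} D"
      unfolding D_def by (rule continuous_on_diff) (intro continuous_intros)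
    fix r assume r: "s < r" "r < 0"
    then have rZ: "r \<in> {- Z..Z}" using sub by auto
    have XS: "X r \<in> S" using X_neg[OF rZ] r by simp
    have t0: "tau r > 0" by (rule tau_pos[OF rZ])
    have "((\<lambda>r. - r * sqrt (- r)) has_real_derivative - (3 / 2) * sqrt (- r)) (at r)"
    proof -
      have "((\<lambda>r. sqrt (- r)) has_real_derivative inverse (sqrt (- r)) / 2 * - 1) (at r)"
        by (rule DERIV_chain2[OF DERIV_real_sqrt DERIV_minus[OF DERIV_ident]]) (use r in simp)
      from DERIV_mult[OF DERIV_minus[OF DERIV_ident] this]
      have D: "((\<lambda>r. - r * sqrt (- r)) has_real_derivative
          - 1 * sqrt (- r) + inverse (sqrt (- r)) / 2 * - 1 * - r) (at r)" .
      have "- r = sqrt (- r) * sqrt (- r)" using r by simp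
      then have "inverse (sqrt (- r)) * - r = sqrt (- r)" using r
        by (metis left_inverse mult.assoc mult_1 neg_0_less_iff_less real_sqrt_gt_0_iff less_irrefl)
      then have "inverse (sqrt (- r)) / 2 * - 1 * - r = - sqrt (- r) / 2" by (simp add: field_simps)
      with D show ?thesis by simp
    qed
    from DERIV_diff[OF DERIV_chain2[where f=Th, OF Th_der[OF XS] X_der[OF rZ]] DERIV_cmult[OF this, of "2 / 3"]]
    have "(D has_real_derivative - sqrt (- V (X r)) * (tau r)\<^sup>2 - 2 / 3 * (- (3 / 2) * sqrt (- r))) (at r)"
      unfolding D_def .
    moreover have "sqrt (- V (X r)) * (tau r)\<^sup>2 = sqrt (- r)"
    proof -
      have "sqrt (- r) = sqrt (- V (X r) * ((tau r)\<^sup>2)\<^sup>2)"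
      proof -
        have "- V (X r) * ((tau r)\<^sup>2)\<^sup>2 = - (V (X r) * tau r ^ 4)" by (simp flip: power_mult)
        then show ?thesis using V_X[OF rZ] by simp
      qed
      also have "\<dots> = sqrt (- V (X r)) * (tau r)\<^sup>2"
        by (simp only: real_sqrt_mult real_sqrt_abs abs_power2)
      finally show ?thesis by simp
    qed
    ultimately show "(D has_real_derivative 0) (at r)" by simp
  qed
  moreover have "D 0 = 0" by (simp add: D_def X_0 Th_b)
  moreover have "sqrt (- s) = t\<^sup>2" using t by (simp add: s(1) real_sqrt_unique flip: power_mult)
  ultimately have "Th (X s) = 2 / 3 * (t ^ 4 * t\<^sup>2)" by (simp add: D_def s(1))
  then show ?thesis by (simp flip: power_add)
qed

end

end

section \<open>Universality of the phase of recessive solutions\<close>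

text \<open>The derivative of the Wronskian is \<open>(k - g) * a * w\<close>. By the inequality between the arithmetic and the
  geometric mean with weight \<open>lam\<close> it is dominated by the decrease of the two energies \<open>e1\<close> and \<open>e2\<close>. So
  Wronskian plus or minus a multiple of the energies is monotone, and no integral has to be formed.
  The weight is free because the two solutions are not normalised.\<close>
lemma wronskian_bound:
  fixes a a1 w w1 e1 e2 :: "real \<Rightarrow> real"
  assumes Z: "Z \<ge> 0" and lam: "lam > 0" and c: "c > 0"
    and a: "\<And>s. s \<in> {- Z..Z} \<Longrightarrow> (a has_real_derivative a1 s) (at s)"
    and a1: "\<And>s. s \<in> {- Z..Z} \<Longrightarrow> (a1 has_real_derivative (P s + g s) * a s) (at s)"
    and w: "\<And>s. s \<in> {- Z..Z} \<Longrightarrow> (w has_real_derivative w1 s) (at s)"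
    and w1: "\<And>s. s \<in> {- Z..Z} \<Longrightarrow> (w1 has_real_derivative (P s + k s) * w s) (at s)"
    and gk: "\<And>s. s \<in> {- Z..Z} \<Longrightarrow> \<bar>k s - g s\<bar> \<le> 2 * G"
    and e1: "\<And>s. s \<in> {- Z..Z} \<Longrightarrow> (e1 has_real_derivative d1 s) (at s) \<and> d1 s \<le> - c * (a s)\<^sup>2"
    and e2: "\<And>s. s \<in> {- Z..Z} \<Longrightarrow> (e2 has_real_derivative d2 s) (at s) \<and> d2 s \<le> - c * (w s)\<^sup>2"
  shows "\<bar>a (- Z) * w1 (- Z) - a1 (- Z) * w (- Z)\<bar> \<le> \<bar>a Z * w1 Z - a1 Z * w Z\<bar>
      + G / c * (lam * (e1 (- Z) - e1 Z) + (e2 (- Z) - e2 Z) / lam)"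
proof -
  define W where "W s = a s * w1 s - a1 s * w s" for s
  define E where "E s = G / c * (lam * e1 s + e2 s / lam)" for s
  have G: "G \<ge> 0" using gk[of 0] Z by auto
  have W_der: "(W has_real_derivative (k s - g s) * (a s * w s)) (at s)" if s: "s \<in> {- Z..Z}" for s
    unfolding W_def
    by (rule DERIV_cong[OF DERIV_diff[OF DERIV_mult[OF a[OF s] w1[OF s]] DERIV_mult[OF a1[OF s] w[OF s]]]])
       (simp add: algebra_simps)
  have E_der: "(E has_real_derivative G / c * (lam * d1 s + d2 s / lam)) (at s)" if s: "s \<in> {- Z..Z}" for s
    unfolding E_def
    by (intro DERIV_cmult DERIV_add DERIV_cdivide) (use e1[OF s] e2[OF s] in auto)
  have key: "\<bar>(k s - g s) * (a s * w s)\<bar> \<le> - (G / c * (lam * d1 s + d2 s / lam))" if s: "s \<in> {- Z..Z}" for s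
  proof -
    have am: "2 * \<bar>a s * w s\<bar> \<le> lam * (a s)\<^sup>2 + (w s)\<^sup>2 / lam"
    proof -
      have "0 \<le> (lam * \<bar>a s\<bar> - \<bar>w s\<bar>)\<^sup>2 / lam" using lam by simp
      also have "\<dots> = lam * (a s)\<^sup>2 + (w s)\<^sup>2 / lam - 2 * \<bar>a s * w s\<bar>"
        using lam by (simp add: power2_diff abs_mult field_simps power2_eq_square)
      finally show ?thesis by simp
    qed
    have "\<bar>(k s - g s) * (a s * w s)\<bar> \<le> (2 * G) * \<bar>a s * w s\<bar>"
      unfolding abs_mult[of "k s - g s"] by (rule mult_right_mono[OF gk[OF s]]) simp
    also have "\<dots> = G * (2 * \<bar>a s * w s\<bar>)" by simp
    also have "\<dots> \<le> G * (lam * (a s)\<^sup>2 + (w s)\<^sup>2 / lam)" by (rule mult_left_mono[OF am G])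
    also have "\<dots> = G / c * (lam * (c * (a s)\<^sup>2) + (c * (w s)\<^sup>2) / lam)" using c by (simp add: field_simps)
    also have "\<dots> \<le> G / c * (lam * - d1 s + - d2 s / lam)"
      using e1[OF s] e2[OF s] lam G c
      by (intro mult_left_mono add_mono divide_right_mono) auto
    finally show ?thesis by (simp add: algebra_simps)
  qed
  have "W Z + E Z \<le> W (- Z) + E (- Z)"
  proof (rule DERIV_nonpos_imp_nonincreasing[of "- Z" Z "\<lambda>s. W s + E s"])
    fix s assume "- Z \<le> s" "s \<le> Z"
    then have s: "s \<in> {- Z..Z}" by simp
    show "\<exists>y. ((\<lambda>s. W s + E s) has_real_derivative y) (at s) \<and> y \<le> 0"
      using DERIV_add[OF W_der[OF s] E_der[OF s]] key[OF s] by (intro exI conjI) (assumption, linarith)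
  qed (use Z in simp)
  moreover have "- W Z + E Z \<le> - W (- Z) + E (- Z)"
  proof (rule DERIV_nonpos_imp_nonincreasing[of "- Z" Z "\<lambda>s. - W s + E s"])
    fix s assume "- Z \<le> s" "s \<le> Z"
    then have s: "s \<in> {- Z..Z}" by simp
    show "\<exists>y. ((\<lambda>s. - W s + E s) has_real_derivative y) (at s) \<and> y \<le> 0"
      using DERIV_add[OF DERIV_minus[OF W_der[OF s]] E_der[OF s]] key[OF s]
      by (intro exI conjI) (assumption, linarith)
  qed (use Z in simp)
  ultimately have "\<bar>W (- Z)\<bar> \<le> \<bar>W Z\<bar> + (E (- Z) - E Z)" by linarith
  also have "E (- Z) - E Z = G / c * (lam * (e1 (- Z) - e1 Z) + (e2 (- Z) - e2 Z) / lam)"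
    unfolding E_def by (simp only: right_diff_distrib[symmetric]) (simp add: algebra_simps diff_divide_distrib)
  finally show ?thesis unfolding W_def .
qed

context allowed_region
begin

lemma energy_le_intensity:
  assumes x: "x \<in> S" and h: "0 < h" "h \<le> 1"
  shows "energy h V y y1 x \<le> (3 / (amp x)\<^sup>2 + 2 * (amp1 x)\<^sup>2) * intensity h y y1 x"
proof -
  have f0: "amp x > 0" by (rule amp_pos[OF x])
  define p where "p = wval y x"
  define q where "q = wslope h y y1 x"
  have y: "y x = amp x * p" using f0 by (simp add: p_def wval_def)
  have hy1: "h * y1 x = h * amp1 x * p - q / amp x"
    using f0 by (simp add: q_def p_def wslope_def wval_def field_simps)
  have Vy: "- V x * (y x)\<^sup>2 = p\<^sup>2 / (amp x)\<^sup>2"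
  proof -
    have "V x = - 1 / amp x ^ 4" using amp_pow4[OF x] f0 by (simp add: field_simps)
    then show ?thesis using f0 by (simp add: y field_simps power2_eq_square power4_eq_xxxx)
  qed
  have "(h * amp1 x * p)\<^sup>2 \<le> (amp1 x * p)\<^sup>2"
  proof -
    have "h\<^sup>2 * (amp1 x * p)\<^sup>2 \<le> 1 * (amp1 x * p)\<^sup>2"
      using h by (intro mult_right_mono) (auto simp: power_le_one)
    then show ?thesis by (simp add: power_mult_distrib mult_ac)
  qed
  moreover have "(h * y1 x)\<^sup>2 \<le> 2 * ((h * amp1 x * p)\<^sup>2 + (q / amp x)\<^sup>2)"
    unfolding hy1 using zero_le_power2[of "h * amp1 x * p + q / amp x"] by (simp add: power2_sum power2_diff)
  ultimately have "(h * y1 x)\<^sup>2 \<le> 2 * (amp1 x * p)\<^sup>2 + 2 * (q / amp x)\<^sup>2" by simp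
  then have "energy h V y y1 x \<le> 2 * (amp1 x * p)\<^sup>2 + 2 * (q / amp x)\<^sup>2 + p\<^sup>2 / (amp x)\<^sup>2"
    using Vy by (simp add: energy_def power_mult_distrib)
  also have "\<dots> = 2 * (amp1 x)\<^sup>2 * p\<^sup>2 + 2 / (amp x)\<^sup>2 * q\<^sup>2 + 1 / (amp x)\<^sup>2 * p\<^sup>2"
    by (simp add: power_mult_distrib power_divide)
  also have "\<dots> \<le> (3 / (amp x)\<^sup>2 + 2 * (amp1 x)\<^sup>2) * (p\<^sup>2 + q\<^sup>2)"
  proof -
    have "0 \<le> 2 * (amp1 x)\<^sup>2 * q\<^sup>2" "0 \<le> 1 / (amp x)\<^sup>2 * q\<^sup>2" "0 \<le> 2 / (amp x)\<^sup>2 * p\<^sup>2" by simp_all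
    moreover have "(3 / (amp x)\<^sup>2 + 2 * (amp1 x)\<^sup>2) * (p\<^sup>2 + q\<^sup>2)
      = 2 * (amp1 x)\<^sup>2 * p\<^sup>2 + 2 / (amp x)\<^sup>2 * q\<^sup>2 + 1 / (amp x)\<^sup>2 * p\<^sup>2
        + (2 * (amp1 x)\<^sup>2 * q\<^sup>2 + 1 / (amp x)\<^sup>2 * q\<^sup>2 + 2 / (amp x)\<^sup>2 * p\<^sup>2)"
      by (simp add: algebra_simps add_divide_distrib)
    ultimately show ?thesis by linarith
  qed
  finally show ?thesis by (simp add: intensity_def p_def q_def)
qed

end

context turning_point
begin

text \<open>All bounds on a recessive solution in the normal form, relative to its intensity at \<open>X (- s)\<close>.
  They are uniform in \<open>s\<close>, since one of the two solutions will be taken at a rescaled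
  point that varies with \<open>h\<close>.\<close>
lemma langer_bounds:
  assumes lm: "langer_map V V1 U b Z X tau tau1 tau2" and Z0: "0 < Z0" "Z0 \<le> Z"
  obtains C c where "C \<ge> 0" "c > 0"
    "\<And>s. s \<in> {- Z..Z} \<Longrightarrow> \<bar>normal_pot tau tau1 tau2 s\<bar> \<le> C \<and> c \<le> V1 (X s) * tau s ^ 4"
    "\<And>h y y1 s. 0 < h \<Longrightarrow> h \<le> 1 \<Longrightarrow> recessive h y y1 \<Longrightarrow> s \<in> {Z0..Z} \<Longrightarrow>
      energy h V y y1 (X (- s)) - energy h V y y1 (X s) \<le> C * intensity h y y1 (X (- s)) \<and>
      (normal_sol X tau y s)\<^sup>2 \<le> C * intensity h y y1 (X (- s)) \<and>
      (normal_slope X tau tau1 y y1 s)\<^sup>2 \<le> C * intensity h y y1 (X (- s))"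
proof -
  define p where "p = X (- Z)"
  define q where "q = X Z"
  define d where "d = min (b - X (- Z0)) (X Z0 - b)"
  have d: "d > 0"
    using X_less[OF lm, of "- Z0" 0] X_less[OF lm, of 0 Z0] Z0 X_0[OF lm] by (simp add: d_def)
  obtain v1 where v1: "v1 > 0" "\<And>s. s \<in> {- Z..Z} \<Longrightarrow> v1 \<le> V1 (X s)"
    using positive_on_interval[OF cont_V1_X[OF lm] V1_X[OF lm]] by metis
  have pq_U: "x \<in> U" and pq_v1: "v1 \<le> V1 x" if "x \<in> {p..q}" for x
    using X_onto[OF lm, of x] that v1(2) X_in[OF lm] unfolding p_def q_def by metis+
  obtain C0 where C0: "C0 \<ge> 0"
    "\<And>h l r y y1. 0 < h \<Longrightarrow> h \<le> 1 \<Longrightarrow> l \<in> {p..b - d} \<Longrightarrow> r \<in> {b + d..q} \<Longrightarrow>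
      sol_on h V {l..r} y y1 \<Longrightarrow> \<forall>x\<in>{b..r}. y x * y1 x \<le> 0 \<Longrightarrow>
      energy h V y y1 l - energy h V y y1 r \<le> C0 * energy h V y y1 l \<and>
      (y r)\<^sup>2 \<le> C0 * energy h V y y1 l \<and> (y1 r)\<^sup>2 \<le> C0 * energy h V y y1 l"
    by (rule recessive_bounds[OF d v1(1) U_V[OF pq_U] pq_v1 V_b]) (assumption | metis)+
  have c_cont: "continuous_on {- Z..Z} (\<lambda>s. V1 (X s) * tau s ^ 4)"
    by (intro continuous_intros cont_V1_X[OF lm] cont_tau[OF lm])
  have c_pos: "V1 (X s) * tau s ^ 4 > 0" if "s \<in> {- Z..Z}" for s
    by (intro mult_pos_pos zero_less_power V1_X[OF lm that] tau_pos[OF lm that])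
  obtain c where c: "c > 0" "\<And>s. s \<in> {- Z..Z} \<Longrightarrow> c \<le> V1 (X s) * tau s ^ 4"
    by (rule positive_on_interval[OF c_cont c_pos]) (assumption | metis)+
  have g_cont: "continuous_on {- Z..Z} (normal_pot tau tau1 tau2)"
    unfolding normal_pot_def[abs_def]
    by (intro continuous_intros cont_tau[OF lm] cont_tau1[OF lm] cont_tau2[OF lm]) (use tau_pos[OF lm] in force)+
  obtain G where G: "G \<ge> 0" "\<And>s. s \<in> {- Z..Z} \<Longrightarrow> \<bar>normal_pot tau tau1 tau2 s\<bar> \<le> G"
    by (rule bounded_on_interval[OF g_cont]) blast
  obtain tl where tl: "tl > 0" "\<And>s. s \<in> {- Z..Z} \<Longrightarrow> tl \<le> tau s"
    by (rule positive_on_interval[OF cont_tau[OF lm] tau_pos[OF lm]]) auto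
  obtain Tu where Tu: "Tu \<ge> 0" "\<And>s. s \<in> {- Z..Z} \<Longrightarrow> \<bar>tau s\<bar> \<le> Tu"
    by (rule bounded_on_interval[OF cont_tau[OF lm]]) blast
  obtain T1 where T1: "T1 \<ge> 0" "\<And>s. s \<in> {- Z..Z} \<Longrightarrow> \<bar>tau1 s\<bar> \<le> T1"
    by (rule bounded_on_interval[OF cont_tau1[OF lm]]) blast
  have X_S: "X ` {- Z..- Z0} \<subseteq> S" using X_neg[OF lm] Z0 by auto
  have X_sub: "continuous_on {- Z..- Z0} X" by (rule continuous_on_subset[OF cont_X[OF lm]]) (use Z0 in auto)
  have "continuous_on {- Z..- Z0} (\<lambda>s. 3 / (amp (X s))\<^sup>2 + 2 * (amp1 (X s))\<^sup>2)"
    by (intro continuous_intros continuous_on_compose2[OF cont_amp X_sub X_S] continuous_on_compose2[OF cont_amp1 X_sub X_S])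
       (use X_S amp_pos in force)
  then obtain M where M: "M \<ge> 0" "\<And>s. s \<in> {- Z..- Z0} \<Longrightarrow> \<bar>3 / (amp (X s))\<^sup>2 + 2 * (amp1 (X s))\<^sup>2\<bar> \<le> M"
    by (rule bounded_on_interval) blast
  define K where "K = 1 + 1 / tl\<^sup>2 + 2 * (Tu\<^sup>2 + T1\<^sup>2 / tl ^ 4)"
  have K: "K \<ge> 0" "K \<ge> 1" "K \<ge> 1 / tl\<^sup>2" "K \<ge> 2 * (Tu\<^sup>2 + T1\<^sup>2 / tl ^ 4)"
    using tl(1) by (auto simp: K_def add_nonneg_nonneg)
  define C where "C = G + C0 * M * K"
  have C: "C \<ge> 0" "C \<ge> G" using G C0 M K by (auto simp: C_def)
  show ?thesis
  proof (rule that[OF C(1) c(1)])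
    show "\<bar>normal_pot tau tau1 tau2 s\<bar> \<le> C \<and> c \<le> V1 (X s) * tau s ^ 4" if "s \<in> {- Z..Z}" for s
      using G(2)[OF that] c(2)[OF that] C(2) by linarith
    fix h s :: real and y y1 :: "real \<Rightarrow> real"
    assume h: "0 < h" "h \<le> 1" and rec: "recessive h y y1" and s: "s \<in> {Z0..Z}"
    have sZ: "s \<in> {- Z..Z}" "- s \<in> {- Z..Z}" "- s \<in> {- Z..- Z0}" using s Z0 by auto
    define l where "l = X (- s)"
    define r where "r = X s"
    have l: "l \<in> {p..b - d}"
      using X_le[OF lm, of "- Z" "- s"] X_le[OF lm, of "- s" "- Z0"] s Z0 by (auto simp: l_def p_def d_def)
    have r: "r \<in> {b + d..q}"
      using X_le[OF lm, of s Z] X_le[OF lm, of Z0 s] s Z0 by (auto simp: r_def q_def d_def)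
    have "{l..r} \<subseteq> S \<union> U" using pq_U l r by auto
    then have sol: "sol_on h V {l..r} y y1" using rec sol_on_subset unfolding recessive_def by blast
    have "\<forall>x\<in>{b..r}. y x * y1 x \<le> 0"
      using rec pq_U l r d unfolding recessive_def by auto
    from C0(2)[OF h l r sol this]
    have E: "energy h V y y1 l - energy h V y y1 r \<le> C0 * energy h V y y1 l"
      "(y r)\<^sup>2 \<le> C0 * energy h V y y1 l" "(y1 r)\<^sup>2 \<le> C0 * energy h V y y1 l" by auto
    define n where "n = intensity h y y1 l"
    have n: "n \<ge> 0" by (simp add: n_def intensity_nonneg)
    define B where "B = C0 * M * n"
    have B: "B \<ge> 0" using C0 M n by (simp add: B_def)
    have "energy h V y y1 l \<le> M * n"
    proof -
      have "energy h V y y1 l \<le> (3 / (amp l)\<^sup>2 + 2 * (amp1 l)\<^sup>2) * n"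
        unfolding n_def by (rule energy_le_intensity[OF _ h]) (use X_S sZ in \<open>auto simp: l_def\<close>)
      also have "\<dots> \<le> M * n" using M(2)[OF sZ(3)] n by (intro mult_right_mono) (auto simp: l_def)
      finally show ?thesis .
    qed
    then have "C0 * energy h V y y1 l \<le> B" unfolding B_def mult.assoc using C0(1) by (rule mult_left_mono)
    then have E': "energy h V y y1 l - energy h V y y1 r \<le> B" "(y r)\<^sup>2 \<le> B" "(y1 r)\<^sup>2 \<le> B"
      using E by linarith+
    have KB: "K * B \<le> C * n"
      using G(1) n by (simp add: C_def B_def algebra_simps)
    have t: "tl \<le> tau s" "\<bar>tau s\<bar> \<le> Tu" "\<bar>tau1 s\<bar> \<le> T1" using tl Tu T1 sZ by auto
    have "B \<le> K * B" using mult_right_mono[OF K(2) B] by simp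
    then have 1: "energy h V y y1 l - energy h V y y1 r \<le> C * n" using E' KB by linarith
    have 2: "(normal_sol X tau y s)\<^sup>2 \<le> C * n"
    proof -
      have "(normal_sol X tau y s)\<^sup>2 = (y r)\<^sup>2 / (tau s)\<^sup>2" by (simp add: normal_sol_def r_def power_divide)
      also have "\<dots> \<le> B / tl\<^sup>2" using E' t tl(1) B by (intro frac_le power_mono) auto
      also have "\<dots> \<le> K * B" using mult_right_mono[OF K(3) B] by simp
      finally show ?thesis using KB by linarith
    qed
    have 3: "(normal_slope X tau tau1 y y1 s)\<^sup>2 \<le> C * n"
    proof -
      have "(normal_slope X tau tau1 y y1 s)\<^sup>2 \<le> 2 * ((tau s * y1 r)\<^sup>2 + (tau1 s * y r / (tau s)\<^sup>2)\<^sup>2)"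
        unfolding normal_slope_def r_def[symmetric]
        using zero_le_power2[of "tau s * y1 r + tau1 s * y r / (tau s)\<^sup>2"] by (simp add: power2_sum power2_diff)
      moreover have "(tau s * y1 r)\<^sup>2 \<le> Tu\<^sup>2 * B"
        unfolding power_mult_distrib using t E' Tu(1)
        by (intro mult_mono) (auto simp: abs_le_square_iff[symmetric])
      moreover have "(tau1 s * y r / (tau s)\<^sup>2)\<^sup>2 \<le> T1\<^sup>2 * B / tl ^ 4"
      proof -
        have "(tau1 s * y r / (tau s)\<^sup>2)\<^sup>2 = ((tau1 s)\<^sup>2 * (y r)\<^sup>2) / tau s ^ 4"
          by (simp add: power_mult_distrib power_divide flip: power_mult)
        also have "\<dots> \<le> T1\<^sup>2 * B / tl ^ 4"
        proof -
          have "(tau1 s)\<^sup>2 \<le> T1\<^sup>2" using t(3) T1(1) by (simp flip: abs_le_square_iff)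
          then have "(tau1 s)\<^sup>2 * (y r)\<^sup>2 \<le> T1\<^sup>2 * B" using E'(2) by (intro mult_mono) auto
          moreover have "tl ^ 4 \<le> tau s ^ 4" using t tl(1) by (intro power_mono) auto
          ultimately show ?thesis using tl(1) B by (intro frac_le) auto
        qed
        finally show ?thesis .
      qed
      ultimately have "(normal_slope X tau tau1 y y1 s)\<^sup>2 \<le> 2 * (Tu\<^sup>2 * B + T1\<^sup>2 * B / tl ^ 4)"
        by (meson add_mono mult_left_mono order_trans zero_le_numeral)
      also have "2 * (Tu\<^sup>2 * B + T1\<^sup>2 * B / tl ^ 4) = 2 * (Tu\<^sup>2 + T1\<^sup>2 / tl ^ 4) * B" by (simp add: algebra_simps)
      also have "\<dots> \<le> K * B" by (rule mult_right_mono[OF K(4) B])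
      finally show ?thesis using KB by linarith
    qed
    show "energy h V y y1 (X (- s)) - energy h V y y1 (X s) \<le> C * intensity h y y1 (X (- s)) \<and>
      (normal_sol X tau y s)\<^sup>2 \<le> C * intensity h y y1 (X (- s)) \<and>
      (normal_slope X tau tau1 y y1 s)\<^sup>2 \<le> C * intensity h y y1 (X (- s))"
      using 1 2 3 by (simp add: n_def l_def r_def)
  qed
qed

end


text \<open>Up to \<open>O(h)\<close>, the coefficient vectors of two recessive solutions are parallel. The two normal
  forms have leading potentials \<open>s / h\<^sup>2\<close> and \<open>s / (h * mu ^ 6)\<^sup>2\<close>; the substitution \<open>s \<mapsto> mu ^ 4 * s\<close> in the second
  makes them equal, since \<open>mu ^ 12\<close> cancels. At \<open>s = - Z\<close> the determinant of the two coefficient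
  vectors is \<open>h * mu\<close> times the Wronskian. The Wronskian is bounded by a multiple of the product of the amplitudes, and
  \<open>coefficient_drift\<close> carries the result to the given base points.\<close>
theorem connection_universality:
  fixes V V1 V2 V3 Th V' V1' V2' V3' Th' :: "real \<Rightarrow> real"
  assumes A: "turning_point S V V1 V2 Th V3 U b"
    and B: "turning_point S' V' V1' V2' Th' V3' U' b'"
    and x0: "x0 \<in> S" "x0' \<in> S'" and mu0: "0 < mu0" "mu0 \<le> 1"
  obtains C where "C \<ge> 0"
    "\<And>h mu y y1 w w1. 0 < h \<Longrightarrow> h \<le> 1 \<Longrightarrow> mu0 \<le> mu \<Longrightarrow> mu \<le> 1 \<Longrightarrow>
      turning_point.recessive S V U b h y y1 \<Longrightarrow>
      turning_point.recessive S' V' U' b' (h * mu ^ 6) w w1 \<Longrightarrow>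
      \<bar>allowed_region.sin_coeff V V1 Th h y y1 x0 * allowed_region.cos_coeff V' V1' Th' (h * mu ^ 6) w w1 x0'
       - allowed_region.cos_coeff V V1 Th h y y1 x0 * allowed_region.sin_coeff V' V1' Th' (h * mu ^ 6) w w1 x0'\<bar>
      \<le> C * h * (sqrt (allowed_region.intensity V V1 h y y1 x0) * sqrt (allowed_region.intensity V' V1' (h * mu ^ 6) w w1 x0'))"
proof -
  interpret A: turning_point S V V1 V2 Th V3 U b by (rule A)
  interpret B: turning_point S' V' V1' V2' Th' V3' U' b' by (rule B)
  obtain ZA XA ta ta1 ta2 where lA: "langer_map V V1 U b ZA XA ta ta1 ta2" by (rule A.langer_map_exists)
  obtain ZB XB tb tb1 tb2 where lB: "langer_map V' V1' U' b' ZB XB tb tb1 tb2" by (rule B.langer_map_exists)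
  define Z where "Z = min ZA ZB / 2"
  have Z: "0 < Z" "Z < ZA" "Z < ZB" using A.Z_pos[OF lA] B.Z_pos[OF lB] by (auto simp: Z_def min_def)
  define t where "t = sqrt (sqrt Z)"
  have "t ^ 4 = ((sqrt (sqrt Z))\<^sup>2)\<^sup>2" by (simp add: t_def flip: power_mult)
  then have t: "t > 0" "t ^ 4 = Z" using Z by (simp_all add: t_def)
  define k0 where "k0 = mu0 ^ 4"
  have k0: "0 < k0" "k0 \<le> 1" using mu0 by (auto simp: k0_def power_le_one)
  have k0Z: "0 < k0 * Z" "k0 * Z \<le> Z" using k0 Z mult_right_mono[of k0 1 Z] by auto
  obtain CA cA where CA: "CA \<ge> 0" "cA > 0"
    and cfA: "\<And>s. s \<in> {- ZA..ZA} \<Longrightarrow> \<bar>normal_pot ta ta1 ta2 s\<bar> \<le> CA \<and> cA \<le> V1 (XA s) * ta s ^ 4"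
    and bdA: "\<And>h y y1 s. 0 < h \<Longrightarrow> h \<le> 1 \<Longrightarrow> A.recessive h y y1 \<Longrightarrow> s \<in> {Z..ZA} \<Longrightarrow>
      energy h V y y1 (XA (- s)) - energy h V y y1 (XA s) \<le> CA * A.intensity h y y1 (XA (- s)) \<and>
      (normal_sol XA ta y s)\<^sup>2 \<le> CA * A.intensity h y y1 (XA (- s)) \<and>
      (normal_slope XA ta ta1 y y1 s)\<^sup>2 \<le> CA * A.intensity h y y1 (XA (- s))"
    by (fact A.langer_bounds[OF lA Z(1) less_imp_le[OF Z(2)]])
  have k0ZB: "k0 * Z \<le> ZB" using k0Z Z by linarith
  obtain CB cB where CB: "CB \<ge> 0" "cB > 0"
    and cfB: "\<And>s. s \<in> {- ZB..ZB} \<Longrightarrow> \<bar>normal_pot tb tb1 tb2 s\<bar> \<le> CB \<and> cB \<le> V1' (XB s) * tb s ^ 4"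
    and bdB: "\<And>h y y1 s. 0 < h \<Longrightarrow> h \<le> 1 \<Longrightarrow> B.recessive h y y1 \<Longrightarrow> s \<in> {k0 * Z..ZB} \<Longrightarrow>
      energy h V' y y1 (XB (- s)) - energy h V' y y1 (XB s) \<le> CB * B.intensity h y y1 (XB (- s)) \<and>
      (normal_sol XB tb y s)\<^sup>2 \<le> CB * B.intensity h y y1 (XB (- s)) \<and>
      (normal_slope XB tb tb1 y y1 s)\<^sup>2 \<le> CB * B.intensity h y y1 (XB (- s))"
    by (fact B.langer_bounds[OF lB k0Z(1) k0ZB])
  have lS: "{XA (- Z)..XA (- Z)} \<subseteq> S" using A.X_neg[OF lA, of "- Z"] Z by auto
  obtain DA where DA: "DA \<ge> 0"
    "\<And>h y y1 x. 0 < h \<Longrightarrow> h \<le> 1 \<Longrightarrow> sol_on h V S y y1 \<Longrightarrow> x \<in> {XA (- Z)..XA (- Z)} \<Longrightarrow>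
       \<bar>A.sin_coeff h y y1 x - A.sin_coeff h y y1 x0\<bar> \<le> DA * h * sqrt (A.intensity h y y1 x0) \<and>
       \<bar>A.cos_coeff h y y1 x - A.cos_coeff h y y1 x0\<bar> \<le> DA * h * sqrt (A.intensity h y y1 x0) \<and>
       A.intensity h y y1 x \<le> DA * A.intensity h y y1 x0"
    by (fact A.coefficient_drift[OF lS x0(1)])
  have lS': "{XB (- Z)..XB (- (k0 * Z))} \<subseteq> S'"
  proof
    fix x assume x: "x \<in> {XB (- Z)..XB (- (k0 * Z))}"
    have "XB (- Z) \<in> S'" "XB (- (k0 * Z)) \<in> S'"
      using B.X_neg[OF lB, of "- Z"] B.X_neg[OF lB, of "- (k0 * Z)"] Z k0Z k0ZB by auto
    then show "x \<in> S'" using x B.interval_S unfolding is_interval_1 by (meson atLeastAtMost_iff)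
  qed
  obtain DB where DB: "DB \<ge> 0"
    "\<And>h y y1 x. 0 < h \<Longrightarrow> h \<le> 1 \<Longrightarrow> sol_on h V' S' y y1 \<Longrightarrow> x \<in> {XB (- Z)..XB (- (k0 * Z))} \<Longrightarrow>
       \<bar>B.sin_coeff h y y1 x - B.sin_coeff h y y1 x0'\<bar> \<le> DB * h * sqrt (B.intensity h y y1 x0') \<and>
       \<bar>B.cos_coeff h y y1 x - B.cos_coeff h y y1 x0'\<bar> \<le> DB * h * sqrt (B.intensity h y y1 x0') \<and>
       B.intensity h y y1 x \<le> DB * B.intensity h y y1 x0'"
    by (fact B.coefficient_drift[OF lS' x0(2)])
  define c where "c = min cA (k0 * cB)"
  have c: "c > 0" "c \<le> cA" "c \<le> k0 * cB" using CA CB k0 by (auto simp: c_def)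
  define G where "G = (CA + CB) / 2"
  have G0: "G \<ge> 0" using CA CB by (simp add: G_def)
  define K where "K = (1 + G / c) * (CA * DA + CB * DB)"
  have K0: "K \<ge> 0" using G0 c CA CB DA DB by (auto simp: K_def)
  define C where "C = 2 * K + 2 * (DA + DB + DA * DB)"
  show ?thesis
  proof (rule that[of C])
    show "C \<ge> 0" using K0 DA DB by (simp add: C_def)
    fix h mu :: real and y y1 w w1 :: "real \<Rightarrow> real"
    assume h: "0 < h" "h \<le> 1" and mu: "mu0 \<le> mu" "mu \<le> 1"
      and ry: "A.recessive h y y1" and rw: "B.recessive (h * mu ^ 6) w w1"
    define h' where "h' = h * mu ^ 6"
    have mu_pos: "mu > 0" using mu mu0 by linarith
    have h': "0 < h'" "h' \<le> h" "h' \<le> 1"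
    proof -
      have "mu ^ 6 \<le> 1" using mu mu_pos by (simp add: power_le_one)
      then have "h * mu ^ 6 \<le> h * 1" using h by (intro mult_left_mono) auto
      then show "h' \<le> h" by (simp add: h'_def)
      then show "h' \<le> 1" using h by linarith
      show "0 < h'" using h mu_pos by (simp add: h'_def)
    qed
    define k where "k = mu ^ 4"
    have k: "k0 \<le> k" "0 < k" "k \<le> 1"
      using mu mu0 mu_pos by (auto simp: k_def k0_def power_le_one intro!: power_mono)
    have kZ: "k0 * Z \<le> k * Z" "k * Z \<le> Z" "0 < k * Z"
      using k Z mult_right_mono[of k 1 Z] by (auto intro!: mult_right_mono)
    have ksB: "k * s \<in> {- ZB..ZB}" if "s \<in> {- Z..Z}" for s
    proof -
      have "\<bar>k * s\<bar> \<le> 1 * Z" unfolding abs_mult using that k by (intro mult_mono) auto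
      then show ?thesis using Z by auto
    qed
    have sA: "s \<in> {- ZA..ZA}" if "s \<in> {- Z..Z}" for s using that Z by auto
    have solU: "sol_on h V U y y1" and solS: "sol_on h V S y y1"
      using ry sol_on_subset unfolding A.recessive_def by blast+
    have solU': "sol_on h' V' U' w w1" and solS': "sol_on h' V' S' w w1"
      using rw sol_on_subset unfolding B.recessive_def h'_def by blast+
    have hn: "h \<noteq> 0" "h' \<noteq> 0" using h h' by auto
    \<comment> \<open>Both solutions in the variable \<open>s\<close> of the first; the second one is rescaled by \<open>k = mu ^ 4\<close>.\<close>
    define a where "a = normal_sol XA ta y"
    define a1 where "a1 = normal_slope XA ta ta1 y y1"
    define d where "d s = normal_sol XB tb w (k * s)" for s
    define d1 where "d1 s = k * normal_slope XB tb tb1 w w1 (k * s)" for s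
    define g where "g = normal_pot ta ta1 ta2"
    define q where "q s = k\<^sup>2 * normal_pot tb tb1 tb2 (k * s)" for s
    define e1 where "e1 s = energy h V y y1 (XA s)" for s
    define e2 where "e2 s = energy h' V' w w1 (XB (k * s))" for s
    have scale: "((\<lambda>s. F (k * s)) has_real_derivative D * k) (at s)"
      if "(F has_real_derivative D) (at (k * s))" for F D s
      using DERIV_chain2[where f=F and g="\<lambda>s. k * s", OF that DERIV_cmult_Id] .
    have h'k: "k ^ 3 / h'\<^sup>2 = 1 / h\<^sup>2"
    proof -
      have "k ^ 3 = (mu ^ 6)\<^sup>2" by (simp add: k_def flip: power_mult)
      then show ?thesis using mu_pos hn by (simp add: h'_def power_mult_distrib)
    qed
    have W: "\<bar>a (- Z) * d1 (- Z) - a1 (- Z) * d (- Z)\<bar> \<le> \<bar>a Z * d1 Z - a1 Z * d Z\<bar>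
        + G / c * (lam * (e1 (- Z) - e1 Z) + (e2 (- Z) - e2 Z) / lam)" if lam: "lam > 0" for lam
    proof (rule wronskian_bound[OF less_imp_le[OF Z(1)] lam c(1)])
      fix s assume s: "s \<in> {- Z..Z}"
      show "(a has_real_derivative a1 s) (at s)"
        unfolding a_def a1_def by (rule A.normal_der(1)[OF lA hn(1) solU sA[OF s]])
      show "(a1 has_real_derivative (s / h\<^sup>2 + g s) * a s) (at s)"
        unfolding a_def a1_def g_def by (rule A.normal_der(2)[OF lA hn(1) solU sA[OF s]])
      show "(d has_real_derivative d1 s) (at s)"
        unfolding d_def d1_def
        by (rule DERIV_cong[OF scale[OF B.normal_der(1)[OF lB hn(2) solU' ksB[OF s]]]]) (rule mult.commute)
      have "k * (((k * s) / h'\<^sup>2 + normal_pot tb tb1 tb2 (k * s)) * normal_sol XB tb w (k * s) * k)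
          = (k ^ 3 / h'\<^sup>2 * s + q s) * d s"
        by (simp add: q_def d_def algebra_simps power2_eq_square power3_eq_cube)
      also have "\<dots> = (s / h\<^sup>2 + q s) * d s" unfolding h'k by simp
      finally show "(d1 has_real_derivative (s / h\<^sup>2 + q s) * d s) (at s)"
        unfolding d1_def
        by (intro DERIV_cong[OF DERIV_cmult[OF scale[OF B.normal_der(2)[OF lB hn(2) solU' ksB[OF s]]]]])
      have "\<bar>q s\<bar> \<le> 1 * CB"
        unfolding q_def abs_mult using cfB[OF ksB[OF s]] k by (intro mult_mono) (auto simp: power_le_one)
      moreover have "\<bar>g s\<bar> \<le> CA" using cfA[OF sA[OF s]] by (simp add: g_def)
      ultimately have "\<bar>q s - g s\<bar> \<le> CA + CB" by linarith
      then show "\<bar>q s - g s\<bar> \<le> 2 * G" by (simp add: G_def)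
      show "(e1 has_real_derivative - (V1 (XA s) * ta s ^ 4) * (a s)\<^sup>2) (at s) \<and>
          - (V1 (XA s) * ta s ^ 4) * (a s)\<^sup>2 \<le> - c * (a s)\<^sup>2"
        unfolding e1_def a_def
        using A.normal_energy_der[OF lA hn(1) solU sA[OF s]] cfA[OF sA[OF s]] c
        by (auto intro!: mult_right_mono)
      have "k0 * cB \<le> k * (V1' (XB (k * s)) * tb (k * s) ^ 4)"
        using k cfB[OF ksB[OF s]] k0 CB by (intro mult_mono) auto
      then have "c \<le> k * (V1' (XB (k * s)) * tb (k * s) ^ 4)" using c by linarith
      then have "c * (d s)\<^sup>2 \<le> k * (V1' (XB (k * s)) * tb (k * s) ^ 4) * (d s)\<^sup>2"
        by (rule mult_right_mono) simp
      then show "(e2 has_real_derivative - (k * (V1' (XB (k * s)) * tb (k * s) ^ 4)) * (d s)\<^sup>2) (at s) \<and>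
          - (k * (V1' (XB (k * s)) * tb (k * s) ^ 4)) * (d s)\<^sup>2 \<le> - c * (d s)\<^sup>2"
        unfolding e2_def d_def
        by (intro conjI DERIV_cong[OF scale[OF B.normal_energy_der[OF lB hn(2) solU' ksB[OF s]]]])
           (simp_all add: mult_ac)
    qed
    define nA where "nA = A.intensity h y y1 x0"
    define nB where "nB = B.intensity h' w w1 x0'"
    have n0: "nA \<ge> 0" "nB \<ge> 0" by (auto simp: nA_def nB_def A.intensity_nonneg B.intensity_nonneg)
    have inA: "XA (- Z) \<in> {XA (- Z)..XA (- Z)}" by simp
    have inB: "XB (- (k * Z)) \<in> {XB (- Z)..XB (- (k0 * Z))}"
      using B.X_le[OF lB, of "- Z" "- (k * Z)"] B.X_le[OF lB, of "- (k * Z)" "- (k0 * Z)"] kZ k0Z Z by auto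
    note drA = DA(2)[OF h solS inA, folded nA_def]
    note drB = DB(2)[OF h'(1,3) solS' inB, folded nB_def]
    have eA: "e1 (- Z) - e1 Z \<le> CA * DA * nA" "(a Z)\<^sup>2 \<le> CA * DA * nA" "(a1 Z)\<^sup>2 \<le> CA * DA * nA"
    proof -
      have "CA * A.intensity h y y1 (XA (- Z)) \<le> CA * (DA * nA)" using drA CA by (intro mult_left_mono) auto
      moreover note bdA[OF h ry, of Z]
      ultimately show "e1 (- Z) - e1 Z \<le> CA * DA * nA" "(a Z)\<^sup>2 \<le> CA * DA * nA" "(a1 Z)\<^sup>2 \<le> CA * DA * nA"
        using Z by (auto simp: e1_def a_def a1_def mult.assoc)
    qed
    have eB: "e2 (- Z) - e2 Z \<le> CB * DB * nB" "(d Z)\<^sup>2 \<le> CB * DB * nB" "(d1 Z)\<^sup>2 \<le> CB * DB * nB"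
    proof -
      have "CB * B.intensity h' w w1 (XB (- (k * Z))) \<le> CB * (DB * nB)" using drB CB by (intro mult_left_mono) auto
      moreover have "(d1 Z)\<^sup>2 \<le> (normal_slope XB tb tb1 w w1 (k * Z))\<^sup>2"
      proof -
        have "k\<^sup>2 * (normal_slope XB tb tb1 w w1 (k * Z))\<^sup>2 \<le> 1 * (normal_slope XB tb tb1 w w1 (k * Z))\<^sup>2"
          using k by (intro mult_right_mono) (auto simp: power_le_one)
        then show ?thesis by (simp add: d1_def power_mult_distrib)
      qed
      moreover note bdB[OF h'(1,3) rw[folded h'_def], of "k * Z"]
      ultimately show "e2 (- Z) - e2 Z \<le> CB * DB * nB" "(d Z)\<^sup>2 \<le> CB * DB * nB" "(d1 Z)\<^sup>2 \<le> CB * DB * nB"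
        using Z kZ by (auto simp: e2_def d_def mult.assoc)
    qed
    define P where "P = CA * DA * nA"
    define Q where "Q = CB * DB * nB"
    define Wr where "Wr = a (- Z) * d1 (- Z) - a1 (- Z) * d (- Z)"
    have Wlam: "\<bar>Wr\<bar> \<le> K * (lam * nA + nB / lam)" if lam: "lam > 0" for lam
    proof -
      have am: "2 * \<bar>p * r\<bar> \<le> lam * P + Q / lam" if "p\<^sup>2 \<le> P" "r\<^sup>2 \<le> Q" for p r
      proof -
        have "0 \<le> (lam * \<bar>p\<bar> - \<bar>r\<bar>)\<^sup>2 / lam" using lam by simp
        also have "\<dots> = lam * p\<^sup>2 + r\<^sup>2 / lam - 2 * \<bar>p * r\<bar>"
          using lam by (simp add: power2_diff abs_mult field_simps power2_eq_square)
        also have "\<dots> \<le> lam * P + Q / lam - 2 * \<bar>p * r\<bar>"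
          using that lam by (intro diff_right_mono add_mono mult_left_mono divide_right_mono) auto
        finally show ?thesis by simp
      qed
      have "\<bar>a Z * d1 Z - a1 Z * d Z\<bar> \<le> \<bar>a Z * d1 Z\<bar> + \<bar>a1 Z * d Z\<bar>" by linarith
      also have "\<dots> \<le> lam * P + Q / lam"
        using am[of "a Z" "d1 Z"] am[of "a1 Z" "d Z"] eA eB by (simp add: P_def Q_def)
      finally have 1: "\<bar>a Z * d1 Z - a1 Z * d Z\<bar> \<le> lam * P + Q / lam" .
      have "lam * (e1 (- Z) - e1 Z) + (e2 (- Z) - e2 Z) / lam \<le> lam * P + Q / lam"
        unfolding P_def Q_def using eA eB lam by (intro add_mono mult_left_mono divide_right_mono) auto
      then have "G / c * (lam * (e1 (- Z) - e1 Z) + (e2 (- Z) - e2 Z) / lam) \<le> G / c * (lam * P + Q / lam)"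
        using G0 c by (intro mult_left_mono) auto
      with W[OF lam] 1 have "\<bar>Wr\<bar> \<le> (lam * P + Q / lam) + G / c * (lam * P + Q / lam)"
        unfolding Wr_def by linarith
      also have "\<dots> = (1 + G / c) * (lam * P + Q / lam)" by (simp add: algebra_simps)
      also have "\<dots> \<le> (1 + G / c) * ((CA * DA + CB * DB) * (lam * nA + nB / lam))"
      proof (intro mult_left_mono)
        have nn: "0 \<le> CA * DA" "0 \<le> CB * DB" "0 \<le> lam * nA" "0 \<le> nB / lam"
          using CA DA CB DB n0 lam by auto
        then have "0 \<le> CA * DA * (nB / lam) + CB * DB * (lam * nA)"
          by (intro add_nonneg_nonneg mult_nonneg_nonneg[OF nn(1,4)] mult_nonneg_nonneg[OF nn(2,3)])
        then show "lam * P + Q / lam \<le> (CA * DA + CB * DB) * (lam * nA + nB / lam)"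
          by (simp add: P_def Q_def algebra_simps)
      qed (use G0 c in simp)
      also have "\<dots> = K * (lam * nA + nB / lam)" by (simp add: K_def)
      finally show ?thesis .
    qed
    \<comment> \<open>At \<open>s = - Z\<close> both solutions have the same angle \<open>Th / h\<close>, and the terms without derivatives cancel.\<close>
    have cross_l: "A.sin_coeff h y y1 (XA (- Z)) * B.cos_coeff h' w w1 (XB (- (k * Z)))
        - A.cos_coeff h y y1 (XA (- Z)) * B.sin_coeff h' w w1 (XB (- (k * Z))) = h * mu * Wr"
    proof -
      have sZ: "- Z = - (t ^ 4)" "- Z \<in> {- ZA..ZA}" "- ZA < - Z" using t Z by auto
      have mt: "mu * t > 0" using mu_pos t by simp
      have skZ: "- (k * Z) = - ((mu * t) ^ 4)" "- (k * Z) \<in> {- ZB..ZB}" "- ZB < - (k * Z)"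
        using t Z kZ by (auto simp: k_def power_mult_distrib)
      have uA: "A.wval y (XA (- Z)) = t * a (- Z)"
        and zA: "A.wslope h y y1 (XA (- Z)) = - h * (a1 (- Z) / t - a (- Z) / (4 * t ^ 5))"
        unfolding a_def a1_def by (rule A.normal_wval_wslope[OF lA t(1) sZ])+
      have uB: "B.wval w (XB (- (k * Z))) = mu * t * d (- Z)"
        and zB: "B.wslope h' w w1 (XB (- (k * Z))) = - h' * (d1 (- Z) / k / (mu * t) - d (- Z) / (4 * (mu * t) ^ 5))"
        using B.normal_wval_wslope(1)[OF lB mt skZ, of w] B.normal_wval_wslope(2)[OF lB mt skZ, where y=w and h=h' and ?y1.0=w1] k by (simp_all add: d_def d1_def)
      have phase: "Th (XA (- Z)) / h = Th' (XB (- (k * Z))) / h'"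
        unfolding A.Th_langer[OF lA t(1) sZ(1,2)] B.Th_langer[OF lB mt skZ(1,2)] h'_def power_mult_distrib
        using mu_pos by simp
      define ph where "ph = Th (XA (- Z)) / h"
      have "A.sin_coeff h y y1 (XA (- Z)) * B.cos_coeff h' w w1 (XB (- (k * Z)))
        - A.cos_coeff h y y1 (XA (- Z)) * B.sin_coeff h' w w1 (XB (- (k * Z)))
        = (A.wslope h y y1 (XA (- Z)) * B.wval w (XB (- (k * Z))) - A.wval y (XA (- Z)) * B.wslope h' w w1 (XB (- (k * Z))))
          * ((sin ph)\<^sup>2 + (cos ph)\<^sup>2)"
        unfolding A.sin_coeff_def A.cos_coeff_def B.sin_coeff_def B.cos_coeff_def phase[symmetric] ph_def[symmetric] by algebra
      also have "\<dots> = A.wslope h y y1 (XA (- Z)) * B.wval w (XB (- (k * Z))) - A.wval y (XA (- Z)) * B.wslope h' w w1 (XB (- (k * Z)))"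
        by simp
      also have "\<dots> = h * mu * Wr"
        unfolding uA zA uB zB unfolding Wr_def h'_def k_def using mu_pos t(1)
        by (simp add: field_simps eval_nat_numeral)
      finally show ?thesis .
    qed
    define sA0 where "sA0 = A.sin_coeff h y y1 x0"
    define cA0 where "cA0 = A.cos_coeff h y y1 x0"
    define sB0 where "sB0 = B.sin_coeff h' w w1 x0'"
    define cB0 where "cB0 = B.cos_coeff h' w w1 x0'"
    define sAl where "sAl = A.sin_coeff h y y1 (XA (- Z))"
    define cAl where "cAl = A.cos_coeff h y y1 (XA (- Z))"
    define sBl where "sBl = B.sin_coeff h' w w1 (XB (- (k * Z)))"
    define cBl where "cBl = B.cos_coeff h' w w1 (XB (- (k * Z)))"
    define R where "R = sqrt nA * sqrt nB"
    have R0: "R \<ge> 0" by (simp add: R_def n0)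
    have bA: "\<bar>sA0\<bar> \<le> sqrt nA" "\<bar>cA0\<bar> \<le> sqrt nA" unfolding sA0_def cA0_def nA_def by (rule A.sin_coeff_le A.cos_coeff_le)+
    have bB: "\<bar>sB0\<bar> \<le> sqrt nB" "\<bar>cB0\<bar> \<le> sqrt nB" unfolding sB0_def cB0_def nB_def by (rule B.sin_coeff_le B.cos_coeff_le)+
    have dA: "\<bar>sAl - sA0\<bar> \<le> DA * h * sqrt nA" "\<bar>cAl - cA0\<bar> \<le> DA * h * sqrt nA"
      using drA by (auto simp: sA0_def cA0_def sAl_def cAl_def)
    have "DB * h' * sqrt nB \<le> DB * h * sqrt nB" using h' DB n0 by (intro mult_right_mono mult_left_mono) auto
    then have dB: "\<bar>sBl - sB0\<bar> \<le> DB * h * sqrt nB" "\<bar>cBl - cB0\<bar> \<le> DB * h * sqrt nB"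
      using drB by (auto simp: sB0_def cB0_def sBl_def cBl_def)
    have prod: "\<bar>p0 * q0 - pl * ql\<bar> \<le> (DA + DB + DA * DB) * h * R"
      if "\<bar>p0\<bar> \<le> sqrt nA" "\<bar>q0\<bar> \<le> sqrt nB" "\<bar>pl - p0\<bar> \<le> DA * h * sqrt nA" "\<bar>ql - q0\<bar> \<le> DB * h * sqrt nB"
      for p0 q0 pl ql
    proof -
      have "p0 * q0 - pl * ql = - (p0 * (ql - q0)) - (pl - p0) * q0 - (pl - p0) * (ql - q0)"
        by (simp add: algebra_simps)
      then have "\<bar>p0 * q0 - pl * ql\<bar> \<le> \<bar>p0\<bar> * \<bar>ql - q0\<bar> + \<bar>pl - p0\<bar> * \<bar>q0\<bar> + \<bar>pl - p0\<bar> * \<bar>ql - q0\<bar>"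
        unfolding abs_mult[symmetric] by linarith
      also have "\<dots> \<le> sqrt nA * (DB * h * sqrt nB) + (DA * h * sqrt nA) * sqrt nB
          + (DA * h * sqrt nA) * (DB * h * sqrt nB)"
        using that n0 h DA DB by (intro add_mono mult_mono) auto
      also have "\<dots> = (DA + DB) * h * R + DA * DB * (h * h) * R" by (simp add: R_def algebra_simps)
      also have "\<dots> \<le> (DA + DB) * h * R + DA * DB * h * R"
        using h DA DB R0 by (intro add_left_mono mult_right_mono mult_left_mono) (auto simp: mult_left_le)
      finally show ?thesis by (simp add: algebra_simps)
    qed
    \<comment> \<open>The weight \<open>sqrt nB / sqrt nA\<close> is the optimal one.\<close>
    have Wr: "\<bar>Wr\<bar> \<le> 2 * K * R" if pos: "nA > 0" "nB > 0"
    proof -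
      have "\<bar>Wr\<bar> \<le> K * (sqrt nB / sqrt nA * nA + nB / (sqrt nB / sqrt nA))"
        by (rule Wlam) (use pos in simp)
      also have "sqrt nB / sqrt nA * nA = R"
        using pos by (simp add: R_def field_simps)
      also have "nB / (sqrt nB / sqrt nA) = R"
        using pos by (simp add: R_def field_simps)
      finally show ?thesis by simp
    qed
    have "\<bar>sA0 * cB0 - cA0 * sB0\<bar> \<le> C * h * R"
    proof (cases "nA > 0 \<and> nB > 0")
      case False
      then have "nA = 0 \<or> nB = 0" using n0 by auto
      then show ?thesis using bA bB R0 \<open>C \<ge> 0\<close> h by auto
    next
      case True
      then have "\<bar>sAl * cBl - cAl * sBl\<bar> \<le> h * (2 * K * R)"
      proof -
        have "\<bar>sAl * cBl - cAl * sBl\<bar> = h * (mu * \<bar>Wr\<bar>)"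
          unfolding sAl_def cBl_def cAl_def sBl_def cross_l using h mu_pos by (simp add: abs_mult)
        also have "\<dots> \<le> h * (1 * (2 * K * R))"
          using h mu mu_pos Wr True by (intro mult_left_mono mult_mono) auto
        finally show ?thesis by simp
      qed
      moreover have "\<bar>sA0 * cB0 - sAl * cBl\<bar> \<le> (DA + DB + DA * DB) * h * R"
        by (rule prod[OF bA(1) bB(2) dA(1) dB(2)])
      moreover have "\<bar>cA0 * sB0 - cAl * sBl\<bar> \<le> (DA + DB + DA * DB) * h * R"
        by (rule prod[OF bA(2) bB(1) dA(2) dB(1)])
      ultimately have "\<bar>sA0 * cB0 - cA0 * sB0\<bar> \<le> h * (2 * K * R) + 2 * ((DA + DB + DA * DB) * h * R)"
        by linarith
      also have "\<dots> = C * h * R" by (simp add: C_def algebra_simps)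
      finally show ?thesis .
    qed
    then show "\<bar>A.sin_coeff h y y1 x0 * B.cos_coeff (h * mu ^ 6) w w1 x0' - A.cos_coeff h y y1 x0 * B.sin_coeff (h * mu ^ 6) w w1 x0'\<bar>
      \<le> C * h * (sqrt (A.intensity h y y1 x0) * sqrt (B.intensity (h * mu ^ 6) w w1 x0'))"
      unfolding sA0_def cA0_def sB0_def cB0_def R_def nA_def nB_def h'_def .
  qed
qed

section \<open>The phase of the harmonic oscillator\<close>

text \<open>The physicists' Hermite polynomials; the recursion is the raising operator.\<close>
primrec hermite :: "nat \<Rightarrow> real poly" where
  "hermite 0 = 1"
| "hermite (Suc n) = [:0, 2:] * hermite n - pderiv (hermite n)"

lemma pderiv_hermite_Suc: "pderiv (hermite (Suc n)) = smult (2 * real (Suc n)) (hermite n)"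
proof (induction n)
  case 0
  show ?case by (simp add: pderiv_diff pderiv_pCons)
next
  case (Suc n)
  have "pderiv (hermite (Suc (Suc n)))
      = smult 2 (hermite (Suc n)) + [:0, 2:] * pderiv (hermite (Suc n)) - pderiv (pderiv (hermite (Suc n)))"
    by (simp only: hermite.simps(2)[of "Suc n"] pderiv_diff pderiv_mult) (simp add: pderiv_pCons)
  also have "\<dots> = smult 2 (hermite (Suc n))
      + smult (2 * real (Suc n)) ([:0, 2:] * hermite n - pderiv (hermite n))"
    unfolding Suc.IH by (simp only: pderiv_smult mult_smult_right smult_diff_right)
  also have "\<dots> = smult 2 (hermite (Suc n)) + smult (2 * real (Suc n)) (hermite (Suc n))"
    by (simp only: hermite.simps(2))
  also have "\<dots> = smult (2 * real (Suc (Suc n))) (hermite (Suc n))"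
    by (simp only: smult_add_left[symmetric]) (simp add: algebra_simps)
  finally show ?case .
qed

text \<open>Hermite's equation. It follows from \<open>pderiv_hermite_Suc\<close>, the lowering operator.\<close>
lemma hermite_ode:
  "poly (pderiv (pderiv (hermite n))) t = 2 * t * poly (pderiv (hermite n)) t - 2 * real n * poly (hermite n) t"
proof (cases n)
  case 0
  then show ?thesis by simp
next
  case (Suc m)
  have "poly (hermite n) t = 2 * t * poly (hermite m) t - poly (pderiv (hermite m)) t"
    by (simp add: Suc)
  moreover have "pderiv (hermite n) = smult (2 * real n) (hermite m)"
    unfolding Suc by (rule pderiv_hermite_Suc)
  then have "poly (pderiv (pderiv (hermite n))) t = 2 * real n * poly (pderiv (hermite m)) t"
    "poly (pderiv (hermite n)) t = 2 * real n * poly (hermite m) t"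
    by (simp_all add: pderiv_smult)
  ultimately show ?thesis by (simp only:) (simp add: algebra_simps)
qed

lemma hermite_0_recurrence: "poly (hermite (Suc (Suc n))) 0 = - 2 * real (Suc n) * poly (hermite n) 0"
proof -
  have "poly (hermite (Suc (Suc n))) 0 = - poly (pderiv (hermite (Suc n))) 0"
    by (simp only: hermite.simps(2)[of "Suc n"]) simp
  also have "\<dots> = - 2 * real (Suc n) * poly (hermite n) 0"
    unfolding pderiv_hermite_Suc poly_smult by (simp only: minus_mult_left)
  finally show ?thesis .
qed

lemma hermite_even_0: "poly (hermite (2 * k)) 0 \<noteq> 0"
  by (induction k) (simp_all add: hermite_0_recurrence del: hermite.simps(2))

lemma hermite_odd_0: "poly (hermite (Suc (2 * k))) 0 = 0"
proof (induction k)
  case (Suc k)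
  then show ?case using hermite_0_recurrence[of "Suc (2 * k)"] by simp
qed simp

lemma pderiv_hermite_even_0: "poly (pderiv (hermite (2 * k))) 0 = 0"
proof (cases k)
  case (Suc m)
  then have "2 * k = Suc (Suc (2 * m))" by simp
  then show ?thesis using hermite_odd_0[of m] by (simp only: pderiv_hermite_Suc) simp
qed simp

lemma poly_gaussian_tendsto_0: "((\<lambda>t::real. poly p t * exp (- t\<^sup>2 / 2)) \<longlongrightarrow> 0) at_top"
proof -
  have "((\<lambda>t::real. t ^ n * poly p t / exp t) \<longlongrightarrow> 0) at_top" for n
  proof (induction p arbitrary: n)
    case (pCons a p)
    have "((\<lambda>t. a * (t ^ n / exp t) + t ^ Suc n * poly p t / exp t) \<longlongrightarrow> a * 0 + 0) at_top"
      by (intro tendsto_intros tendsto_power_div_exp_0 pCons.IH)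
    then show ?case by (simp add: algebra_simps add_divide_distrib)
  qed simp
  from this[of 0] have lim: "((\<lambda>t. poly p t / exp t) \<longlongrightarrow> 0) at_top" by simp
  show ?thesis
  proof (rule Lim_null_comparison[OF _ tendsto_rabs_zero[OF lim]])
    show "\<forall>\<^sub>F t in at_top. norm (poly p t * exp (- t\<^sup>2 / 2)) \<le> \<bar>poly p t / exp t\<bar>"
    proof (rule eventually_at_top_linorderI[of 2])
      fix t :: real assume "t \<ge> 2"
      then have "2 * t \<le> t * t" by (intro mult_right_mono) auto
      then have "- t\<^sup>2 / 2 \<le> - t" unfolding power2_eq_square by linarith
      then have "exp (- t\<^sup>2 / 2) \<le> exp (- t)" by (simp only: exp_le_cancel_iff)
      then have "\<bar>poly p t\<bar> * exp (- t\<^sup>2 / 2) \<le> \<bar>poly p t\<bar> * exp (- t)"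
        by (rule mult_left_mono) (rule abs_ge_zero)
      also have "\<dots> = \<bar>poly p t / exp t\<bar>"
        by (simp add: abs_mult exp_minus divide_inverse)
      finally show "norm (poly p t * exp (- t\<^sup>2 / 2)) \<le> \<bar>poly p t / exp t\<bar>"
        by (simp only: real_norm_def abs_mult abs_exp_cancel)
    qed
  qed
qed

text \<open>The oscillator near its right turning point \<open>1\<close>. The phase function is
  the integral of \<open>sqrt (1 - t\<^sup>2)\<close> over \<open>{x..1}\<close> in closed form.\<close>
abbreviation "osc_S \<equiv> {-1<..<1::real}"
abbreviation "osc_V \<equiv> \<lambda>x::real. x\<^sup>2 - 1"
abbreviation "osc_V1 \<equiv> \<lambda>x::real. 2 * x"
abbreviation "osc_Th \<equiv> \<lambda>x::real. (arccos x - x * sqrt (1 - x\<^sup>2)) / 2"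

lemma oscillator_turning_point:
  "turning_point osc_S osc_V osc_V1 (\<lambda>_. 2) osc_Th (\<lambda>_. 0) {0<..} 1"
proof unfold_locales
  show "is_interval osc_S" by (simp add: is_interval_1)
  show "osc_V x < 0" if "x \<in> osc_S" for x
    using that abs_square_less_1[of x] by auto
  show "(osc_Th has_real_derivative - sqrt (- osc_V x)) (at x)" if x: "x \<in> osc_S" for x
  proof -
    have pos: "1 - x\<^sup>2 > 0" using x abs_square_less_1[of x] by auto
    define q where "q = sqrt (1 - x\<^sup>2)"
    have q: "q > 0" "q * q = 1 - x * x" using pos by (auto simp: q_def power2_eq_square)
    have "((\<lambda>x. 1 - x\<^sup>2) has_real_derivative - 2 * x) (at x)"
      by (auto intro!: derivative_eq_intros)
    from DERIV_chain2[OF DERIV_real_sqrt[OF pos] this]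
    have "((\<lambda>x. sqrt (1 - x\<^sup>2)) has_real_derivative inverse q / 2 * (- 2 * x)) (at x)"
      by (simp add: q_def)
    from DERIV_mult[OF DERIV_ident this]
    have "((\<lambda>x. x * sqrt (1 - x\<^sup>2)) has_real_derivative q - x * x / q) (at x)"
      by (simp add: q_def field_simps)
    from DERIV_cdivide[OF DERIV_diff[OF DERIV_arccos this], of 2] x
    have D: "(osc_Th has_real_derivative (inverse (- q) - (q - x * x / q)) / 2) (at x)"
      by (simp add: q_def)
    have "(inverse (- q) - (q - x * x / q)) / 2 = - q" using q by (simp add: field_simps)
    also have "\<dots> = - sqrt (- osc_V x)" by (simp add: q_def)
    finally show ?thesis using D by (rule DERIV_cong[rotated])
  qed
  show "continuous_on (insert 1 osc_S) osc_Th"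
    by (intro continuous_intros) auto
qed (auto intro!: derivative_eq_intros continuous_intros)

interpretation osc: turning_point osc_S osc_V osc_V1 "\<lambda>_. 2" osc_Th "\<lambda>_. 0" "{0<..}" 1
  by (rule oscillator_turning_point)

text \<open>For \<open>h = 1 / (4 k + 1)\<close> the function \<open>H (x / sqrt h) * exp (- x\<^sup>2 / (2 h))\<close> with the even Hermite polynomial \<open>H\<close>
  of degree \<open>2 k\<close> is a solution. It tends to \<open>0\<close> at infinity, which is impossible if its modulus
  grows somewhere beyond the turning point, so it is recessive. At \<open>0\<close> its slope vanishes and the angle is
  \<open>pi / 4 + k * pi\<close>; there sine and cosine agree, and so do the coefficients.\<close>
lemma oscillator_phase:
  fixes k :: nat
  defines "h \<equiv> 1 / (4 * real k + 1)"
  obtains y y1 where "osc.recessive h y y1" "osc.sin_coeff h y y1 0 = osc.cos_coeff h y y1 0" "osc.cos_coeff h y y1 0 \<noteq> 0"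
proof -
  define H where "H = hermite (2 * k)"
  define s where "s = sqrt h"
  have h: "h > 0" by (simp add: h_def)
  have s: "s > 0" "s\<^sup>2 = h" using h by (auto simp: s_def)
  then have sn: "s \<noteq> 0" by simp
  define y where "y x = poly H (x / s) * exp (- (x / s)\<^sup>2 / 2)" for x
  define y1 where "y1 x = (poly (pderiv H) (x / s) - x / s * poly H (x / s)) * exp (- (x / s)\<^sup>2 / 2) / s" for x
  have arg: "((\<lambda>x. x / s) has_real_derivative 1 / s) (at x)" for x
    by (rule DERIV_cdivide[OF DERIV_ident])
  have e_der: "((\<lambda>x. exp (- (x / s)\<^sup>2 / 2)) has_real_derivative exp (- (x / s)\<^sup>2 / 2) * (- (x / s) / s)) (at x)" for x
  proof -
    have "((\<lambda>x. - (x / s)\<^sup>2 / 2) has_real_derivative - (x / s) / s) (at x)"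
      by (rule DERIV_cong[OF DERIV_cdivide[OF DERIV_minus[OF DERIV_power[OF arg]]]]) simp
    from DERIV_chain2[OF DERIV_exp this] show ?thesis .
  qed
  have p_der: "((\<lambda>x. poly p (x / s)) has_real_derivative poly (pderiv p) (x / s) * (1 / s)) (at x)" for p x
    by (rule DERIV_chain2[OF poly_DERIV arg])
  have y_der: "(y has_real_derivative y1 x) (at x)" for x
  proof -
    have "p * (1 / s) * e + e * (- (x / s) / s) * q = (p - x / s * q) * e / s" for p q e
      using sn by (simp add: field_simps)
    then show ?thesis
      unfolding y_def y1_def by (intro DERIV_cong[OF DERIV_mult[OF p_der e_der]])
  qed
  have y1_der: "(y1 has_real_derivative osc_V x * y x / h\<^sup>2) (at x)" for x
  proof -
    define t where "t = x / s"
    define e where "e = exp (- t\<^sup>2 / 2)"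
    have D: "(y1 has_real_derivative
        ((poly (pderiv (pderiv H)) t * (1 / s) - (1 / s * poly H t + poly (pderiv H) t * (1 / s) * t)) * e
          + e * (- t / s) * (poly (pderiv H) t - t * poly H t)) / s) (at x)"
      unfolding y1_def t_def e_def
      by (intro DERIV_cdivide DERIV_mult DERIV_diff p_der e_der arg)
    have ode: "poly (pderiv (pderiv H)) t = 2 * t * poly (pderiv H) t - 4 * real k * poly H t"
      using hermite_ode[of "2 * k" t] by (simp add: H_def)
    have kh: "4 * real k = 1 / h - 1" by (simp add: h_def)
    have combine: "((A * (1 / s) - (1 / s * C + B * (1 / s) * t)) * E + E * (- t / s) * (B - t * C)) / s
        = (A - 2 * t * B + (t\<^sup>2 - 1) * C) * E / s\<^sup>2" for A B C E
      using sn by (simp add: field_simps power2_eq_square)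
    have "((poly (pderiv (pderiv H)) t * (1 / s) - (1 / s * poly H t + poly (pderiv H) t * (1 / s) * t)) * e
          + e * (- t / s) * (poly (pderiv H) t - t * poly H t)) / s
        = (poly (pderiv (pderiv H)) t - 2 * t * poly (pderiv H) t + (t\<^sup>2 - 1) * poly H t) * e / s\<^sup>2"
      by (rule combine)
    also have "\<dots> = (t\<^sup>2 - 1 / h) * (poly H t * e) / h"
      unfolding ode kh s by (simp add: algebra_simps)
    also have "t\<^sup>2 = x\<^sup>2 / h" by (simp add: t_def power_divide s)
    also have "poly H t * e = y x" by (simp add: y_def t_def e_def)
    also have "(x\<^sup>2 / h - 1 / h) * y x / h = osc_V x * y x / h\<^sup>2"
      using h by (simp add: field_simps power2_eq_square)
    finally show ?thesis using D by simp
  qed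
  have sol: "sol_on h osc_V T y y1" for T using y_der y1_der by (auto simp: sol_on_def)
  have "filterlim (\<lambda>x. x / s) at_top at_top"
    using filterlim_tendsto_pos_mult_at_top[OF tendsto_const, of "1 / s" "\<lambda>x. x" at_top] s
    by (simp add: filterlim_ident)
  from filterlim_compose[OF poly_gaussian_tendsto_0 this] have lim: "(y \<longlongrightarrow> 0) at_top"
    by (simp add: y_def[abs_def])
  have V_nn: "osc_V x \<ge> 0" if "x \<ge> 1" for x
    using one_le_power[OF that, of 2] by simp
  have dec: "y m * y1 m \<le> 0" if m: "m \<ge> 1" for m
  proof (rule ccontr)
    assume neg: "\<not> y m * y1 m \<le> 0"
    have F: "y x * y1 x > 0" if x: "x \<ge> m" for x
    proof (rule ccontr)
      assume "\<not> y x * y1 x > 0"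
      then have yx: "y x * y1 x \<le> 0" by linarith
      have "osc_V t \<ge> 0" if "t \<in> {m..x}" for t using that m by (intro V_nn) simp
      from recessive_propagates[OF sol this yx, of m] x have "y m * y1 m \<le> 0" by simp
      with neg show False by simp
    qed
    have y_inc: "(y m)\<^sup>2 \<le> (y x)\<^sup>2" if x: "x \<ge> m" for x
    proof (rule DERIV_nonneg_imp_nondecreasing[OF x, of "\<lambda>x. (y x)\<^sup>2"])
      fix t assume "m \<le> t"
      have "((\<lambda>x. (y x)\<^sup>2) has_real_derivative 2 * (y t * y1 t)) (at t)"
        using DERIV_power[OF y_der, of 2 t] by (simp add: mult_ac)
      then show "\<exists>d. ((\<lambda>x. (y x)\<^sup>2) has_real_derivative d) (at t) \<and> 0 \<le> d"
        using F[OF \<open>m \<le> t\<close>] by (intro exI[of _ "2 * (y t * y1 t)"]) simp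
    qed
    have "(y m)\<^sup>2 > 0" using neg by auto
    moreover have "((\<lambda>x. (y x)\<^sup>2) \<longlongrightarrow> 0) at_top"
      using tendsto_power[OF lim, of 2] by simp
    ultimately have "\<forall>\<^sub>F x in at_top. (y x)\<^sup>2 < (y m)\<^sup>2" by (rule order_tendstoD(2)[rotated])
    moreover have "\<forall>\<^sub>F x in at_top. x \<ge> m" by (rule eventually_ge_at_top)
    ultimately have "\<forall>\<^sub>F x in (at_top :: real filter). False"
      by eventually_elim (use y_inc in force)
    then show False by simp
  qed
  have rec: "osc.recessive h y y1" unfolding osc.recessive_def using sol dec by auto
  have y0: "y 0 \<noteq> 0" using hermite_even_0[of k] by (simp add: y_def H_def)
  have y10: "y1 0 = 0" using pderiv_hermite_even_0[of k] by (simp add: y1_def H_def)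
  have ph: "osc_Th 0 / h = pi / 4 + real k * pi" by (simp add: h_def field_simps)
  have uu: "osc.wval y 0 = y 0" by (simp add: osc.wval_def osc.amp_def)
  have zz: "osc.wslope h y y1 0 = 0" by (simp add: osc.wslope_def osc.amp1_def y10)
  have coeffs: "osc.sin_coeff h y y1 0 = y 0 * sin (osc_Th 0 / h)" "osc.cos_coeff h y y1 0 = y 0 * cos (osc_Th 0 / h)"
    unfolding osc.sin_coeff_def osc.cos_coeff_def uu zz by simp_all
  have "osc.sin_coeff h y y1 0 = osc.cos_coeff h y y1 0"
    unfolding coeffs ph by (simp add: sin_add cos_add sin_45 cos_45)
  moreover have "osc.cos_coeff h y y1 0 \<noteq> 0"
    unfolding coeffs ph using y0 by (simp add: cos_add cos_45)
  ultimately show ?thesis using that rec by blast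
qed

text \<open>Comparison with the oscillator. Among the numbers \<open>4 k + 1\<close> one is at least \<open>1 / h\<close> and at most \<open>6 / h\<close>. So
  the ratio \<open>mu ^ 6\<close> of the two parameters lies between \<open>1 / 6\<close> and \<open>1\<close>, and \<open>mu \<ge> 1 / 2\<close>.\<close>
lemma (in turning_point) recessive_phase:
  assumes x0: "x0 \<in> S"
  obtains C where "C \<ge> 0"
    "\<And>h y y1. 0 < h \<Longrightarrow> h \<le> 1 \<Longrightarrow> recessive h y y1 \<Longrightarrow>
      \<bar>sin_coeff h y y1 x0 - cos_coeff h y y1 x0\<bar> \<le> C * h * sqrt (intensity h y y1 x0)"
proof -
  have "(1 / 2 :: real) > 0" "(1 / 2 :: real) \<le> 1" by simp_all
  from connection_universality[OF turning_point_axioms oscillator_turning_point x0 _ this, of 0]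
  obtain C where C: "C \<ge> 0"
    "\<And>h mu y y1 w w1. 0 < h \<Longrightarrow> h \<le> 1 \<Longrightarrow> 1 / 2 \<le> mu \<Longrightarrow> mu \<le> 1 \<Longrightarrow>
      recessive h y y1 \<Longrightarrow> osc.recessive (h * mu ^ 6) w w1 \<Longrightarrow>
      \<bar>sin_coeff h y y1 x0 * osc.cos_coeff (h * mu ^ 6) w w1 0 - cos_coeff h y y1 x0 * osc.sin_coeff (h * mu ^ 6) w w1 0\<bar>
      \<le> C * h * (sqrt (intensity h y y1 x0) * sqrt (osc.intensity (h * mu ^ 6) w w1 0))" by auto
  show ?thesis
  proof (rule that[of "C * sqrt 2"])
    show "C * sqrt 2 \<ge> 0" using C(1) by simp
    fix h y y1 assume h: "0 < h" "h \<le> 1" and rec: "recessive h y y1"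
    define k where "k = nat \<lceil>1 / (4 * h)\<rceil>"
    define h' where "h' = 1 / (4 * real k + 1)"
    have k: "1 / (4 * h) \<le> real k" "real k < 1 / (4 * h) + 1"
      using h by (auto simp: k_def) linarith+
    have h'_h: "h' / h \<le> 1" "1 / 64 \<le> h' / h"
      using k h by (auto simp: h'_def field_simps)
    define mu where "mu = root 6 (h' / h)"
    have mu6: "mu ^ 6 = h' / h" 
    proof -
      have "0 \<le> h' / h" using h'_h by linarith
      then show ?thesis unfolding mu_def by (intro real_root_pow_pos2) simp_all
    qed
    have mu: "1 / 2 \<le> mu" "mu \<le> 1"
    proof -
      have "root 6 ((1 / 2) ^ 6) \<le> mu" unfolding mu_def using h'_h by (simp add: power_divide)
      then show "1 / 2 \<le> mu" by (simp only: real_root_power_cancel)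
      show "mu \<le> 1" using h'_h by (simp add: mu_def)
    qed
    have hmu: "h * mu ^ 6 = h'" using h by (simp add: mu6)
    obtain w w1 where w: "osc.recessive h' w w1" "osc.sin_coeff h' w w1 0 = osc.cos_coeff h' w w1 0" "osc.cos_coeff h' w w1 0 \<noteq> 0"
      by (rule oscillator_phase[of k, folded h'_def])
    define c where "c = osc.cos_coeff h' w w1 0"
    have N: "sqrt (osc.intensity h' w w1 0) = sqrt 2 * \<bar>c\<bar>"
      unfolding osc.intensity_eq w(2) by (simp add: c_def real_sqrt_mult flip: mult_2)
    have "\<bar>sin_coeff h y y1 x0 - cos_coeff h y y1 x0\<bar> * \<bar>c\<bar> = \<bar>sin_coeff h y y1 x0 * c - cos_coeff h y y1 x0 * c\<bar>"
      by (simp add: left_diff_distrib flip: abs_mult)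
    also have "\<dots> \<le> C * h * (sqrt (intensity h y y1 x0) * (sqrt 2 * \<bar>c\<bar>))"
      using C(2)[OF h mu rec, of w w1] w unfolding hmu by (simp add: N c_def)
    also have "\<dots> = (C * sqrt 2 * h * sqrt (intensity h y y1 x0)) * \<bar>c\<bar>" by (simp add: mult_ac)
    finally show "\<bar>sin_coeff h y y1 x0 - cos_coeff h y y1 x0\<bar> \<le> C * sqrt 2 * h * sqrt (intensity h y y1 x0)"
      using w(3) by (simp add: c_def)
  qed
qed

section \<open>Asymptotic formulas on one side of the barrier\<close>

lemma eventually_small: "\<forall>\<^sub>F h in at_right (0::real). 0 < h \<and> h \<le> 1"
  unfolding eventually_at_right_field by (intro exI[of _ 1]) auto

text \<open>The remainder is \<open>O(h)\<close> and its derivative is \<open>O(1)\<close>. The derivative is existentially quantified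
  so that the property is easily transported along a reflection.\<close>
definition small_remainder :: "real \<Rightarrow> real \<Rightarrow> real set \<Rightarrow> (real \<Rightarrow> real) \<Rightarrow> bool" where
  "small_remainder C h T r \<longleftrightarrow>
     (\<forall>x\<in>T. \<bar>r x\<bar> \<le> C * h \<and> (\<exists>D. (r has_real_derivative D) (at x) \<and> \<bar>D\<bar> \<le> C))"

text \<open>A point of the circle of radius \<open>A\<close> that is close to the diagonal is close to the point with \<open>s + c \<ge> 0\<close>
  where the circle meets the diagonal: the common coordinate of that point lies between \<open>s\<close> and \<open>c\<close>.\<close>
lemma diagonal_nearest:
  fixes s c A :: real
  assumes n: "s\<^sup>2 + c\<^sup>2 = A\<^sup>2" and A: "A > 0" and half: "s + c \<ge> 0"
  shows "\<bar>s - A * (sqrt 2 / 2)\<bar> \<le> \<bar>s - c\<bar>" "\<bar>c - A * (sqrt 2 / 2)\<bar> \<le> \<bar>s - c\<bar>"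
proof -
  define p where "p = A * (sqrt 2 / 2)"
  have p: "p > 0" "2 * p\<^sup>2 = s\<^sup>2 + c\<^sup>2" using A n by (auto simp: p_def power_mult_distrib power_divide)
  have "p \<le> max s c"
  proof (rule ccontr)
    assume "\<not> p \<le> max s c"
    then have "\<bar>s\<bar> < p \<and> \<bar>c\<bar> \<le> p \<or> \<bar>c\<bar> < p \<and> \<bar>s\<bar> \<le> p" using half by linarith
    then have "s\<^sup>2 + c\<^sup>2 < p\<^sup>2 + p\<^sup>2"
    proof
      assume "\<bar>s\<bar> < p \<and> \<bar>c\<bar> \<le> p"
      then show ?thesis using power_strict_mono[of "\<bar>s\<bar>" p 2] power_mono[of "\<bar>c\<bar>" p 2] by simp
    next
      assume "\<bar>c\<bar> < p \<and> \<bar>s\<bar> \<le> p"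
      then show ?thesis using power_strict_mono[of "\<bar>c\<bar>" p 2] power_mono[of "\<bar>s\<bar>" p 2] by simp
    qed
    with p show False by simp
  qed
  moreover have "min s c \<le> p"
  proof (rule ccontr)
    assume "\<not> min s c \<le> p"
    then have "p < s" "p < c" by auto
    then have "p\<^sup>2 < s\<^sup>2" "p\<^sup>2 < c\<^sup>2" using p by (auto intro: power_strict_mono)
    with p show False by simp
  qed
  ultimately have "\<bar>s - p\<bar> \<le> \<bar>s - c\<bar> \<and> \<bar>c - p\<bar> \<le> \<bar>s - c\<bar>" by linarith
  then show "\<bar>s - A * (sqrt 2 / 2)\<bar> \<le> \<bar>s - c\<bar>" "\<bar>c - A * (sqrt 2 / 2)\<bar> \<le> \<bar>s - c\<bar>" by (auto simp: p_def)
qed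

context allowed_region
begin

text \<open>The remainder and \<open>h\<close> times its derivative are combinations, with sines and cosines as weights, of the
  two differences \<open>sin_coeff / A - cos th\<close> and \<open>cos_coeff / A - sin th\<close>. These are \<open>O(h)\<close> at the base point
  by hypothesis and elsewhere by \<open>coefficient_drift\<close>.\<close>
lemma wkb_remainder:
  assumes x0: "x0 \<in> S" and ac: "{a..c} \<subseteq> S" and K: "K \<ge> 0"
  obtains C where
    "\<And>h y y1 A th. 0 < h \<Longrightarrow> h \<le> 1 \<Longrightarrow> sol_on h V S y y1 \<Longrightarrow> A = sqrt (intensity h y y1 x0) \<Longrightarrow> A > 0 \<Longrightarrow>
      \<bar>sin_coeff h y y1 x0 - A * cos th\<bar> \<le> K * h * A \<Longrightarrow> \<bar>cos_coeff h y y1 x0 - A * sin th\<bar> \<le> K * h * A \<Longrightarrow>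
      small_remainder C h {a..c} (\<lambda>x. y x / (A * amp x) - sin (Th x / h + th))"
proof -
  obtain C1 where C1: "C1 \<ge> 0"
    "\<And>h y y1 x. 0 < h \<Longrightarrow> h \<le> 1 \<Longrightarrow> sol_on h V S y y1 \<Longrightarrow> x \<in> {a..c} \<Longrightarrow>
       \<bar>sin_coeff h y y1 x - sin_coeff h y y1 x0\<bar> \<le> C1 * h * sqrt (intensity h y y1 x0) \<and>
       \<bar>cos_coeff h y y1 x - cos_coeff h y y1 x0\<bar> \<le> C1 * h * sqrt (intensity h y y1 x0) \<and>
       intensity h y y1 x \<le> C1 * intensity h y y1 x0"
    by (fact coefficient_drift[OF ac x0])
  have "continuous_on {a..c} (\<lambda>x. 1 / (amp x)\<^sup>2)"
    by (intro continuous_intros continuous_on_subset[OF cont_amp ac]) (use ac amp_pos in force)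
  then obtain M where M: "M \<ge> 0" "\<And>x. x \<in> {a..c} \<Longrightarrow> \<bar>1 / (amp x)\<^sup>2\<bar> \<le> M"
    by (rule bounded_on_interval) blast
  define L where "L = 2 * (C1 + K)"
  have L: "L \<ge> 0" using C1 K by (simp add: L_def)
  define C where "C = L * (1 + M)"
  have C: "L \<le> C" "M * L \<le> C" using L M by (auto simp: C_def algebra_simps)
  show ?thesis
  proof (rule that[of C])
    fix h y y1 A th
    assume h: "0 < h" "h \<le> 1" and sol: "sol_on h V S y y1" and A: "A = sqrt (intensity h y y1 x0)" "A > 0"
      and s0: "\<bar>sin_coeff h y y1 x0 - A * cos th\<bar> \<le> K * h * A" and c0: "\<bar>cos_coeff h y y1 x0 - A * sin th\<bar> \<le> K * h * A"
    show "small_remainder C h {a..c} (\<lambda>x. y x / (A * amp x) - sin (Th x / h + th))"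
      unfolding small_remainder_def
    proof
      fix x assume x: "x \<in> {a..c}"
      have xS: "x \<in> S" using x ac by auto
      have f0: "amp x > 0" by (rule amp_pos[OF xS])
      define ph where "ph = Th x / h"
      define p where "p = sin_coeff h y y1 x / A - cos th"
      define q where "q = cos_coeff h y y1 x / A - sin th"
      note dr = C1(2)[OF h sol x, folded A(1)]
      have "\<bar>sin_coeff h y y1 x - A * cos th\<bar> \<le> \<bar>sin_coeff h y y1 x - sin_coeff h y y1 x0\<bar> + \<bar>sin_coeff h y y1 x0 - A * cos th\<bar>"
        by linarith
      also have "\<dots> \<le> C1 * h * A + K * h * A" by (rule add_mono[OF conjunct1[OF dr] s0])
      also have "\<dots> = (C1 + K) * h * A" by (simp add: algebra_simps)
      finally have "\<bar>sin_coeff h y y1 x - A * cos th\<bar> \<le> (C1 + K) * h * A" .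
      moreover have "sin_coeff h y y1 x - A * cos th = A * p" using A by (simp add: p_def algebra_simps)
      ultimately have p: "\<bar>p\<bar> \<le> (C1 + K) * h" using A by (simp add: abs_mult mult.commute[of A])
      have "\<bar>cos_coeff h y y1 x - A * sin th\<bar> \<le> \<bar>cos_coeff h y y1 x - cos_coeff h y y1 x0\<bar> + \<bar>cos_coeff h y y1 x0 - A * sin th\<bar>"
        by linarith
      also have "\<dots> \<le> C1 * h * A + K * h * A" by (rule add_mono[OF conjunct1[OF conjunct2[OF dr]] c0])
      also have "\<dots> = (C1 + K) * h * A" by (simp add: algebra_simps)
      finally have "\<bar>cos_coeff h y y1 x - A * sin th\<bar> \<le> (C1 + K) * h * A" .
      moreover have "cos_coeff h y y1 x - A * sin th = A * q" using A by (simp add: q_def algebra_simps)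
      ultimately have q: "\<bar>q\<bar> \<le> (C1 + K) * h" using A by (simp add: abs_mult mult.commute[of A])
      have comb: "\<bar>p * v + q * w\<bar> \<le> L * h" if "\<bar>v\<bar> \<le> 1" "\<bar>w\<bar> \<le> 1" for v w
      proof -
        have "\<bar>p * v\<bar> \<le> (C1 + K) * h * 1" "\<bar>q * w\<bar> \<le> (C1 + K) * h * 1"
          unfolding abs_mult using C1(1) K h
          by (auto intro!: mult_mono[OF p that(1)] mult_mono[OF q that(2)] mult_nonneg_nonneg simp del: mult_1_right)
        then have "\<bar>p * v + q * w\<bar> \<le> (C1 + K) * h + (C1 + K) * h" by linarith
        also have "\<dots> = L * h" by (simp add: L_def algebra_simps)
        finally show ?thesis .
      qed
      have "y x / (A * amp x) = wval y x / A" by (simp add: wval_def)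
      also have "\<dots> = sin_coeff h y y1 x / A * sin ph + cos_coeff h y y1 x / A * cos ph"
        unfolding ph_def wval_eq[of y x h y1] by (simp add: add_divide_distrib)
      finally have "y x / (A * amp x) - sin (ph + th) = p * sin ph + q * cos ph"
        by (simp add: p_def q_def sin_add algebra_simps)
      then have 1: "\<bar>y x / (A * amp x) - sin (Th x / h + th)\<bar> \<le> L * h"
        using comb[of "sin ph" "cos ph"] by (simp add: ph_def)
      have hn: "h \<noteq> 0" using h by simp
      have "((\<lambda>x. wval y x / A - sin (Th x / h + th)) has_real_derivative
          - wslope h y y1 x / (h * (amp x)\<^sup>2) / A - cos (Th x / h + th) * (- 1 / (h * (amp x)\<^sup>2))) (at x)"
        by (rule derivative_eq_intros DERIV_cdivide wval_der[OF hn sol xS] phase_der[OF hn sol xS] refl | simp)+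
      moreover have "- wslope h y y1 x / (h * (amp x)\<^sup>2) / A - cos (Th x / h + th) * (- 1 / (h * (amp x)\<^sup>2))
          = - (wslope h y y1 x / A - cos (ph + th)) * (1 / (amp x)\<^sup>2 / h)"
        by (simp add: ph_def algebra_simps)
      moreover have "wslope h y y1 x / A - cos (ph + th) = p * cos ph + q * (- sin ph)"
        unfolding wslope_eq[of h y y1 x] ph_def[symmetric]
        by (simp add: p_def q_def cos_add algebra_simps diff_divide_distrib)
      ultimately have D: "((\<lambda>x. y x / (A * amp x) - sin (Th x / h + th)) has_real_derivative
          - (p * cos ph + q * (- sin ph)) * (1 / (amp x)\<^sup>2 / h)) (at x)"
        by (simp add: wval_def mult.commute)
      have "\<bar>- (p * cos ph + q * (- sin ph)) * (1 / (amp x)\<^sup>2 / h)\<bar>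
          = \<bar>p * cos ph + q * (- sin ph)\<bar> * \<bar>1 / (amp x)\<^sup>2\<bar> / h"
        using h unfolding abs_mult abs_minus_cancel abs_divide by simp
      also have "\<dots> \<le> (L * h) * M / h"
        using comb[of "cos ph" "- sin ph"] M(2)[OF x] M(1) L h by (intro divide_right_mono mult_mono) auto
      also have "\<dots> = M * L" using h by simp
      finally have "\<bar>- (p * cos ph + q * (- sin ph)) * (1 / (amp x)\<^sup>2 / h)\<bar> \<le> C" using C by linarith
      moreover have "L * h \<le> C * h" using C h by (intro mult_right_mono) auto
      ultimately show "\<bar>y x / (A * amp x) - sin (Th x / h + th)\<bar> \<le> C * h \<and>
          (\<exists>D. ((\<lambda>x. y x / (A * amp x) - sin (Th x / h + th)) has_real_derivative D) (at x) \<and> \<bar>D\<bar> \<le> C)"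
        using 1 D by (intro conjI exI[of _ "- (p * cos ph + q * (- sin ph)) * (1 / (amp x)\<^sup>2 / h)"]) auto
    qed
  qed
qed

end

context turning_point
begin

text \<open>The predicate \<open>R\<close> selects the parameters for which the solution is recessive. For these the phase is
  set to \<open>pi / 4\<close> or \<open>pi / 4 + pi\<close>, whichever is nearer to the coefficient vector; for all others it is
  the polar angle of the coefficient vector.\<close>
lemma wkb_family:
  fixes psi dpsi :: "real \<Rightarrow> real \<Rightarrow> real"
  assumes x0: "x0 \<in> S"
    and sol: "\<forall>\<^sub>F h in at_right 0. sol_on h V S (psi h) (dpsi h) \<and> (psi h x0 \<noteq> 0 \<or> dpsi h x0 \<noteq> 0)"
    and rec: "\<forall>\<^sub>F h in at_right 0. R h \<longrightarrow> recessive h (psi h) (dpsi h)"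
  shows "\<exists>A th. (\<forall>h. A h > 0) \<and> (\<forall>h. R h \<longrightarrow> (\<exists>k::int. th h = pi / 4 + of_int k * pi)) \<and>
    (\<forall>a c. {a..c} \<subseteq> S \<longrightarrow> (\<exists>C. \<forall>\<^sub>F h in at_right 0. small_remainder C h {a..c}
       (\<lambda>x. psi h x / (A h * amp x) - sin (Th x / h + th h))))"
proof -
  define n where "n h = intensity h (psi h) (dpsi h) x0" for h
  \<comment> \<open>Only eventually is \<open>psi h\<close> a nonzero solution; the value \<open>1\<close> keeps the amplitude positive at all other \<open>h\<close>.\<close>
  define A where "A h = (if n h > 0 then sqrt (n h) else 1)" for h
  define s where "s h = sin_coeff h (psi h) (dpsi h) x0" for h
  define c where "c h = cos_coeff h (psi h) (dpsi h) x0" for h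
  have A_pos: "A h > 0" for h by (simp add: A_def)
  have polar: "\<exists>t. s h = A h * cos t \<and> c h = A h * sin t" if "n h > 0" for h
  proof -
    have "(s h)\<^sup>2 + (c h)\<^sup>2 = (A h)\<^sup>2" using that by (simp add: A_def n_def s_def c_def intensity_eq)
    then have "(s h / A h)\<^sup>2 + (c h / A h)\<^sup>2 = 1"
      using A_pos[of h] by (simp add: power_divide flip: add_divide_distrib)
    from sincos_total_2pi_le[OF this] show ?thesis using A_pos[of h] by (auto simp: field_simps)
  qed
  define th where "th h = (if R h then (if s h + c h \<ge> 0 then pi / 4 else pi / 4 + pi)
      else (SOME t. s h = A h * cos t \<and> c h = A h * sin t))" for h
  obtain C0 where C0: "C0 \<ge> 0"
    "\<And>h y y1. 0 < h \<Longrightarrow> h \<le> 1 \<Longrightarrow> recessive h y y1 \<Longrightarrow>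
      \<bar>sin_coeff h y y1 x0 - cos_coeff h y y1 x0\<bar> \<le> C0 * h * sqrt (intensity h y y1 x0)"
    by (fact recessive_phase[OF x0])
  have good: "\<forall>\<^sub>F h in at_right 0. 0 < h \<and> h \<le> 1 \<and> sol_on h V S (psi h) (dpsi h) \<and> A h = sqrt (n h) \<and>
      \<bar>s h - A h * cos (th h)\<bar> \<le> C0 * h * A h \<and> \<bar>c h - A h * sin (th h)\<bar> \<le> C0 * h * A h"
    using sol rec eventually_small
  proof eventually_elim
    case (elim h)
    then have h: "0 < h" "h \<le> 1" by auto
    have n: "n h > 0"
      using elim intensity_zero_imp[OF x0, of h "psi h" "dpsi h"] intensity_nonneg[of h "psi h" "dpsi h" x0] h
      by (auto simp: n_def less_le)
    then have A: "A h = sqrt (n h)" by (simp add: A_def)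
    have "\<bar>s h - A h * cos (th h)\<bar> \<le> C0 * h * A h \<and> \<bar>c h - A h * sin (th h)\<bar> \<le> C0 * h * A h"
    proof (cases "R h")
      case False
      then have "s h = A h * cos (th h) \<and> c h = A h * sin (th h)"
        using someI_ex[OF polar[OF n]] by (simp add: th_def)
      then show ?thesis using C0(1) h A_pos[of h] by simp
    next
      case True
      have d: "\<bar>s h - c h\<bar> \<le> C0 * h * A h"
        using C0(2)[OF h, of "psi h" "dpsi h"] elim True by (simp add: s_def c_def A n_def)
      have sq: "(s h)\<^sup>2 + (c h)\<^sup>2 = (A h)\<^sup>2" using n by (simp add: A_def n_def s_def c_def intensity_eq)
      show ?thesis
      proof (cases "s h + c h \<ge> 0")
        case True
        with \<open>R h\<close> have th: "th h = pi / 4" by (simp add: th_def)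
        show ?thesis
          using diagonal_nearest[OF sq A_pos True] d unfolding th cos_45 sin_45 by linarith
      next
        case False
        with \<open>R h\<close> have th: "th h = pi / 4 + pi" by (simp add: th_def)
        have cs: "cos (th h) = - (sqrt 2 / 2)" "sin (th h) = - (sqrt 2 / 2)"
          unfolding th by (simp_all only: cos_periodic_pi sin_periodic_pi cos_45 sin_45)
        have "(- s h)\<^sup>2 + (- c h)\<^sup>2 = (A h)\<^sup>2" using sq by simp
        from diagonal_nearest[OF this A_pos] False
        have "\<bar>- s h - A h * (sqrt 2 / 2)\<bar> \<le> \<bar>- s h - - c h\<bar>" "\<bar>- c h - A h * (sqrt 2 / 2)\<bar> \<le> \<bar>- s h - - c h\<bar>"
          by auto
        moreover have "s h - A h * cos (th h) = - (- s h - A h * (sqrt 2 / 2))"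
          "c h - A h * sin (th h) = - (- c h - A h * (sqrt 2 / 2))" unfolding cs by simp_all
        moreover have "\<bar>- s h - - c h\<bar> = \<bar>s h - c h\<bar>" by simp
        ultimately show ?thesis using d by (simp only: abs_minus_cancel) linarith
      qed
    qed
    then show ?case using elim A h by blast
  qed
  show ?thesis
  proof (rule exI[of _ A], rule exI[of _ th], intro conjI allI impI)
    show "A h > 0" for h by (rule A_pos)
    fix h assume "R h"
    then have "th h = pi / 4 + of_int 0 * pi \<or> th h = pi / 4 + of_int 1 * pi" by (simp add: th_def)
    then show "\<exists>k::int. th h = pi / 4 + of_int k * pi" by blast
  next
    fix a b' assume ab: "{a..b'} \<subseteq> S"
    obtain C where C:
      "\<And>h y y1 A th. 0 < h \<Longrightarrow> h \<le> 1 \<Longrightarrow> sol_on h V S y y1 \<Longrightarrow> A = sqrt (intensity h y y1 x0) \<Longrightarrow> A > 0 \<Longrightarrow>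
      \<bar>sin_coeff h y y1 x0 - A * cos th\<bar> \<le> C0 * h * A \<Longrightarrow> \<bar>cos_coeff h y y1 x0 - A * sin th\<bar> \<le> C0 * h * A \<Longrightarrow>
      small_remainder C h {a..b'} (\<lambda>x. y x / (A * amp x) - sin (Th x / h + th))"
      by (fact wkb_remainder[OF x0 ab C0(1)])
    from good have "\<forall>\<^sub>F h in at_right 0. small_remainder C h {a..b'}
       (\<lambda>x. psi h x / (A h * amp x) - sin (Th x / h + th h))"
    proof eventually_elim
      case (elim h)
      show ?case
        by (intro C) (use elim A_pos[of h] in \<open>auto simp: n_def s_def c_def\<close>)
    qed
    then show "\<exists>C. \<forall>\<^sub>F h in at_right 0. small_remainder C h {a..b'}
       (\<lambda>x. psi h x / (A h * amp x) - sin (Th x / h + th h))" by blast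
  qed
qed

end

text \<open>The left side of a barrier. The right side is the same statement for the reflected potential, so the
  derivatives and the phase function are left as parameters here.\<close>
lemma one_sided_wkb:
  fixes V V1 V2 V3 Th :: "real \<Rightarrow> real" and psi dpsi :: "real \<Rightarrow> real \<Rightarrow> real"
  assumes I: "open I" "is_interval I" "b \<in> I" "m \<in> I" "b < m"
    and V: "\<And>x. x \<in> I \<Longrightarrow> (V has_real_derivative V1 x) (at x)"
    and V1: "\<And>x. x \<in> I \<Longrightarrow> (V1 has_real_derivative V2 x) (at x)"
    and V2: "continuous_on I V2"
    and U: "open U" "b \<in> U" "U \<subseteq> I" "\<And>x. x \<in> U \<Longrightarrow> (V2 has_real_derivative V3 x) (at x)" "continuous_on U V3"
    and Vb: "V b = 0" "V1 b > 0" and neg: "\<And>x. x \<in> I \<Longrightarrow> x < b \<Longrightarrow> V x < 0"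
    and pos: "\<And>x. x \<in> {b..m} \<Longrightarrow> V x \<ge> 0"
    and Th: "continuous_on I Th" "Th b = 0" "\<And>x. x \<in> I \<Longrightarrow> x < b \<Longrightarrow> (Th has_real_derivative - sqrt (- V x)) (at x)"
    and sol: "\<forall>\<^sub>F h in at_right 0. sol_on h V I (psi h) (dpsi h) \<and> (\<exists>x\<in>I. psi h x \<noteq> 0)"
  shows "\<exists>A th. (\<forall>h. A h > 0) \<and>
    (\<forall>h. psi h m * dpsi h m \<le> 0 \<longrightarrow> (\<exists>k::int. th h = pi / 4 + of_int k * pi)) \<and>
    (\<forall>a c. {a..c} \<subseteq> {x\<in>I. x < b} \<longrightarrow> (\<exists>C. \<forall>\<^sub>F h in at_right 0. small_remainder C h {a..c}
       (\<lambda>x. psi h x / (A h * (- V x) powr (- 1 / 4)) - sin (Th x / h + th h))))"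
proof -
  define S where "S = {x\<in>I. x < b}"
  have S: "S = I \<inter> {..<b}" by (auto simp: S_def)
  have bm: "{b..m} \<subseteq> I"
  proof
    fix x assume "x \<in> {b..m}"
    then show "x \<in> I" using I unfolding is_interval_1 by (meson atLeastAtMost_iff)
  qed
  \<comment> \<open>Cutting \<open>U\<close> off at \<open>m\<close> keeps it inside the part of the barrier where the solution is known to decay.\<close>
  have tp: "turning_point S V V1 V2 Th V3 (U \<inter> {..<m}) b"
  proof unfold_locales
    show "open S" unfolding S using I by (intro open_Int) auto
    show "is_interval S" unfolding S by (rule is_interval_Int[OF I(2)]) (simp add: is_interval_1)
    show "continuous_on S V2" by (rule continuous_on_subset[OF V2]) (auto simp: S)
    show "open (U \<inter> {..<m})" using U by (intro open_Int) auto
    show "continuous_on (U \<inter> {..<m}) V3" by (rule continuous_on_subset[OF U(5)]) auto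
    show "continuous_on (insert b S) Th" by (rule continuous_on_subset[OF Th(1)]) (use I in \<open>auto simp: S\<close>)
    show "b \<in> U \<inter> {..<m}" using U(2) I(5) by simp
  qed (use V V1 U(3,4) Vb neg Th(2,3) in \<open>auto simp: S\<close>)
  interpret turning_point S V V1 V2 Th V3 "U \<inter> {..<m}" b by (rule tp)
  obtain e where e: "e > 0" "ball b e \<subseteq> I" using I by (meson open_contains_ball)
  define x0 where "x0 = b - e / 2"
  have "x0 \<in> ball b e" using e by (simp add: x0_def dist_real_def)
  then have x0: "x0 \<in> S" using e by (auto simp: S x0_def)
  have V_cont: "continuous_on I V" by (rule DERIV_continuous_on[OF has_field_derivative_at_within[OF V]])
  have sol': "\<forall>\<^sub>F h in at_right 0. sol_on h V S (psi h) (dpsi h) \<and> (psi h x0 \<noteq> 0 \<or> dpsi h x0 \<noteq> 0)"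
    using sol
  proof eventually_elim
    case (elim h)
    have "x0 \<in> I" using x0 by (auto simp: S)
    then have "psi h x0 \<noteq> 0 \<or> dpsi h x0 \<noteq> 0"
      using sol_on_zero[OF conjunct1[OF elim] I(2) V_cont, of x0] elim by blast
    moreover have "sol_on h V S (psi h) (dpsi h)" using elim by (auto simp: S intro: sol_on_subset)
    ultimately show ?case by blast
  qed
  have rec: "\<forall>\<^sub>F h in at_right 0. psi h m * dpsi h m \<le> 0 \<longrightarrow> recessive h (psi h) (dpsi h)"
    using sol
  proof eventually_elim
    case (elim h)
    show ?case
    proof
      assume m: "psi h m * dpsi h m \<le> 0"
      have sol_bm: "sol_on h V {b..m} (psi h) (dpsi h)" using elim bm by (auto intro: sol_on_subset)
      have "psi h x * dpsi h x \<le> 0" if "x \<in> U \<inter> {..<m}" "b \<le> x" for x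
        by (rule recessive_propagates[OF sol_bm pos m]) (use that in auto)
      moreover have "sol_on h V (S \<union> U \<inter> {..<m}) (psi h) (dpsi h)"
        using elim U(3) by (auto simp: S intro: sol_on_subset)
      ultimately show "recessive h (psi h) (dpsi h)" unfolding recessive_def by blast
    qed
  qed
  from wkb_family[where R="\<lambda>h. psi h m * dpsi h m \<le> 0", OF x0 sol' rec]
  show ?thesis unfolding amp_def S_def .
qed

section \<open>Both sides of the barrier\<close>

lemma is_interval_einterval: "is_interval (einterval a b)"
  unfolding is_interval_1
proof (intro ballI allI impI)
  fix p q x assume "p \<in> einterval a b" "q \<in> einterval a b" "p \<le> x \<and> x \<le> q"
  then have *: "a < ereal p" "ereal p \<le> ereal x" "ereal x \<le> ereal q" "ereal q < b"
    by (auto simp: einterval_iff)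
  from less_le_trans[OF *(1,2)] le_less_trans[OF *(3,4)] show "x \<in> einterval a b" by (simp add: einterval_iff)
qed

lemma oriented_integral_der:
  fixes g :: "real \<Rightarrow> real"
  assumes I: "open I" "is_interval I" "b \<in> I" "x \<in> I" and g: "continuous_on I g"
  shows "((\<lambda>u. LBINT y=ereal b..ereal u. g y) has_real_derivative g x) (at x)"
proof -
  have "min b x \<in> I" "max b x \<in> I" using I by (auto simp: min_def max_def)
  then obtain e1 e2 where e: "e1 > 0" "ball (min b x) e1 \<subseteq> I" "e2 > 0" "ball (max b x) e2 \<subseteq> I"
    using I(1) by (meson open_contains_ball)
  define p where "p = min b x - e1 / 2"
  define q where "q = max b x + e2 / 2"
  have "p \<in> ball (min b x) e1" "q \<in> ball (max b x) e2" using e by (auto simp: p_def q_def dist_real_def)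
  then have "p \<in> I" "q \<in> I" using e by auto
  then have sub: "{p..q} \<subseteq> I" using I(2) unfolding is_interval_1 by (meson atLeastAtMost_iff subsetI)
  have pq: "p < b" "b < q" "p < x" "x < q" using e by (auto simp: p_def q_def)
  have "((\<lambda>u. LBINT y=b..u. g y) has_vector_derivative g x) (at x within {p..q})"
    by (rule interval_integral_FTC2) (use pq continuous_on_subset[OF g sub] in auto)
  then have "((\<lambda>u. LBINT y=b..u. g y) has_real_derivative g x) (at x within {p..q})"
    by (simp add: has_real_derivative_iff_has_vector_derivative)
  moreover have "at x within {p..q} = at x" using pq by (intro at_within_interior) (auto simp: interior_cbox)
  ultimately show ?thesis by simp
qed

text \<open>The remainder is the one that makes the asymptotic formula an identity.\<close>
lemma wkb_asymptoticsI:
  assumes A: "\<And>h. A h > 0" and V: "\<And>x. x \<in> I \<Longrightarrow> v x < lam"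
    and bound: "\<And>a c. {a..c} \<subseteq> I \<Longrightarrow> \<exists>C. \<forall>\<^sub>F h in at_right 0. small_remainder C h {a..c}
       (\<lambda>x. psi h x / (A h * (lam - v x) powr (- 1 / 4)) - sin (Th x / h + th h))"
  shows "wkb_asymptotics v lam Th I psi A th"
  unfolding wkb_asymptotics_def
proof (intro exI[of _ "\<lambda>h x. psi h x / (A h * (lam - v x) powr (- 1 / 4)) - sin (Th x / h + th h)"] conjI allI impI)
  show "\<forall>\<^sub>F h in at_right 0. \<forall>x\<in>I. psi h x = A h * (lam - v x) powr (- 1 / 4) *
      (sin (Th x / h + th h) + (psi h x / (A h * (lam - v x) powr (- 1 / 4)) - sin (Th x / h + th h)))"
  proof (intro always_eventually allI ballI)
    fix h x assume "x \<in> I"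
    then have "A h * (lam - v x) powr (- 1 / 4) \<noteq> 0" using A[of h] V[of x] by simp
    then show "psi h x = A h * (lam - v x) powr (- 1 / 4) *
      (sin (Th x / h + th h) + (psi h x / (A h * (lam - v x) powr (- 1 / 4)) - sin (Th x / h + th h)))" by simp
  qed
  fix a c assume "{a..c} \<subseteq> I"
  from bound[OF this] obtain C where "\<forall>\<^sub>F h in at_right 0. small_remainder C h {a..c}
       (\<lambda>x. psi h x / (A h * (lam - v x) powr (- 1 / 4)) - sin (Th x / h + th h))" by blast
  moreover have "\<bar>r x\<bar> \<le> C * h \<and> r differentiable (at x) \<and> \<bar>deriv r x\<bar> \<le> C"
    if small: "small_remainder C h T r" "x \<in> T" for h r x T
  proof -
    obtain D where "(r has_real_derivative D) (at x)" "\<bar>D\<bar> \<le> C" "\<bar>r x\<bar> \<le> C * h"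
      using small unfolding small_remainder_def by blast
    then show ?thesis by (auto simp: DERIV_imp_deriv real_differentiable_def)
  qed
  ultimately show "\<exists>C. \<forall>\<^sub>F h in at_right 0. \<forall>x\<in>{a..c}.
       \<bar>psi h x / (A h * (lam - v x) powr (- 1 / 4)) - sin (Th x / h + th h)\<bar> \<le> C * h \<and>
       (\<lambda>x. psi h x / (A h * (lam - v x) powr (- 1 / 4)) - sin (Th x / h + th h)) differentiable (at x) \<and>
       \<bar>deriv (\<lambda>x. psi h x / (A h * (lam - v x) powr (- 1 / 4)) - sin (Th x / h + th h)) x\<bar> \<le> C"
    by (intro exI[of _ C]) (elim eventually_mono, intro ballI, assumption)
qed

lemma C_k_on_der:
  assumes "C_k_on n g S" "i < n" "x \<in> S"
  shows "((deriv ^^ i) g has_real_derivative (deriv ^^ Suc i) g x) (at x)"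
  using assms by (auto simp: C_k_on_def DERIV_deriv_iff_real_differentiable)

theorem theorem5p5:
  fixes v :: "real \<Rightarrow> real" and lam b1 b2 :: real and x1 x2 :: ereal
    and psi :: "real \<Rightarrow> real \<Rightarrow> real"
  assumes "potential_barrier v lam x1 x2 b1 b2"
    and "\<forall>\<^sub>F h in at_right 0. schroedinger_solution h v lam (einterval x1 x2) (psi h) \<and>
           (\<exists>x\<in>einterval x1 x2. psi h x \<noteq> 0)"
  shows "\<exists>A1 A2 th1 th2 :: real \<Rightarrow> real.
    (\<forall>h>0. A1 h > 0 \<and> A2 h > 0) \<and>
    wkb_asymptotics v lam (phase_function 1 v lam b1) (einterval x1 (ereal b1)) psi A1 th1 \<and>
    wkb_asymptotics v lam (phase_function 2 v lam b2) (einterval (ereal b2) x2) psi A2 th2 \<and>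
    (\<forall>\<^sub>F h in at_right 0.
       (\<exists>k::int. th1 h = pi / 4 + of_int k * pi) \<or> (\<exists>k::int. th2 h = pi / 4 + of_int k * pi))"
proof -
  define I where "I = einterval x1 x2"
  have I: "open I" "is_interval I" by (simp_all add: I_def is_interval_einterval)
  note pb = assms(1)[unfolded potential_barrier_def, folded I_def]
  have C2: "C_k_on 2 v I" and b12: "b1 < b2" and zeros: "{x \<in> I. v x = lam} = {b1, b2}"
    and above: "\<And>x. x \<in> {b1<..<b2} \<Longrightarrow> lam < v x" and below: "\<And>x. x \<in> I - {b1..b2} \<Longrightarrow> v x < lam"
    and slopes: "0 < deriv v b1" "deriv v b2 < 0"
    using pb by auto
  obtain U1 where U1: "open U1" "b1 \<in> U1" "U1 \<subseteq> I" "C_k_on 3 v U1" using pb by auto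
  obtain U2 where U2: "open U2" "b2 \<in> U2" "U2 \<subseteq> I" "C_k_on 3 v U2" using pb by auto
  have b: "b1 \<in> I" "b2 \<in> I" "v b1 = lam" "v b2 = lam" using zeros by auto
  define m where "m = (b1 + b2) / 2"
  have m: "b1 < m" "m < b2" using b12 by (auto simp: m_def)
  have mI: "m \<in> I" using b m I(2) unfolding is_interval_1 by (meson less_imp_le)
  have v_der: "(v has_real_derivative deriv v x) (at x)"
    and v1_der: "(deriv v has_real_derivative deriv (deriv v) x) (at x)" if "x \<in> I" for x
    using C_k_on_der[OF C2 _ that, of 0] C_k_on_der[OF C2 _ that, of 1] by simp_all
  have v2_cont: "continuous_on I (deriv (deriv v))" using C2 by (simp add: C_k_on_def numeral_2_eq_2)
  have v_cont: "continuous_on I v" by (rule DERIV_continuous_on[OF has_field_derivative_at_within[OF v_der]])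
  have v2_der: "(deriv (deriv v) has_real_derivative deriv (deriv (deriv v)) x) (at x)"
    if "C_k_on 3 v U" "x \<in> U" for U x
    using C_k_on_der[OF that(1) _ that(2), of 2] by (simp add: numeral_2_eq_2)
  have v3_cont: "continuous_on U (deriv (deriv (deriv v)))" if "C_k_on 3 v U" for U
    using that by (simp add: C_k_on_def numeral_3_eq_3)
  have root_cont: "continuous_on I (\<lambda>y. sqrt (lam - v y))" by (intro continuous_intros v_cont)
  have sol: "\<forall>\<^sub>F h in at_right 0. sol_on h (\<lambda>x. v x - lam) I (psi h) (deriv (psi h)) \<and> (\<exists>x\<in>I. psi h x \<noteq> 0)"
    using assms(2)[folded I_def] eventually_small
  proof eventually_elim
    case (elim h)
    then have h: "h > 0" and s: "schroedinger_solution h v lam I (psi h)" by auto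
    have "sol_on h (\<lambda>x. v x - lam) I (psi h) (deriv (psi h))"
      unfolding sol_on_def
    proof (intro ballI conjI)
      fix x assume "x \<in> I"
      with s have d: "psi h differentiable (at x)" "deriv (psi h) differentiable (at x)"
        and eq: "- h\<^sup>2 * deriv (deriv (psi h)) x + v x * psi h x = lam * psi h x"
        unfolding schroedinger_solution_def by auto
      show "(psi h has_real_derivative deriv (psi h) x) (at x)"
        using d by (simp add: DERIV_deriv_iff_real_differentiable)
      have "h\<^sup>2 * deriv (deriv (psi h)) x = (v x - lam) * psi h x" using eq by (simp add: algebra_simps)
      then have "deriv (deriv (psi h)) x = (v x - lam) * psi h x / h\<^sup>2"
        using h by (simp add: field_simps)
      then show "(deriv (psi h) has_real_derivative (v x - lam) * psi h x / h\<^sup>2) (at x)"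
        using d by (metis DERIV_deriv_iff_real_differentiable)
    qed
    then show ?case using elim by blast
  qed
  have V_nonneg: "0 \<le> v x - lam" if "x \<in> {b1..b2}" for x
    using above[of x] that b by (cases "x = b1 \<or> x = b2") auto
  define Th1 where "Th1 = phase_function 1 v lam b1"
  have Th1_der: "(Th1 has_real_derivative - sqrt (lam - v x)) (at x)" if "x \<in> I" for x
    unfolding Th1_def phase_function_def
    using DERIV_minus[OF oriented_integral_der[OF I b(1) that root_cont]] by simp
  have I1: "einterval x1 (ereal b1) = {x\<in>I. x < b1}"
  proof -
    have "ereal x < x2" if "x < b1" for x
    proof -
      have "ereal x < ereal b1" "ereal b1 < x2" using that b(1) by (simp_all add: I_def einterval_iff)
      then show ?thesis by (rule less_trans)
    qed
    then show ?thesis by (auto simp: I_def einterval_iff)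
  qed
  have "\<exists>A th. (\<forall>h. A h > 0) \<and>
    (\<forall>h. psi h m * deriv (psi h) m \<le> 0 \<longrightarrow> (\<exists>k::int. th h = pi / 4 + of_int k * pi)) \<and>
    (\<forall>a c. {a..c} \<subseteq> {x\<in>I. x < b1} \<longrightarrow> (\<exists>C. \<forall>\<^sub>F h in at_right 0. small_remainder C h {a..c}
       (\<lambda>x. psi h x / (A h * (- (v x - lam)) powr (- 1 / 4)) - sin (Th1 x / h + th h))))"
  proof (rule one_sided_wkb[OF I b(1) mI m(1), where U=U1 and ?V1.0="deriv v" and
        ?V2.0="deriv (deriv v)" and ?V3.0="deriv (deriv (deriv v))"])
    show "(deriv v has_real_derivative deriv (deriv v) x) (at x)" if "x \<in> I" for x
      by (rule v1_der[OF that])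
    show "(deriv (deriv v) has_real_derivative deriv (deriv (deriv v)) x) (at x)" if "x \<in> U1" for x
      by (rule v2_der[OF U1(4) that])
    show "continuous_on I (deriv (deriv v))" by (rule v2_cont)
    show "continuous_on U1 (deriv (deriv (deriv v)))" by (rule v3_cont[OF U1(4)])
    show "open U1" "b1 \<in> U1" "U1 \<subseteq> I" by (rule U1)+
    show "v b1 - lam = 0" "deriv v b1 > 0" using b slopes by simp_all
    show "\<forall>\<^sub>F h in at_right 0. sol_on h (\<lambda>x. v x - lam) I (psi h) (deriv (psi h)) \<and> (\<exists>x\<in>I. psi h x \<noteq> 0)"
      by (rule sol)
    show "((\<lambda>x. v x - lam) has_real_derivative deriv v x) (at x)" if "x \<in> I" for x
      using DERIV_diff[OF v_der[OF that] DERIV_const] by simp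
    show "continuous_on I Th1"
      by (rule DERIV_continuous_on[OF has_field_derivative_at_within[OF Th1_der]])
    show "Th1 b1 = 0" by (simp add: Th1_def phase_function_def)
    show "v x - lam < 0" if "x \<in> I" "x < b1" for x using below[of x] that by auto
    show "0 \<le> v x - lam" if "x \<in> {b1..m}" for x using V_nonneg[of x] that m by auto
    show "(Th1 has_real_derivative - sqrt (- (v x - lam))) (at x)" if "x \<in> I" for x
      using Th1_der[OF that] by simp
  qed
  then obtain A1 th1 where A1: "\<And>h. A1 h > 0"
    "\<And>h. psi h m * deriv (psi h) m \<le> 0 \<Longrightarrow> \<exists>k::int. th1 h = pi / 4 + of_int k * pi"
    and w1: "\<And>a c. {a..c} \<subseteq> {x\<in>I. x < b1} \<Longrightarrow> \<exists>C. \<forall>\<^sub>F h in at_right 0. small_remainder C h {a..c}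
       (\<lambda>x. psi h x / (A1 h * (- (v x - lam)) powr (- 1 / 4)) - sin (Th1 x / h + th1 h))"
    by blast
  have W1: "wkb_asymptotics v lam Th1 (einterval x1 (ereal b1)) psi A1 th1"
  proof (rule wkb_asymptoticsI[OF A1(1)])
    show "v x < lam" if "x \<in> einterval x1 (ereal b1)" for x
      using below[of x] that unfolding I1 by auto
  qed (use w1 in \<open>simp add: I1\<close>)
  define Th2 where "Th2 = phase_function 2 v lam b2"
  have Th2_der: "(Th2 has_real_derivative sqrt (lam - v x)) (at x)" if "x \<in> I" for x
    unfolding Th2_def phase_function_def
    using oriented_integral_der[OF I b(2) that root_cont] by simp
  have I2: "einterval (ereal b2) x2 = {x\<in>I. b2 < x}"
  proof -
    have "x1 < ereal x" if "b2 < x" for x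
    proof -
      have "x1 < ereal b2" "ereal b2 < ereal x" using that b(2) by (simp_all add: I_def einterval_iff)
      then show ?thesis by (rule less_trans)
    qed
    then show ?thesis by (auto simp: I_def einterval_iff)
  qed
  \<comment> \<open>The right side is reduced to the left side by reflection; \<open>psi h * deriv (psi h)\<close> changes its sign at \<open>m\<close>.\<close>
  define J where "J = uminus ` I"
  have J_iff: "x \<in> J \<longleftrightarrow> - x \<in> I" for x unfolding J_def by (metis image_iff minus_minus)
  have J: "open J" "is_interval J" unfolding J_def using I by (auto intro: open_negations is_interval_neg_translationI)
  have refl_der: "((\<lambda>x. G (- x)) has_real_derivative - D) (at x)" if "(G has_real_derivative D) (at (- x))" for G D x
    using DERIV_chain2[where f=G and g=uminus, OF that DERIV_minus[OF DERIV_ident]] by simp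
  have refl_cont: "continuous_on (uminus ` T) (\<lambda>x. G (- x))" if "continuous_on T G" for G :: "real \<Rightarrow> real" and T
    by (rule continuous_on_compose2[OF that]) (auto intro!: continuous_intros)
  have "\<exists>A th. (\<forall>h. A h > 0) \<and>
    (\<forall>h. psi h (- (- m)) * (- deriv (psi h) (- (- m))) \<le> 0 \<longrightarrow> (\<exists>k::int. th h = pi / 4 + of_int k * pi)) \<and>
    (\<forall>a c. {a..c} \<subseteq> {x\<in>J. x < - b2} \<longrightarrow> (\<exists>C. \<forall>\<^sub>F h in at_right 0. small_remainder C h {a..c}
       (\<lambda>x. psi h (- x) / (A h * (- (v (- x) - lam)) powr (- 1 / 4)) - sin (Th2 (- x) / h + th h))))"
  proof (rule one_sided_wkb[OF J, where U="uminus ` U2" and ?V1.0="\<lambda>x. - deriv v (- x)" and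
        ?V2.0="\<lambda>x. deriv (deriv v) (- x)" and ?V3.0="\<lambda>x. - deriv (deriv (deriv v)) (- x)"])
    show "((\<lambda>x. v (- x) - lam) has_real_derivative - deriv v (- x)) (at x)" if "x \<in> J" for x
      using DERIV_diff[OF refl_der[OF v_der] DERIV_const, of x lam] that by (simp add: J_iff)
    show "((\<lambda>x. - deriv v (- x)) has_real_derivative deriv (deriv v) (- x)) (at x)" if "x \<in> J" for x
      using DERIV_minus[OF refl_der[OF v1_der, of x]] that by (simp add: J_iff)
    show "continuous_on J (\<lambda>x. deriv (deriv v) (- x))" unfolding J_def by (rule refl_cont[OF v2_cont])
    show "((\<lambda>x. deriv (deriv v) (- x)) has_real_derivative - deriv (deriv (deriv v)) (- x)) (at x)"
      if "x \<in> uminus ` U2" for x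
      using that by (intro refl_der v2_der[OF U2(4)]) auto
    show "continuous_on (uminus ` U2) (\<lambda>x. - deriv (deriv (deriv v)) (- x))"
      by (intro continuous_intros refl_cont v3_cont U2)
    show "open (uminus ` U2)" using U2(1) by (rule open_negations)
    show "uminus ` U2 \<subseteq> J" unfolding J_def using U2(3) by blast
    show "continuous_on J (\<lambda>x. Th2 (- x))"
      unfolding J_def by (rule refl_cont[OF DERIV_continuous_on[OF has_field_derivative_at_within[OF Th2_der]]])
    show "Th2 (- (- b2)) = 0" by (simp add: Th2_def phase_function_def)
    show "v (- x) - lam < 0" if "x \<in> J" "x < - b2" for x using below[of "- x"] that by (auto simp: J_iff)
    show "0 \<le> v (- x) - lam" if "x \<in> {- b2..- m}" for x using V_nonneg[of "- x"] that m by auto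
    show "((\<lambda>x. Th2 (- x)) has_real_derivative - sqrt (- (v (- x) - lam))) (at x)" if "x \<in> J" for x
      using refl_der[OF Th2_der, of x] that by (simp add: J_iff)
    show "\<forall>\<^sub>F h in at_right 0. sol_on h (\<lambda>x. v (- x) - lam) J (\<lambda>x. psi h (- x)) (\<lambda>x. - deriv (psi h) (- x)) \<and>
        (\<exists>x\<in>J. psi h (- x) \<noteq> 0)"
      using sol
    proof eventually_elim
      case (elim h)
      have "sol_on h (\<lambda>x. v (- x) - lam) J (\<lambda>x. psi h (- x)) (\<lambda>x. - deriv (psi h) (- x))"
        unfolding sol_on_def
      proof (intro ballI conjI)
        fix x assume "x \<in> J"
        then have x: "- x \<in> I" by (simp add: J_iff)
        show "((\<lambda>x. psi h (- x)) has_real_derivative - deriv (psi h) (- x)) (at x)"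
          by (rule refl_der[OF sol_onD(1)[OF conjunct1[OF elim] x]])
        show "((\<lambda>x. - deriv (psi h) (- x)) has_real_derivative (v (- x) - lam) * psi h (- x) / h\<^sup>2) (at x)"
          using DERIV_minus[OF refl_der[OF sol_onD(2)[OF conjunct1[OF elim] x]]] by simp
      qed
      moreover have "\<exists>x\<in>J. psi h (- x) \<noteq> 0" using elim unfolding J_def by force
      ultimately show ?case ..
    qed
    show "- b2 \<in> J" "- m \<in> J" using b mI by (simp_all add: J_iff)
    show "- b2 < - m" using m by simp
    show "- b2 \<in> uminus ` U2" using U2(2) by simp
    show "v (- (- b2)) - lam = 0" "- deriv v (- (- b2)) > 0" using b slopes by simp_all
  qed
  then obtain A2 th2 where A2: "\<And>h. A2 h > 0"
    "\<And>h. psi h (- (- m)) * (- deriv (psi h) (- (- m))) \<le> 0 \<Longrightarrow> \<exists>k::int. th2 h = pi / 4 + of_int k * pi"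
    and w2: "\<And>a c. {a..c} \<subseteq> {x\<in>J. x < - b2} \<Longrightarrow> \<exists>C. \<forall>\<^sub>F h in at_right 0. small_remainder C h {a..c}
       (\<lambda>x. psi h (- x) / (A2 h * (- (v (- x) - lam)) powr (- 1 / 4)) - sin (Th2 (- x) / h + th2 h))"
    by blast
  have W2: "wkb_asymptotics v lam Th2 (einterval (ereal b2) x2) psi A2 th2"
  proof (rule wkb_asymptoticsI[OF A2(1)])
    show "v x < lam" if "x \<in> einterval (ereal b2) x2" for x
      using below[of x] that unfolding I2 by auto
    fix a c assume "{a..c} \<subseteq> einterval (ereal b2) x2"
    then have ac: "x \<in> I \<and> b2 < x" if "x \<in> {a..c}" for x using that unfolding I2 by blast
    have "{- c..- a} \<subseteq> {x\<in>J. x < - b2}"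
    proof
      fix x assume "x \<in> {- c..- a}"
      then have "- x \<in> {a..c}" by auto
      from ac[OF this] show "x \<in> {x\<in>J. x < - b2}" by (simp add: J_iff)
    qed
    from w2[OF this] obtain C where C: "\<forall>\<^sub>F h in at_right 0. small_remainder C h {- c..- a}
       (\<lambda>x. psi h (- x) / (A2 h * (- (v (- x) - lam)) powr (- 1 / 4)) - sin (Th2 (- x) / h + th2 h))" by blast
    from C have "\<forall>\<^sub>F h in at_right 0. small_remainder C h {a..c}
       (\<lambda>x. psi h x / (A2 h * (lam - v x) powr (- 1 / 4)) - sin (Th2 x / h + th2 h))"
    proof eventually_elim
      case (elim h)
      show ?case
        unfolding small_remainder_def
      proof
        fix x assume "x \<in> {a..c}"
        then have "- x \<in> {- c..- a}" by auto
        from elim[unfolded small_remainder_def, rule_format, OF this] obtain D where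
          1: "\<bar>psi h x / (A2 h * (lam - v x) powr (- 1 / 4)) - sin (Th2 x / h + th2 h)\<bar> \<le> C * h"
          and D: "((\<lambda>x. psi h (- x) / (A2 h * (lam - v (- x)) powr (- 1 / 4)) - sin (Th2 (- x) / h + th2 h)) has_real_derivative D) (at (- x))"
          and D_le: "\<bar>D\<bar> \<le> C" by auto
        from refl_der[OF D]
        have D': "((\<lambda>x. psi h x / (A2 h * (lam - v x) powr (- 1 / 4)) - sin (Th2 x / h + th2 h)) has_real_derivative - D) (at x)"
          by simp
        show "\<bar>psi h x / (A2 h * (lam - v x) powr (- 1 / 4)) - sin (Th2 x / h + th2 h)\<bar> \<le> C * h \<and>
         (\<exists>D. ((\<lambda>x. psi h x / (A2 h * (lam - v x) powr (- 1 / 4)) - sin (Th2 x / h + th2 h)) has_real_derivative D) (at x)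
          \<and> \<bar>D\<bar> \<le> C)"
          by (intro conjI 1 exI[of _ "- D"] D') (use D_le in simp)
      qed
    qed
    then show "\<exists>C. \<forall>\<^sub>F h in at_right 0. small_remainder C h {a..c}
       (\<lambda>x. psi h x / (A2 h * (lam - v x) powr (- 1 / 4)) - sin (Th2 x / h + th2 h))" by blast
  qed
  have "(\<exists>k::int. th1 h = pi / 4 + of_int k * pi) \<or> (\<exists>k::int. th2 h = pi / 4 + of_int k * pi)" for h
    using A1(2)[of h] A2(2)[of h] by (cases "psi h m * deriv (psi h) m \<le> 0") auto
  then show ?thesis
    using A1(1) A2(1) W1 W2 unfolding Th1_def Th2_def
    by - (rule exI[of _ A1], rule exI[of _ A2], rule exI[of _ th1], rule exI[of _ th2], simp)
qed

end
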